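(* Let $k$ be a positive integer. For each word $w\in[\overline{k}]^{*}$ there exists a unique King tableau $T\in \mathrm{KT}_k$ such that $w\equiv_{C}\operatorname{row}T$. In particular, $T=P_{C}(w)$.
   Context: Alphabet and tableaux. $[\overline{k}]=\{1,\overline1,\dots,k,\overline k\}$ with the total order $1<\overline1<2<\overline2<\cdots<k<\overline k$; $[\overline k]^{*}$ is the set of all finite words (including the empty word) in $[\overline k]$. Partitions are identified with Young diagrams in English notation. A King tableau of shape $\lambda$ is a filling of the Young diagram $\lambda$ by elements of $[\overline k]$ such that entries weakly increase along rows, strictly increase down columns, and all entries in row $i$ are $\ge i$ (for the order $1<\overline1<2<\overline2<\cdots<k<\overline k$) for every $i$. $\mathrm{KT}_k(\lambda)$ is the set of these and $\mathrm{KT}_k=\bigcup_\lambda \mathrm{KT}_k(\lambda)$ (the empty tableau is included). The row word $\operatorname{row}T$ is obtained by reading the rows of $T$ from bottom to top, each row from left to right. Berele insertion $T\leftarrow_C x$ ($T\in\mathrm{KT}_k$, $x\in[\overline k]$). Start as in Schensted row insertion: insert $x$ into row 1; inserting a letter $a$ into a row replaces (bumps) the leftmost entry that is strictly larger than $a$, and the bumped entry is then inserted into the next row; if no entry of the row is larger than $a$, then $a$ is put at the end of the row and the procedure stops. Exception: if at some moment the letter $i$ is to be inserted into row $i$ and row $i$ contains at least one $\overline i$, then instead: replace the first $\overline i$ of row $i$ by $i$, replace the first $i$ of row $i$ by an empty box, and play jeu de taquin with this empty box: repeatedly, if the empty box has a box with entry $b$ below it and/or a box with entry $r$ to its right, slide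 $b$ up when only $b$ exists or when both exist and $b\le r$, and slide $r$ left when only $r$ exists or when both exist and $b>r$; once the empty box is at a corner of the shape, delete it and stop. The result is again a King tableau. For a word $w=w_1\cdots w_n$, $P_C(w)=(\cdots((\emptyset\leftarrow_C w_1)\leftarrow_C w_2)\cdots)\leftarrow_C w_n$. Knuth equivalences. $\equiv_A$ is the equivalence relation on $[\overline k]^{*}$ generated by the following replacements of three adjacent letters in a word: $yxz\leftrightarrow yzx$ for $x<y\le z$, and $xzy\leftrightarrow zxy$ for $x\le y<z$. A column word is a word $c=c_n\cdots c_1$ in $[\overline k]$ with $c_{i+1}>c_i$ for all $i$ (the empty word is allowed). For column words, $c\sim c'$ means $P_C(c)=P_C(c')$. Write $w\equiv_5 w'$ if there exist a word $v$ and column words $c,c'$ with $w\equiv_A cv$, $w'\equiv_A c'v$ and $c\sim c'$. Type C Knuth equivalence $\equiv_C$: $w\equiv_C w'$ if there is a finite sequence of words $w=w_0,w_1,\dots,w_n=w'$ such that each $w_{j+1}$ is obtained from $w_j$ by one of the three-letter replacements $yxz\leftrightarrow yzx$ (for $x<y\le z$) and $xzy\leftrightarrow zxy$ (for $x\le y<z$) or satisfies $w_j\equiv_5 w_{j+1}$. *)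

theory Defs
  imports Main
begin

text \<open>\<open>Plain i\<close> is the letter \<open>i\<close> and \<open>Barred i\<close> is the barred letter. The type contains letters of all
  indices; the alphabet with bound \<open>k\<close> is the set \<open>alphabet k\<close>.\<close>

datatype letter = Plain nat | Barred nat

fun letter_rank :: "letter \<Rightarrow> nat" where
  "letter_rank (Plain i) = 2 * i"
| "letter_rank (Barred i) = 2 * i + 1"

lemma letter_rank_inject: "letter_rank a = letter_rank b \<longleftrightarrow> a = b"
  by (cases a; cases b) (auto, presburger+)

instantiation letter :: linorder
begin

definition less_eq_letter :: "letter \<Rightarrow> letter \<Rightarrow> bool" where
  "a \<le> b \<longleftrightarrow> letter_rank a \<le> letter_rank b"

definition less_letter :: "letter \<Rightarrow> letter \<Rightarrow> bool" where
  "a < b \<longleftrightarrow> letter_rank a < letter_rank b"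

instance
  by standard (auto simp: less_eq_letter_def less_letter_def letter_rank_inject)

end

definition alphabet :: "nat \<Rightarrow> letter set" where
  "alphabet k = Plain ` {1..k} \<union> Barred ` {1..k}"

definition words :: "nat \<Rightarrow> letter list set" where
  "words k = lists (alphabet k)"

text \<open>A tableau is the list of its rows, from top to bottom. Since lists are indexed from 0, row
  number \<open>i\<close> of the diagram is \<open>T ! (i - 1)\<close>.\<close>

type_synonym tableau = "letter list list"

definition is_partition :: "nat list \<Rightarrow> bool" where
  "is_partition L \<longleftrightarrow> sorted_wrt (\<ge>) L \<and> 0 \<notin> set L"

definition king_tableaux_of_shape :: "nat \<Rightarrow> nat list \<Rightarrow> tableau set" where
  "king_tableaux_of_shape k L = {T. map length T = L
     \<and> (\<forall>R \<in> set T. set R \<subseteq> alphabet k)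
     \<and> (\<forall>R \<in> set T. sorted R)
     \<and> (\<forall>i j. Suc i < length T \<longrightarrow> j < length (T ! Suc i) \<longrightarrow> T ! i ! j < T ! Suc i ! j)
     \<and> (\<forall>i < length T. \<forall>a \<in> set (T ! i). Plain (i + 1) \<le> a)}"

definition king_tableaux :: "nat \<Rightarrow> tableau set" where
  "king_tableaux k = (\<Union>L \<in> {L. is_partition L}. king_tableaux_of_shape k L)"

definition row_word :: "tableau \<Rightarrow> letter list" where
  "row_word T = concat (rev T)"

text \<open>\<open>jdt T r c\<close> plays jeu de taquin on \<open>T\<close> with the empty box in position \<open>(r, c)\<close>, both
  coordinates counted from 0. The entry of \<open>T\<close> stored in that position is a placeholder and is
  never read. At a corner, the empty box is the last box of its row, and it is deleted together
  with the row if the row has no other box.\<close>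

function jdt :: "tableau \<Rightarrow> nat \<Rightarrow> nat \<Rightarrow> tableau" where
  "jdt T r c =
    (let below = (r + 1 < length T \<and> c < length (T ! (r + 1)));
         right = (r < length T \<and> c + 1 < length (T ! r))
     in if below \<and> (right \<longrightarrow> T ! (r + 1) ! c \<le> T ! r ! (c + 1))
        then jdt (T[r := (T ! r)[c := T ! (r + 1) ! c]]) (r + 1) c
        else if right
        then jdt (T[r := (T ! r)[c := T ! r ! (c + 1)]]) r (c + 1)
        else filter (\<lambda>R. R \<noteq> []) (T[r := butlast (T ! r)]))"
  by pat_completeness auto
termination
  by (relation "measures [\<lambda>(T, r, c). length T - r, \<lambda>(T, r, c). length (T ! r) - c]")
    (auto simp: Let_def)

declare jdt.simps [simp del]

text \<open>Position (from 0) of the first occurrence of a letter that occurs in the row.\<close>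

definition first_pos :: "letter \<Rightarrow> letter list \<Rightarrow> nat" where
  "first_pos a R = length (takeWhile (\<lambda>b. b \<noteq> a) R)"

text \<open>Schensted insertion into one row; the second component is the bumped letter, if any.\<close>

fun row_insert :: "letter \<Rightarrow> letter list \<Rightarrow> letter list \<times> letter option" where
  "row_insert a [] = ([a], None)"
| "row_insert a (b # R) =
    (if a < b then (a # R, Some b)
     else let (R', out) = row_insert a R in (b # R', out))"

text \<open>\<open>berele_from i Rs a\<close> inserts \<open>a\<close> into row number \<open>i\<close> (counted from 1), where \<open>Rs\<close> consists of
  the rows \<open>i, i + 1, \<dots>\<close> of the tableau. The rows above are not needed, because neither bumping
  nor the moving empty box ever goes upwards.\<close>

fun berele_from :: "nat \<Rightarrow> tableau \<Rightarrow> letter \<Rightarrow> tableau" where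
  "berele_from i [] a = [[a]]"
| "berele_from i (R # Rs) a =
    (if a = Plain i \<and> Barred i \<in> set R
     then let R' = R[first_pos (Barred i) R := Plain i]
          in jdt (R' # Rs) 0 (first_pos (Plain i) R')
     else case row_insert a R of
            (R', None) \<Rightarrow> R' # Rs
          | (R', Some b) \<Rightarrow> R' # berele_from (i + 1) Rs b)"

definition berele_insert :: "tableau \<Rightarrow> letter \<Rightarrow> tableau" where
  "berele_insert T x = berele_from 1 T x"

definition P_C :: "letter list \<Rightarrow> tableau" where
  "P_C w = foldl berele_insert [] w"

inductive knuth_step :: "letter list \<Rightarrow> letter list \<Rightarrow> bool" where
  "x < y \<Longrightarrow> y \<le> z \<Longrightarrow> knuth_step (u @ [y, x, z] @ v) (u @ [y, z, x] @ v)"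
| "x \<le> y \<Longrightarrow> y < z \<Longrightarrow> knuth_step (u @ [x, z, y] @ v) (u @ [z, x, y] @ v)"

text \<open>A Knuth step permutes the letters of a word, so restricting the two ends to \<open>words k\<close>
  restricts all intermediate words.\<close>

definition equiv_A :: "nat \<Rightarrow> letter list \<Rightarrow> letter list \<Rightarrow> bool" where
  "equiv_A k w w' \<longleftrightarrow> w \<in> words k \<and> w' \<in> words k \<and> equivclp knuth_step w w'"

text \<open>A column word \<open>c\<^sub>n \<dots> c\<^sub>1\<close> with \<open>c\<^sub>i\<^sub>+\<^sub>1 > c\<^sub>i\<close> is strictly decreasing when read from
  left to right.\<close>

definition column_words :: "nat \<Rightarrow> letter list set" where
  "column_words k = {c \<in> words k. sorted_wrt (>) c}"

definition equiv_5 :: "nat \<Rightarrow> letter list \<Rightarrow> letter list \<Rightarrow> bool" where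
  "equiv_5 k w w' \<longleftrightarrow> (\<exists>v \<in> words k. \<exists>c \<in> column_words k. \<exists>c' \<in> column_words k.
     equiv_A k w (c @ v) \<and> equiv_A k w' (c' @ v) \<and> P_C c = P_C c')"

definition step_C :: "nat \<Rightarrow> letter list \<Rightarrow> letter list \<Rightarrow> bool" where
  "step_C k w w' \<longleftrightarrow> w \<in> words k \<and> w' \<in> words k \<and>
     (knuth_step w w' \<or> knuth_step w' w \<or> equiv_5 k w w')"

definition equiv_C :: "nat \<Rightarrow> letter list \<Rightarrow> letter list \<Rightarrow> bool" where
  "equiv_C k w w' \<longleftrightarrow> w \<in> words k \<and> w' \<in> words k \<and> (step_C k)\<^sup>*\<^sup>* w w'"

end

(* Columns are sets of letters, and a tableau is read as a tuple of columns. Two kinds of moves shorten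
   or straighten such a tuple: moving a letter to the column on its left, which is a Knuth equivalence
   when the letter is chosen by the signature rule, and deleting a pair i, bar i from the first column.
   These are the raising operators of a crystal of type C (Howe dual to the symplectic group); the King
   tableaux are the highest weight elements, and one step of Berele insertion is a Knuth equivalence
   possibly followed by one deletion. Hence the theorem amounts to confluence. By uniqueness of the
   Schensted tableau in a Knuth class and induction on the length of the word, only the deletion and a
   move between the first two columns can interfere, and there the local relations of a crystal of
   type C_2 hold. Therefore P_C is constant on the classes of the equivalence. *)

theory Submission
  imports Defs "HOL-Library.Multiset"
begin

text \<open>Rows increase weakly, so a tableau is King as soon as its first column is. Deletions
  therefore concern the first column alone and are undisturbed by moves between later columns; moves
  among themselves stay in one Knuth class, which contains a single tableau. The obstacle is that a
  word splits in many ways, up to Knuth equivalence, into a column and a rest, and each splitting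
  offers its own deletion. All of these are compared with one deletion, that from the first column
  of the Schensted tableau. Both operators are read off from integer sequences, \<open>hgt\<close>
  and \<open>excess\<close>, that grow by at most one per step; the operator acts at the first
  maximum. A deletion lifts \<open>hgt\<close> by two beyond its pair, whereas a move lifts
  \<open>excess\<close> by one only. This asymmetry is the double bond of the Dynkin diagram, and it
  is why up to three consecutive moves, at the levels \<open>m + 2\<close>, \<open>m + 1\<close> and
  \<open>m\<close>, occur between two deletions.\<close>

abbreviation knuth :: "letter list \<Rightarrow> letter list \<Rightarrow> bool"  (infix "\<approx>" 50) where
  "knuth \<equiv> equivclp knuth_step"

section \<open>Knuth equivalence as a congruence that preserves the content\<close>

lemma knuth_refl [simp, intro]: "w \<approx> w"
  by simp

lemma knuth_sym: "w \<approx> w' \<Longrightarrow> w' \<approx> w"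
  by (rule equivclp_sym)

lemma knuth_trans [trans]: "u \<approx> v \<Longrightarrow> v \<approx> w \<Longrightarrow> u \<approx> w"
  by (rule equivclp_trans)

lemma knuth_step_context:
  assumes "knuth_step w w'"
  shows "knuth_step (u @ w @ v) (u @ w' @ v)"
  using assms
proof cases
  case (1 x y z u' v')
  then show ?thesis using knuth_step.intros(1)[of x y z "u @ u'" "v' @ v"] by simp
next
  case (2 x y z u' v')
  then show ?thesis using knuth_step.intros(2)[of x y z "u @ u'" "v' @ v"] by simp
qed

lemma knuth_context: "w \<approx> w' \<Longrightarrow> u @ w @ v \<approx> u @ w' @ v"
proof (induction rule: equivclp_induct)
  case base
  then show ?case by simp
next
  case (step y z)
  then have "knuth_step (u @ y @ v) (u @ z @ v) \<or> knuth_step (u @ z @ v) (u @ y @ v)"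
    using knuth_step_context by blast
  with step.IH show ?case
    by (metis equivclp_into_equivclp)
qed

lemma knuth_append_left: "w \<approx> w' \<Longrightarrow> u @ w \<approx> u @ w'"
  using knuth_context[of w w' u "[]"] by simp

lemma knuth_append_right: "w \<approx> w' \<Longrightarrow> w @ v \<approx> w' @ v"
  using knuth_context[of w w' "[]" v] by simp

lemma knuth_Cons: "w \<approx> w' \<Longrightarrow> a # w \<approx> a # w'"
  using knuth_append_left[of w w' "[a]"] by simp

lemma knuth_mset: "w \<approx> w' \<Longrightarrow> mset w = mset w'"
  by (induction rule: equivclp_induct) (auto elim!: knuth_step.cases)

lemma knuth_yxz: "x < y \<Longrightarrow> y \<le> z \<Longrightarrow> u @ [y, x, z] @ v \<approx> u @ [y, z, x] @ v"
  by (intro r_into_equivclp knuth_step.intros)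

lemma knuth_xzy: "x \<le> y \<Longrightarrow> y < z \<Longrightarrow> u @ [x, z, y] @ v \<approx> u @ [z, x, y] @ v"
  by (intro r_into_equivclp knuth_step.intros)

lemma knuth_length: "w \<approx> w' \<Longrightarrow> length w = length w'"
  using knuth_mset mset_eq_length by blast

lemma knuth_set: "w \<approx> w' \<Longrightarrow> set w = set w'"
  using knuth_mset mset_eq_setD by blast

section \<open>Rows\<close>

text \<open>The letter \<open>a\<close> passes the letters of \<open>N\<close> from right to left;
  the witness is always the letter in front of the one passed, in the end \<open>b\<close>
  itself.\<close>

lemma knuth_pull_back:
  assumes "a < b" "\<forall>n\<in>set N. b \<le> n" "sorted N"
  shows "b # N @ [a] \<approx> b # a # N"
  using assms(2,3)
proof (induction N rule: rev_induct)
  case Nil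
  then show ?case by simp
next
  case (snoc n N)
  have IH: "b # N @ [a] \<approx> b # a # N"
    using snoc by (auto simp: sorted_append)
  have "b # N @ [n, a] \<approx> b # N @ [a, n]"
  proof (cases N rule: rev_cases)
    case Nil
    then show ?thesis using knuth_yxz[of a b n "[]" "[]"] snoc.prems assms(1)
      by (auto intro: knuth_sym)
  next
    case (snoc N' m)
    then have "a < m" "m \<le> n" using snoc.prems assms(1) by (auto simp: sorted_append)
    then show ?thesis using knuth_yxz[of a m n "b # N'" "[]"] snoc
      by (auto intro: knuth_sym)
  qed
  also have "\<dots> \<approx> b # a # N @ [n]"
    using knuth_append_right[OF IH, of "[n]"] by simp
  finally show ?case by simp
qed

text \<open>Here \<open>b\<close> travels and the letter just passed is the witness for the next
  one, beginning with \<open>a\<close>. The changing witness is why the induction generalizes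
  \<open>a\<close>.\<close>

lemma knuth_push_front:
  assumes "a < b" "\<forall>p\<in>set P. p \<le> a" "sorted P"
  shows "P @ [b, a] \<approx> b # P @ [a]"
  using assms
proof (induction P arbitrary: a rule: rev_induct)
  case Nil
  then show ?case by simp
next
  case (snoc p P)
  have "P @ [p, b, a] \<approx> P @ [b, p, a]"
    using knuth_xzy[of p a b P "[]"] snoc.prems by auto
  also have "\<dots> \<approx> b # P @ [p, a]"
    using knuth_append_right[OF snoc.IH[of p], of "[a]"] snoc.prems by (auto simp: sorted_append)
  finally show ?case by simp
qed

text \<open>One row of Schensted insertion: \<open>a\<close> is first brought next to the letter
  that it bumps, then that letter leaves at the front.\<close>

lemma knuth_bump:
  assumes "sorted (P @ b # N)" "\<forall>p\<in>set P. p \<le> a" "a < b"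
  shows "P @ b # N @ [a] \<approx> b # P @ a # N"
proof -
  have "P @ b # N @ [a] \<approx> P @ b # a # N"
    using knuth_append_left[OF knuth_pull_back[OF assms(3)]] assms(1) by (auto simp: sorted_append)
  also have "\<dots> \<approx> b # P @ a # N"
    using knuth_append_right[OF knuth_push_front[OF assms(3,2)], of N] assms(1)
    by (auto simp: sorted_append)
  finally show ?thesis .
qed

text \<open>The letters of \<open>A\<close> are inserted from left to right, and each bumps its
  partner in \<open>C\<close>; what has been inserted joins \<open>L\<close>.\<close>

lemma knuth_bump_block:
  assumes "sorted (L @ C @ N)" "sorted (L @ A @ N)" "length A = length C" "list_all2 (<) A C"
  shows "L @ C @ N @ A \<approx> C @ L @ A @ N"
  using assms(4,1,2)
proof (induction A C arbitrary: L rule: list_all2_induct)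
  case Nil
  then show ?case by simp
next
  case (Cons a A c C)
  have "L @ c # (C @ N) @ [a] \<approx> c # L @ a # C @ N"
    using Cons.prems Cons.hyps by (intro knuth_bump) (auto simp: sorted_append)
  from knuth_append_right[OF this, of A]
  have "L @ (c # C) @ N @ a # A \<approx> c # (L @ [a]) @ C @ N @ A"
    by simp
  also have "\<dots> \<approx> c # C @ (L @ [a]) @ A @ N"
    using Cons.prems Cons.hyps
    by (intro knuth_Cons Cons.IH) (auto simp: sorted_append intro: order.trans less_imp_le)
  finally show ?case by simp
qed

section \<open>Pairs of rows, and gluing a column to a tableau\<close>

definition above :: "letter list \<Rightarrow> letter list \<Rightarrow> bool" where
  "above P Q \<longleftrightarrow> length Q \<le> length P \<and> (\<forall>m < length Q. P ! m < Q ! m)"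

lemma above_Nil [simp]: "above P []" "above [] Q \<longleftrightarrow> Q = []"
  by (auto simp: above_def)

lemma above_Cons [simp]: "above (p # P) (q # Q) \<longleftrightarrow> p < q \<and> above P Q"
  by (auto simp: above_def nth_Cons split: nat.splits)

lemma above_tl: "above P Q \<Longrightarrow> above (tl P) (tl Q)"
  by (cases P; cases Q) auto

lemma above_split:
  assumes "above P Q"
  obtains P1 P2 where "P = P1 @ P2" "list_all2 (<) P1 Q"
proof
  show "P = take (length Q) P @ drop (length Q) P" by simp
  show "list_all2 (<) (take (length Q) P) Q"
    using assms by (auto simp: above_def list_all2_conv_all_nth)
qed

text \<open>Inserting \<open>R\<close> into the row \<open>a # R'\<close> bumps out exactly
  \<open>R'\<close>, because \<open>a\<close> is small enough to stay and each letter of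
  \<open>R'\<close> exceeds its partner in \<open>R\<close>.\<close>

lemma knuth_swap_rows:
  assumes "sorted (a # R)" "sorted R'" "above R R'"
  shows "a # R' @ R \<approx> R' @ a # R"
proof (cases R')
  case Nil
  then show ?thesis by simp
next
  case (Cons r R'')
  obtain P1 P2 where P: "R = P1 @ P2" "list_all2 (<) P1 R'"
    using assms(3) by (rule above_split)
  have "a \<le> r"
    using assms P Cons by (cases P1) auto
  have "[a] @ R' @ [] @ P1 \<approx> R' @ [a] @ P1 @ []"
    using assms P Cons \<open>a \<le> r\<close>
    by (intro knuth_bump_block) (auto simp: sorted_append list_all2_lengthD)
  from knuth_append_right[OF this, of P2] show ?thesis
    using P by simp
qed

text \<open>Empty rows are allowed at the bottom.\<close>

fun tab :: "tableau \<Rightarrow> bool" where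
  "tab [] \<longleftrightarrow> True"
| "tab (R # Rs) \<longleftrightarrow> sorted R \<and> (case Rs of [] \<Rightarrow> True | R' # _ \<Rightarrow> above R R') \<and> tab Rs"

lemma row_word_simps [simp]: "row_word [] = []" "row_word (R # Rs) = row_word Rs @ R"
  by (simp_all add: row_word_def)

lemma row_word_append: "row_word (Rs @ Rs') = row_word Rs' @ row_word Rs"
  by (simp add: row_word_def)

text \<open>Column strictness turns a lower bound of the first row into one of all rows, so
  \<open>knuth_swap_rows\<close> lets \<open>a\<close> pass one row after another.\<close>

lemma knuth_move_down:
  assumes "tab (R # Rs)" "\<forall>r\<in>set R. a \<le> r"
  shows "a # row_word (R # Rs) \<approx> row_word Rs @ a # R"
  using assms
proof (induction Rs arbitrary: R)
  case Nil
  then show ?case by simp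
next
  case (Cons R' Rs)
  have aR: "sorted (a # R)" "above R R'" "sorted R'"
    using Cons.prems by auto
  have "\<forall>r\<in>set R'. a \<le> r"
  proof
    fix r assume "r \<in> set R'"
    then obtain m where m: "m < length R'" "r = R' ! m" by (metis in_set_conv_nth)
    then have "R ! m < r" "R ! m \<in> set R" using aR by (auto simp: above_def)
    then show "a \<le> r" using Cons.prems(2) by fastforce
  qed
  then have "a # row_word (R' # Rs) \<approx> row_word Rs @ a # R'"
    using Cons by simp
  from knuth_append_right[OF this, of R]
  have "a # row_word (R # R' # Rs) \<approx> row_word Rs @ a # R' @ R"
    by simp
  also have "\<dots> \<approx> row_word Rs @ R' @ a # R"
    using knuth_swap_rows[of a R R'] aR by (intro knuth_append_left) auto
  finally show ?case by simp
qed

text \<open>Each entry of \<open>c\<close> is carried in front of the remainders of its own row and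
  of all lower rows. This is the bridge from row words to words of columns.\<close>

lemma knuth_attach_column:
  assumes "tab V" "length c = length V" "\<forall>m < length V. \<forall>r\<in>set (V ! m). c ! m \<le> r"
  shows "row_word (map2 (#) c V) \<approx> rev c @ row_word V"
  using assms
proof (induction V arbitrary: c)
  case Nil
  then show ?case by simp
next
  case (Cons R V)
  then obtain a c' where c: "c = a # c'" by (cases c) auto
  have "row_word (map2 (#) c' V) \<approx> rev c' @ row_word V"
    using Cons.prems c by (intro Cons.IH) (auto simp: nth_Cons split: nat.splits)
  from knuth_append_right[OF this, of "a # R"]
  have "row_word (map2 (#) c (R # V)) \<approx> rev c' @ row_word V @ a # R"
    using c by simp
  also have "\<dots> \<approx> rev c' @ a # row_word (R # V)"
    using Cons.prems c
    by (intro knuth_append_left knuth_sym[OF knuth_move_down]) auto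
  finally show ?case using c by simp
qed

section \<open>Columns\<close>

definition letter_of :: "nat \<Rightarrow> letter" where
  "letter_of n = (if even n then Plain (n div 2) else Barred (n div 2))"

lemma letter_rank_letter_of [simp]: "letter_rank (letter_of n) = n"
  by (simp add: letter_of_def)

lemma letter_of_letter_rank [simp]: "letter_of (letter_rank a) = a"
  by (simp flip: letter_rank_inject)

lemma letter_of_less_iff [simp]: "letter_of x < letter_of y \<longleftrightarrow> x < y"
  and letter_of_le_iff [simp]: "letter_of x \<le> letter_of y \<longleftrightarrow> x \<le> y"
  and letter_of_eq_iff [simp]: "letter_of x = letter_of y \<longleftrightarrow> x = y"
  by (auto simp: less_letter_def less_eq_letter_def simp flip: letter_rank_inject)

text \<open>A column is encoded by the set of the ranks of its letters.\<close>

definition column_word :: "nat set \<Rightarrow> letter list" where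
  "column_word A = map letter_of (rev (sorted_list_of_set A))"

lemma column_word_empty [simp]: "column_word {} = []"
  by (simp add: column_word_def)

lemma set_column_word: "finite A \<Longrightarrow> set (column_word A) = letter_of ` A"
  by (simp add: column_word_def)

lemma length_column_word [simp]: "length (column_word A) = card A"
  by (simp add: column_word_def)

lemma column_word_union:
  assumes "finite A" "finite B" "\<And>a b. a \<in> A \<Longrightarrow> b \<in> B \<Longrightarrow> a < b"
  shows "column_word (A \<union> B) = column_word B @ column_word A"
proof -
  have "A \<inter> B = {}" using assms(3) by force
  then have "sorted_list_of_set (A \<union> B) = sorted_list_of_set A @ sorted_list_of_set B"
    using assms
    by (intro sorted_distinct_set_unique) (auto simp: sorted_append intro: less_imp_le)
  then show ?thesis by (simp add: column_word_def)
qed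

lemma column_word_insert_min:
  assumes "finite A" "\<And>a. a \<in> A \<Longrightarrow> x < a"
  shows "column_word (insert x A) = column_word A @ [letter_of x]"
  using column_word_union[of "{x}" A] assms by (simp add: column_word_def)

lemma column_word_insert_max:
  assumes "finite A" "\<And>a. a \<in> A \<Longrightarrow> a < x"
  shows "column_word (insert x A) = letter_of x # column_word A"
  using column_word_union[of A "{x}"] assms by (simp add: column_word_def)

lemma column_word_Min:
  assumes "finite A" "A \<noteq> {}"
  shows "column_word A = column_word (A - {Min A}) @ [letter_of (Min A)]"
  using column_word_insert_min[of "A - {Min A}" "Min A"] assms
  by (metis Diff_iff Min_in Min_le finite_Diff insertCI insert_Diff le_neq_implies_less)

lemma column_word_Max:
  assumes "finite A" "A \<noteq> {}"
  shows "column_word A = letter_of (Max A) # column_word (A - {Max A})"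
  using column_word_insert_max[of "A - {Max A}" "Max A"] assms
  by (metis Diff_iff Max_in Max_ge finite_Diff insertCI insert_Diff le_neq_implies_less)

text \<open>Integer valued, so that the difference of two counts may be negative.\<close>

definition cnt :: "nat set \<Rightarrow> nat \<Rightarrow> int" where
  "cnt A a = int (card (A \<inter> {..a}))"

lemma cnt_insert: "y \<notin> A \<Longrightarrow> cnt (insert y A) a = cnt A a + (if y \<le> a then 1 else 0)"
  by (simp add: cnt_def Int_insert_left)

lemma cnt_remove: "y \<in> A \<Longrightarrow> cnt (A - {y}) a = cnt A a - (if y \<le> a then 1 else 0)"
  using cnt_insert[of y "A - {y}" a] by (simp add: insert_absorb)

lemma cnt_nonneg: "cnt A a \<ge> 0"
  by (simp add: cnt_def)

lemma cnt_pos_iff: "cnt A a > 0 \<longleftrightarrow> (\<exists>x\<in>A. x \<le> a)"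
  by (auto simp: cnt_def card_gt_0_iff)

section \<open>Letters passing columns\<close>

text \<open>The condition on \<open>cnt\<close> says that \<open>A\<close> and \<open>B\<close> are
  neighbouring columns of a tableau. To pass \<open>Min B\<close>, the letter \<open>x\<close> needs
  a witness; \<open>Min A\<close> serves, and the induction hypothesis carries it through the rest
  of \<open>B\<close> and back again.\<close>

lemma knuth_column_small:
  assumes "finite A" "finite B" "\<And>a. cnt B a \<le> cnt A a" "\<And>a. a \<in> A \<union> B \<Longrightarrow> x < a"
  shows "column_word A @ column_word B @ [letter_of x] \<approx> column_word A @ letter_of x # column_word B"
  using assms
proof (induction "card B" arbitrary: A B x)
  case 0
  then show ?case by simp
next
  case (Suc n)
  define b where "b = Min B"
  define a where "a = Min A"
  have "B \<noteq> {}" using Suc.hyps by auto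
  then have b: "b \<in> B" "\<And>b'. b' \<in> B \<Longrightarrow> b \<le> b'"
    using Suc.prems by (auto simp: b_def)
  have "cnt B b > 0" using b by (auto simp: cnt_pos_iff)
  then obtain a' where a': "a' \<in> A" "a' \<le> b"
    using Suc.prems(3)[of b] cnt_pos_iff[of A b] by fastforce
  then have "A \<noteq> {}" by auto
  then have a: "a \<in> A" "\<And>a'. a' \<in> A \<Longrightarrow> a \<le> a'" "a \<le> b"
    unfolding a_def using Suc.prems(1) a' \<open>A \<noteq> {}\<close> by (auto simp: Min_le_iff)
  define A' where "A' = A - {a}"
  define B' where "B' = B - {b}"
  have fin: "finite A'" "finite B'" using Suc.prems by (auto simp: A'_def B'_def)
  have cB': "n = card B'" using Suc.hyps(2) b Suc.prems(2) by (simp add: B'_def)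
  have cwA: "column_word A = column_word A' @ [letter_of a]"
    using column_word_Min[of A] Suc.prems a by (auto simp: A'_def a_def)
  have cwB: "column_word B = column_word B' @ [letter_of b]"
    using column_word_Min[of B] Suc.prems \<open>B \<noteq> {}\<close> by (auto simp: B'_def b_def)
  have dom1: "cnt B' c \<le> cnt A c" for c
    using Suc.prems(3)[of c] b by (auto simp: B'_def cnt_remove)
  have dom2: "cnt B' c \<le> cnt A' c" for c
  proof (cases "b \<le> c")
    case True
    then show ?thesis using Suc.prems(3)[of c] a b by (simp add: A'_def B'_def cnt_remove)
  next
    case False
    then have "\<not> cnt B c > 0" using b unfolding cnt_pos_iff by fastforce
    then have "cnt B' c = 0" using b False cnt_nonneg[of B c] by (simp add: B'_def cnt_remove)
    then show ?thesis using cnt_nonneg[of A' c] by simp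
  qed
  have large: "a < c" if "c \<in> A' \<union> B'" for c
  proof (cases "c \<in> A'")
    case True then show ?thesis using a(2)[of c] by (auto simp: A'_def)
  next
    case False
    then have "b < c" using that b(2)[of c] by (auto simp: B'_def)
    then show ?thesis using a(3) by simp
  qed
  have IH: "column_word A' @ column_word B' @ [letter_of a] \<approx> column_word A' @ letter_of a # column_word B'"
    using dom2 large by (intro Suc.hyps(1)[OF cB' fin]) auto
  have "column_word A @ column_word B @ [letter_of x]
      = (column_word A' @ letter_of a # column_word B') @ [letter_of b, letter_of x]"
    by (simp add: cwA cwB)
  also have "\<dots> \<approx> (column_word A' @ column_word B') @ [letter_of a, letter_of b, letter_of x]"
    using knuth_append_right[OF knuth_sym[OF IH], of "[letter_of b, letter_of x]"] by simp
  also have "\<dots> \<approx> (column_word A' @ column_word B') @ [letter_of a, letter_of x, letter_of b]"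
    using Suc.prems(4)[of a] a
      knuth_sym[OF knuth_yxz[of "letter_of x" "letter_of a" "letter_of b" "column_word A' @ column_word B'" "[]"]]
    by auto
  also have "\<dots> \<approx> (column_word A @ column_word B' @ [letter_of x]) @ [letter_of b]"
    using knuth_append_right[OF IH, of "[letter_of x, letter_of b]"] by (simp add: cwA)
  also have "\<dots> \<approx> (column_word A @ letter_of x # column_word B') @ [letter_of b]"
    using dom1 Suc.prems
    by (intro knuth_append_right Suc.hyps(1)[OF cB']) (auto simp: B'_def)
  finally show ?case by (simp add: cwB)
qed

text \<open>The mirror image of \<open>knuth_column_small\<close>: reversing both the words and the
  order of the letters exchanges the two Knuth relations and the roles of \<open>A\<close> and
  \<open>B\<close>. This is why letters are counted from above here.\<close>

lemma knuth_column_large: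
  assumes "finite A" "finite B" "\<And>a. card (A \<inter> {a..}) \<le> card (B \<inter> {a..})"
    "\<And>a. a \<in> A \<union> B \<Longrightarrow> a < y"
  shows "column_word A @ letter_of y # column_word B \<approx> letter_of y # column_word A @ column_word B"
  using assms
proof (induction "card A" arbitrary: A B y)
  case 0
  then show ?case by simp
next
  case (Suc n)
  define a where "a = Max A"
  define b where "b = Max B"
  have "A \<noteq> {}" using Suc.hyps by auto
  then have a: "a \<in> A" "\<And>a'. a' \<in> A \<Longrightarrow> a' \<le> a"
    using Suc.prems by (auto simp: a_def)
  then have "card (A \<inter> {a..}) > 0" using Suc.prems(1) by (auto simp: card_gt_0_iff)
  then have "card (B \<inter> {a..}) > 0" using Suc.prems(3)[of a] by simp
  then obtain b' where b': "b' \<in> B" "a \<le> b'" by (auto simp: card_gt_0_iff)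
  then have "B \<noteq> {}" by auto
  then have b: "b \<in> B" "\<And>b'. b' \<in> B \<Longrightarrow> b' \<le> b" "a \<le> b"
    unfolding b_def using Suc.prems(2) b' \<open>B \<noteq> {}\<close> by (auto simp: Max_ge_iff)
  define A' where "A' = A - {a}"
  define B' where "B' = B - {b}"
  have fin: "finite A'" "finite B'" using Suc.prems by (auto simp: A'_def B'_def)
  have cA': "n = card A'" using Suc.hyps(2) a Suc.prems(1) by (simp add: A'_def)
  have cwA: "column_word A = letter_of a # column_word A'"
    using column_word_Max[of A] Suc.prems \<open>A \<noteq> {}\<close> by (auto simp: A'_def a_def)
  have cwB: "column_word B = letter_of b # column_word B'"
    using column_word_Max[of B] Suc.prems b by (auto simp: B'_def b_def)
  have dom1: "card (A' \<inter> {c..}) \<le> card (B \<inter> {c..})" for c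
    using Suc.prems(1)
    by (intro order.trans[OF card_mono Suc.prems(3)[of c]]) (auto simp: A'_def)
  have dom2: "card (A' \<inter> {c..}) \<le> card (B' \<inter> {c..})" for c
  proof (cases "c \<le> a")
    case True
    have "card (A' \<inter> {c..}) = card (A \<inter> {c..}) - 1" "card (B' \<inter> {c..}) = card (B \<inter> {c..}) - 1"
      using True a b Suc.prems
      by (auto simp: A'_def B'_def Diff_Int_distrib2 card_Diff_singleton)
    then show ?thesis using Suc.prems(3)[of c] by simp
  next
    case False
    then have "A' \<inter> {c..} = {}" using a(2) by (force simp: A'_def)
    then show ?thesis by simp
  qed
  have small: "c < b" if "c \<in> A' \<union> B'" for c
  proof (cases "c \<in> A'")
    case True then show ?thesis using a(2)[of c] b(3) by (auto simp: A'_def)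
  next
    case False
    then show ?thesis using that b(2)[of c] by (auto simp: B'_def)
  qed
  have IH: "column_word A' @ letter_of b # column_word B' \<approx> letter_of b # column_word A' @ column_word B'"
    using dom2 small by (intro Suc.hyps(1)[OF cA' fin]) auto
  have "column_word A' @ letter_of y # column_word B \<approx> letter_of y # column_word A' @ column_word B"
    using dom1 Suc.prems fin by (intro Suc.hyps(1)[OF cA']) (auto simp: A'_def)
  from knuth_Cons[OF this, of "letter_of a"]
  have "column_word A @ letter_of y # column_word B
      \<approx> [letter_of a, letter_of y] @ column_word A' @ letter_of b # column_word B'"
    by (simp add: cwA cwB)
  also have "\<dots> \<approx> [letter_of a, letter_of y, letter_of b] @ column_word A' @ column_word B'"
    using knuth_append_left[OF IH, of "[letter_of a, letter_of y]"] by simp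
  also have "\<dots> \<approx> [letter_of y, letter_of a, letter_of b] @ column_word A' @ column_word B'"
    using Suc.prems(4)[of b] b
      knuth_xzy[of "letter_of a" "letter_of b" "letter_of y" "[]" "column_word A' @ column_word B'"]
    by auto
  also have "\<dots> \<approx> [letter_of y, letter_of a] @ column_word A' @ letter_of b # column_word B'"
    using knuth_append_left[OF knuth_sym[OF IH], of "[letter_of y, letter_of a]"] by simp
  finally show ?case by (simp add: cwA cwB)
qed

text \<open>The letters of \<open>X\<close> pass \<open>B\<close> in turn, the largest first. A
  letter that has passed extends the column \<open>A\<close> at its end, which only strengthens the
  domination of \<open>B\<close>.\<close>

lemma knuth_column_smalls:
  assumes "finite A" "finite B" "finite X" "\<And>a. cnt B a \<le> cnt A a"
    "\<And>a x. a \<in> A \<union> B \<Longrightarrow> x \<in> X \<Longrightarrow> x < a"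
  shows "column_word A @ column_word B @ column_word X \<approx> column_word A @ column_word X @ column_word B"
  using assms
proof (induction "card X" arbitrary: A X)
  case 0
  then show ?case by simp
next
  case (Suc n)
  define x where "x = Max X"
  define X' where "X' = X - {x}"
  have "X \<noteq> {}" using Suc.hyps by auto
  then have x: "x \<in> X" "\<And>x'. x' \<in> X \<Longrightarrow> x' \<le> x"
    using Suc.prems by (auto simp: x_def)
  have cwX: "column_word X = letter_of x # column_word X'"
    using column_word_Max[of X] Suc.prems \<open>X \<noteq> {}\<close> by (auto simp: X'_def x_def)
  have n: "n = card X'" using Suc.hyps(2) x Suc.prems(3) by (simp add: X'_def)
  have xA: "x \<notin> A" using Suc.prems(5) x by blast
  have cwA: "column_word (insert x A) = column_word A @ [letter_of x]"
    using Suc.prems x by (intro column_word_insert_min) auto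
  have "column_word A @ column_word B @ [letter_of x] \<approx> column_word A @ letter_of x # column_word B"
    using Suc.prems x by (intro knuth_column_small) auto
  from knuth_append_right[OF this, of "column_word X'"]
  have "column_word A @ column_word B @ column_word X
      \<approx> column_word (insert x A) @ column_word B @ column_word X'"
    by (simp add: cwX cwA)
  also have "\<dots> \<approx> column_word (insert x A) @ column_word X' @ column_word B"
  proof (rule Suc.hyps(1)[OF n])
    show "cnt B a \<le> cnt (insert x A) a" for a
      using Suc.prems(4)[of a] xA by (simp add: cnt_insert)
    show "x' < a" if "a \<in> insert x A \<union> B" "x' \<in> X'" for a x'
      using that Suc.prems(5)[of a x'] x(2)[of x'] by (auto simp: X'_def)
  qed (use Suc.prems in \<open>auto simp: X'_def\<close>)
  finally show ?case by (simp add: cwA cwX)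
qed

section \<open>The raising operator between two columns\<close>

definition hgt :: "nat set \<Rightarrow> nat set \<Rightarrow> nat \<Rightarrow> int" where
  "hgt A B a = cnt B a - cnt A a"

text \<open>\<open>hgt\<close> counts unmatched letters, so the first maximum is the letter that the signature rule of
  the crystal moves from \<open>B\<close> to \<open>A\<close>.\<close>

definition raising :: "nat set \<Rightarrow> nat set \<Rightarrow> nat \<Rightarrow> bool" where
  "raising A B y \<longleftrightarrow> hgt A B y \<ge> 1 \<and> (\<forall>a. hgt A B a \<le> hgt A B y) \<and> (\<forall>a<y. hgt A B a < hgt A B y)"

lemma cnt_Suc: "cnt A (Suc a) = cnt A a + (if Suc a \<in> A then 1 else 0)"
proof -
  have "A \<inter> {..Suc a} = (if Suc a \<in> A then insert (Suc a) (A \<inter> {..a}) else A \<inter> {..a})"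
    by (auto simp: le_Suc_eq)
  then show ?thesis by (simp add: cnt_def)
qed

lemma cnt_0: "cnt A 0 = (if 0 \<in> A then 1 else 0)"
proof -
  have "A \<inter> {..0} = (if 0 \<in> A then {0} else {})" by auto
  then show ?thesis by (simp add: cnt_def)
qed

text \<open>A positive first maximum is a place where \<open>hgt\<close> grows, and only a letter of
  \<open>B\<close> that is absent from \<open>A\<close> makes it grow.\<close>

lemma raising_mem:
  assumes "raising A B y"
  shows "y \<in> B" "y \<notin> A"
proof -
  have "y \<in> B \<and> y \<notin> A"
  proof (cases y)
    case 0
    then show ?thesis using assms by (auto simp: raising_def hgt_def cnt_0 split: if_splits)
  next
    case (Suc x)
    then have "hgt A B x < hgt A B (Suc x)" using assms by (auto simp: raising_def)
    then show ?thesis using Suc by (auto simp: hgt_def cnt_Suc split: if_splits)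
  qed
  then show "y \<in> B" "y \<notin> A" by auto
qed

lemma raising_exists:
  assumes "finite B" "hgt A B a \<ge> 1"
  shows "\<exists>y. raising A B y"
proof -
  have bound: "hgt A B x \<le> int (card B)" for x
  proof -
    have "cnt B x \<le> int (card B)"
      using assms(1) by (auto simp: cnt_def intro: card_mono)
    then show ?thesis using cnt_nonneg[of A x] by (simp add: hgt_def)
  qed
  \<comment> \<open>Restricting the values to this interval makes the set finite although
    \<open>hgt\<close> is defined on all natural numbers.\<close>
  define M where "M = Max (range (hgt A B) \<inter> {1..int (card B)})"
  have fin: "finite (range (hgt A B) \<inter> {1..int (card B)})" by simp
  have ne: "hgt A B a \<in> range (hgt A B) \<inter> {1..int (card B)}" using assms(2) bound by auto
  then have "M \<in> range (hgt A B) \<inter> {1..int (card B)}" unfolding M_def using fin Max_in by blast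
  then have M: "\<exists>x. hgt A B x = M" "M \<ge> 1" by auto
  have max: "hgt A B x \<le> M" for x
  proof (cases "hgt A B x \<ge> 1")
    case True then show ?thesis using bound fin unfolding M_def by (intro Max_ge) auto
  qed (use M in auto)
  define y where "y = (LEAST x. hgt A B x = M)"
  have "hgt A B y = M" using M(1) unfolding y_def by (rule LeastI_ex)
  moreover have "hgt A B x < M" if "x < y" for x
    using not_less_Least[of x "\<lambda>x. hgt A B x = M"] that max[of x] by (auto simp: y_def)
  ultimately show ?thesis using max M(2) by (auto simp: raising_def)
qed

lemma cnt_split: "a < b \<Longrightarrow> cnt A b = cnt A a + int (card (A \<inter> {a<..b}))"
proof -
  assume "a < b"
  then have "A \<inter> {..b} = (A \<inter> {..a}) \<union> (A \<inter> {a<..b})" by auto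
  then show ?thesis by (simp add: cnt_def card_Un_disjoint disjoint_iff)
qed

text \<open>Cut both columns at \<open>y\<close>. The large parts \<open>A2\<close> and
  \<open>B2\<close> form a tableau, the small parts \<open>A1\<close> and \<open>B1\<close> satisfy
  the mirrored condition. So \<open>y\<close> may pass \<open>A1\<close> and then \<open>B2\<close>,
  provided that \<open>A1\<close> and \<open>B2\<close> change places before and after.\<close>

lemma knuth_raising:
  assumes "finite A" "finite B" "raising A B y"
  shows "column_word A @ column_word B \<approx> column_word (insert y A) @ column_word (B - {y})"
proof -
  define A1 where "A1 = A \<inter> {..<y}"
  define A2 where "A2 = A \<inter> {y<..}"
  define B1 where "B1 = B \<inter> {..<y}"
  define B2 where "B2 = B \<inter> {y<..}"
  note defs = A1_def A2_def B1_def B2_def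
  have y: "y \<in> B" "y \<notin> A" using raising_mem[OF assms(3)] .
  have fin: "finite A1" "finite A2" "finite B1" "finite B2" using assms by (auto simp: defs)
  have A: "A = A1 \<union> A2" using y by (auto simp: defs) (metis linorder_neqE_nat)
  have B: "B = (B1 \<union> {y}) \<union> B2" "B - {y} = B1 \<union> B2" using y by (auto simp: defs)
  have cA: "column_word A = column_word A2 @ column_word A1"
    unfolding A using fin by (intro column_word_union) (auto simp: defs)
  have "column_word B = column_word B2 @ column_word (B1 \<union> {y})"
    unfolding B(1) using fin by (intro column_word_union) (auto simp: defs)
  also have "column_word (B1 \<union> {y}) = letter_of y # column_word B1"
    using column_word_insert_max[of B1 y] fin by (auto simp: defs)
  finally have cB: "column_word B = column_word B2 @ letter_of y # column_word B1" .
  have cB': "column_word (B - {y}) = column_word B2 @ column_word B1"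
    unfolding B(2) using fin by (intro column_word_union) (auto simp: defs)
  have "insert y A = insert y A1 \<union> A2" by (auto simp: A)
  also have "column_word \<dots> = column_word A2 @ column_word (insert y A1)"
    using fin by (intro column_word_union) (auto simp: defs)
  also have "column_word (insert y A1) = letter_of y # column_word A1"
    using fin by (intro column_word_insert_max) (auto simp: defs)
  finally have cA': "column_word (insert y A) = column_word A2 @ letter_of y # column_word A1" .
  \<comment> \<open>Beyond \<open>y\<close> the height never exceeds its value at \<open>y\<close>,
    so no interval that starts right after \<open>y\<close> contains more letters of
    \<open>B\<close> than of \<open>A\<close>.\<close>
  have dom2: "cnt B2 a \<le> cnt A2 a" for a
  proof (cases "y < a")
    case True
    have "hgt A B a \<le> hgt A B y" using assms(3) by (simp add: raising_def)
    moreover have "B2 \<inter> {..a} = B \<inter> {y<..a}" "A2 \<inter> {..a} = A \<inter> {y<..a}" by (auto simp: defs)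
    ultimately show ?thesis using cnt_split[OF True] by (simp add: hgt_def cnt_def)
  next
    case False
    then have "B2 \<inter> {..a} = {}" by (auto simp: defs)
    then show ?thesis by (simp add: cnt_def)
  qed
  \<comment> \<open>Before \<open>y\<close> the height is strictly smaller than at \<open>y\<close>,
    so every interval that ends in \<open>y\<close> contains more letters of \<open>B\<close> than
    of \<open>A\<close>; one of the surplus letters is \<open>y\<close> itself.\<close>
  have dom1: "card (A1 \<inter> {a..}) \<le> card (B1 \<inter> {a..})" for a
  proof (cases "a \<le> y")
    case True
    have inty: "B \<inter> {a..y} = insert y (B1 \<inter> {a..})" "A \<inter> {a..y} = A1 \<inter> {a..}"
      using y True by (auto simp: defs order.order_iff_strict)
    have "card (A \<inter> {a..y}) < card (B \<inter> {a..y})"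
    proof (cases a)
      case 0
      then show ?thesis using assms(3) by (simp add: raising_def hgt_def cnt_def atMost_atLeast0)
    next
      case (Suc a')
      then have "hgt A B a' < hgt A B y" "a' < y" using assms(3) True by (auto simp: raising_def)
      then show ?thesis using cnt_split[of a' y] Suc
        by (simp add: hgt_def atLeastSucAtMost_greaterThanAtMost)
    qed
    moreover have "card (B \<inter> {a..y}) = Suc (card (B1 \<inter> {a..}))"
      using fin unfolding inty by (subst card_insert_disjoint) (auto simp: defs)
    ultimately show ?thesis using inty by simp
  next
    case False
    then have "A1 \<inter> {a..} = {}" by (auto simp: defs)
    then show ?thesis by simp
  qed
  have yA2: "y \<notin> A2" by (simp add: defs)
  have "column_word A @ column_word B
      = (column_word A2 @ column_word A1 @ column_word B2) @ letter_of y # column_word B1"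
    by (simp add: cA cB)
  also have "\<dots> \<approx> (column_word A2 @ column_word B2 @ column_word A1) @ letter_of y # column_word B1"
    using fin dom2 by (intro knuth_append_right knuth_sym[OF knuth_column_smalls]) (auto simp: defs)
  also have "\<dots> \<approx> (column_word A2 @ column_word B2) @ letter_of y # column_word A1 @ column_word B1"
    using knuth_append_left[OF knuth_column_large[of A1 B1 y], of "column_word A2 @ column_word B2"] fin dom1
    by (auto simp: defs)
  also have "\<dots> \<approx> column_word A2 @ letter_of y # column_word B2 @ column_word A1 @ column_word B1"
    using knuth_append_right[OF knuth_column_small[of A2 B2 y], of "column_word A1 @ column_word B1"]
      fin dom2 by (auto simp: defs)
  also have "\<dots> = (column_word (insert y A2) @ column_word B2 @ column_word A1) @ column_word B1"
    using column_word_insert_min[of A2 y] fin by (auto simp: defs)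
  also have "\<dots> \<approx> (column_word (insert y A2) @ column_word A1 @ column_word B2) @ column_word B1"
  proof (intro knuth_append_right knuth_column_smalls)
    show "cnt B2 a \<le> cnt (insert y A2) a" for a
      using dom2[of a] yA2 by (simp add: cnt_insert)
  qed (use fin in \<open>auto simp: defs\<close>)
  also have "\<dots> = column_word (insert y A) @ column_word (B - {y})"
    using column_word_insert_min[of A2 y] fin cA' cB' by (auto simp: defs)
  finally show ?thesis .
qed

section \<open>Confluence for two columns\<close>

text \<open>A column is King iff its excess is nowhere positive. The crystal operator for the long root
  deletes the letters \<open>Plain t\<close> and \<open>Barred t\<close> (ranks \<open>2 * t\<close> and \<open>2 * t + 1\<close>) at the first
  maximum \<open>t\<close>.\<close>

definition excess :: "nat set \<Rightarrow> nat \<Rightarrow> int" where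
  "excess A j = cnt A (2 * j + 1) - int j"

definition letter_pair :: "nat \<Rightarrow> nat set" where
  "letter_pair t = {2 * t, 2 * t + 1}"

definition cancelling :: "nat set \<Rightarrow> nat \<Rightarrow> bool" where
  "cancelling A t \<longleftrightarrow> excess A t \<ge> 1 \<and> (\<forall>j. excess A j \<le> excess A t) \<and> (\<forall>j<t. excess A j < excess A t)"

lemma cancellingI:
  assumes "excess A t = u" "1 \<le> u" "\<And>j. excess A j \<le> u" "\<And>j. j < t \<Longrightarrow> excess A j < u"
  shows "cancelling A t"
  using assms by (auto simp: cancelling_def)

lemma raisingI:
  assumes "hgt A B y = m" "1 \<le> m" "\<And>a. hgt A B a \<le> m" "\<And>a. a < y \<Longrightarrow> hgt A B a < m"
  shows "raising A B y"
  using assms by (auto simp: raising_def)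

lemma cancelling_unique: "cancelling A t \<Longrightarrow> cancelling A t' \<Longrightarrow> t = t'"
  unfolding cancelling_def by (metis linorder_neqE_nat linorder_not_le)

lemma excess_Suc:
  "excess A (Suc j) = excess A j - 1 + (if 2 * Suc j \<in> A then 1 else 0) + (if 2 * Suc j + 1 \<in> A then 1 else 0)"
proof -
  have "2 * Suc j + 1 = Suc (Suc (2 * j + 1))" "2 * Suc j = Suc (2 * j + 1)" by auto
  then show ?thesis unfolding excess_def by (simp only: cnt_Suc)
qed

lemma excess_0: "A \<subseteq> {2..} \<Longrightarrow> excess A 0 = 0"
  by (auto simp: excess_def cnt_def)

text \<open>\<open>excess\<close> starts at 0, changes by -1, 0 or 1, and grows only where both
  letters of a pair are present; its positive first maximum is such a place.\<close>

lemma cancelling_mem: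
  assumes "A \<subseteq> {2..}" "cancelling A t"
  shows "2 * t \<in> A" "2 * t + 1 \<in> A" "t > 0" "excess A (t - 1) = excess A t - 1"
proof -
  obtain s where s: "t = Suc s"
    using assms excess_0[OF assms(1)] by (cases t) (auto simp: cancelling_def)
  then have "excess A s < excess A (Suc s)" using assms by (auto simp: cancelling_def)
  then show "2 * t \<in> A" "2 * t + 1 \<in> A" "t > 0" "excess A (t - 1) = excess A t - 1"
    unfolding s excess_Suc by (auto split: if_splits)
qed

section \<open>Effect of each operator on both sequences\<close>

text \<open>The total shifts in this and the following lemmas (two and one for a move, two and two
  for a deletion) are, up to sign, the entries of the Cartan matrix.\<close>

lemma hgt_raise:
  assumes "raising A B y"
  shows "hgt (insert y A) (B - {y}) a = hgt A B a - (if y \<le> a then 2 else 0)"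
  using raising_mem[OF assms] by (simp add: hgt_def cnt_insert cnt_remove)

lemma excess_insert:
  assumes "y \<notin> A"
  shows "excess (insert y A) j = excess A j + (if y div 2 \<le> j then 1 else 0)"
proof -
  have "y \<le> 2 * j + 1 \<longleftrightarrow> y div 2 \<le> j" by auto
  then show ?thesis using assms by (simp add: excess_def cnt_insert)
qed

lemma excess_raise:
  assumes "raising A B y"
  shows "excess (insert y A) j = excess A j + (if y div 2 \<le> j then 1 else 0)"
  using raising_mem[OF assms] by (simp add: excess_insert)

lemma cnt_cancel:
  assumes "A \<subseteq> {2..}" "cancelling A t"
  shows "cnt (A - letter_pair t) a = cnt A a - (if 2 * t \<le> a then 1 else 0) - (if 2 * t + 1 \<le> a then 1 else 0)"
proof -
  have "A - letter_pair t = A - {2 * t} - {2 * t + 1}" by (auto simp: letter_pair_def)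
  then show ?thesis using cancelling_mem[OF assms] by (simp add: cnt_remove)
qed

lemma hgt_cancel:
  assumes "A \<subseteq> {2..}" "cancelling A t"
  shows "hgt (A - letter_pair t) B a
    = hgt A B a + (if 2 * t \<le> a then 1 else 0) + (if 2 * t + 1 \<le> a then 1 else 0)"
  using cnt_cancel[OF assms] by (simp add: hgt_def)

lemma excess_cancel:
  assumes "A \<subseteq> {2..}" "cancelling A t"
  shows "excess (A - letter_pair t) j = excess A j - (if t \<le> j then 2 else 0)"
  using cnt_cancel[OF assms] by (auto simp: excess_def)

text \<open>A discrete intermediate value theorem: steps of height at most one cannot jump over the
  level \<open>v\<close>. It supplies the letters of all later moves.\<close>

lemma hgt_reach:
  assumes "hgt A B x \<ge> v" "v \<ge> 1"
  shows "\<exists>z\<le>x. hgt A B z = v \<and> (\<forall>a<z. hgt A B a < v)"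
proof -
  define z where "z = (LEAST z. hgt A B z \<ge> v)"
  have z: "hgt A B z \<ge> v" unfolding z_def using assms(1) by (rule LeastI)
  have less: "hgt A B a < v" if "a < z" for a
    using not_less_Least[of a "\<lambda>z. hgt A B z \<ge> v"] that by (simp add: z_def)
  have "hgt A B z \<le> v"
  proof (cases z)
    case 0
    then show ?thesis using assms(2) by (simp add: hgt_def cnt_0)
  next
    case (Suc a)
    then show ?thesis using less[of a] by (auto simp: hgt_def cnt_Suc)
  qed
  moreover have "z \<le> x" unfolding z_def using assms(1) by (rule Least_le)
  ultimately show ?thesis using z less by (intro exI[of _ z]) auto
qed

lemma excess_reach:
  assumes "A \<subseteq> {2..}" "excess A x \<ge> v" "v \<ge> 1"
  shows "\<exists>z\<le>x. excess A z = v \<and> (\<forall>a<z. excess A a < v)"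
proof -
  define z where "z = (LEAST z. excess A z \<ge> v)"
  have z: "excess A z \<ge> v" unfolding z_def using assms(2) by (rule LeastI)
  have less: "excess A a < v" if "a < z" for a
    using not_less_Least[of a "\<lambda>z. excess A z \<ge> v"] that by (simp add: z_def)
  have "excess A z \<le> v"
  proof (cases z)
    case 0
    then show ?thesis using assms by (simp add: excess_0)
  next
    case (Suc a)
    then show ?thesis using less[of a] by (auto simp: excess_Suc)
  qed
  moreover have "z \<le> x" unfolding z_def using assms(2) by (rule Least_le)
  ultimately show ?thesis using z less by (intro exI[of _ z]) auto
qed

lemma cancelling_exists:
  assumes "finite A" "A \<subseteq> {2..}" "excess A j \<ge> 1"
  shows "\<exists>t. cancelling A t"
proof -
  have bound: "excess A x \<le> int (card A)" for x
    using assms(1) card_mono[of A "A \<inter> {..2 * x + 1}"] by (simp add: excess_def cnt_def)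
  let ?V = "range (excess A) \<inter> {1..int (card A)}"
  have fin: "finite ?V" by simp
  have "excess A j \<in> ?V" using assms(3) bound by auto
  then have "Max ?V \<in> ?V" using fin Max_in by blast
  then obtain x where x: "excess A x = Max ?V" "Max ?V \<ge> 1" by auto
  have max: "excess A x \<le> Max ?V" for x
  proof (cases "excess A x \<ge> 1")
    case True then show ?thesis using bound fin by (intro Max_ge) auto
  qed (use x in auto)
  obtain z where "excess A z = Max ?V" "\<forall>a<z. excess A a < Max ?V"
    using excess_reach[OF assms(2), of "Max ?V" x] x by auto
  then have "cancelling A z" using max x(2) by (intro cancellingI[of A z "Max ?V"]) auto
  then show ?thesis ..
qed

text \<open>The size bound stands for an induction hypothesis, invariance being known for shorter
  words only. The ranks from 2 on are those of the letters from \<open>Plain 1\<close> on.\<close>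

definition small :: "nat \<Rightarrow> nat set \<Rightarrow> nat set \<Rightarrow> bool" where
  "small N A B \<longleftrightarrow> finite A \<and> finite B \<and> card A + card B < N \<and> A \<union> B \<subseteq> {2..}"

lemma small_raise: "small N A B \<Longrightarrow> raising A B y \<Longrightarrow> small N (insert y A) (B - {y})"
  using raising_mem[of A B y] card_gt_0_iff[of B] by (auto simp: small_def card_Diff_singleton)

lemma small_cancel: "small N A B \<Longrightarrow> small N (A - letter_pair t) B"
  using card_mono[of A "A - letter_pair t"] by (auto simp: small_def)

text \<open>Whichever of the two operators comes first, the paths can be completed to a common end. The
  case distinction yields the local relations of degrees 2, 4, 5 and 7 of crystals of type \<open>C\<^sub>2\<close>.\<close>

lemma two_column_confluence:
  fixes f :: "nat set \<Rightarrow> nat set \<Rightarrow> 'b"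
  assumes f_raise: "\<And>A B y. small N A B \<Longrightarrow> raising A B y \<Longrightarrow> f A B = f (insert y A) (B - {y})"
    and f_cancel: "\<And>A B t. small N A B \<Longrightarrow> cancelling A t \<Longrightarrow> f A B = f (A - letter_pair t) B"
    and fin: "finite A" "finite B" "card A + card B \<le> N" "A \<union> B \<subseteq> {2..}"
    and y: "raising A B y" and t: "cancelling A t" and t': "cancelling (insert y A) t'"
  shows "f (A - letter_pair t) B = f (insert y A - letter_pair t') (B - {y})"
proof -
  define h where "h = hgt A B"
  define S where "S = excess A"
  define l where "l = y div 2"
  \<comment> \<open>The two maxima. Every letter or pair chosen later is the first point at which
    one of the sequences reaches a level close to \<open>m\<close> or \<open>u\<close>.\<close>
  define m where "m = h y"
  define u where "u = S t"
  define A0 where "A0 = A - letter_pair t"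
  define h1 where "h1 = hgt A0 B"
  have A2: "A \<subseteq> {2..}" "insert y A \<subseteq> {2..}" using fin raising_mem[OF y] by auto
  have m: "m \<ge> 1" and hm: "\<And>a. h a \<le> m" and hl: "\<And>a. a < y \<Longrightarrow> h a < m"
    using y by (auto simp: raising_def h_def m_def)
  have u: "u \<ge> 1" and Su: "\<And>j. S j \<le> u" and Sl: "\<And>j. j < t \<Longrightarrow> S j < u"
    using t by (auto simp: cancelling_def S_def u_def)
  have yA: "y \<notin> A" "y \<in> B" using raising_mem[OF y] by auto
  have tA: "2 * t \<in> A" "2 * t + 1 \<in> A" "t > 0" "S (t - 1) = u - 1"
    using cancelling_mem[OF A2(1) t] by (auto simp: S_def u_def)
  have yt: "y \<noteq> 2 * t" "y \<noteq> 2 * t + 1" using yA tA by metis+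
  have tl: "t \<noteq> l" using yt by (auto simp: l_def)
  have h1: "h1 a = h a + (if 2 * t \<le> a then 1 else 0) + (if 2 * t + 1 \<le> a then 1 else 0)" for a
    using hgt_cancel[OF A2(1) t] by (simp add: h_def h1_def A0_def)
  have S0: "excess A0 j = S j - (if t \<le> j then 2 else 0)" for j
    using excess_cancel[OF A2(1) t] by (simp add: S_def A0_def)
  have S': "excess (insert y A) j = S j + (if l \<le> j then 1 else 0)" for j
    using excess_raise[OF y] by (simp add: S_def l_def)
  have cA: "card (letter_pair t) = 2" "card (A - letter_pair t) = card A - 2"
    "card (letter_pair t') = 2" "card (insert y A - letter_pair t') = card (insert y A) - 2"
    using tA fin cancelling_mem[OF A2(2) t'] by (auto simp: letter_pair_def card_Diff_subset)
  have "card (letter_pair t) \<le> card A"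
    using tA fin by (intro card_mono) (auto simp: letter_pair_def)
  \<comment> \<open>Both sides have lost a pair, so \<open>f\<close> is invariant under everything
    that is applied from here on.\<close>
  then have smA0: "small N A0 B" and smY: "small N (insert y A - letter_pair t') (B - {y})"
    using fin cA yA by (auto simp: small_def A0_def card_Diff_singleton)
  \<comment> \<open>If the pair lies below \<open>y\<close>, the deletion keeps \<open>y\<close> the
    first maximum of \<open>hgt\<close>, but the move may shift the first maximum of
    \<open>excess\<close>. If it lies above \<open>y\<close>, the roles are exchanged: the move
    keeps \<open>t\<close>, and the deletion may shift the maximum of \<open>hgt\<close>.\<close>
  show ?thesis
  proof (cases "t < l")
    case True
    then have ty: "2 * t + 1 < y" by (auto simp: l_def)
    show ?thesis
    proof (cases "\<exists>j\<ge>l. S j = u")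
      \<comment> \<open>Degree 2: the move does not lift any later excess above \<open>u\<close>, so
        both operators keep their places and commute.\<close>
      case False
      then have Sll: "S j < u" if "l \<le> j" for j using Su[of j] that by (meson order_less_le)
      have "cancelling (insert y A) t"
      proof (rule cancellingI[of _ _ u])
        show "excess (insert y A) j \<le> u" for j
          using Su[of j] Sll[of j] by (auto simp: S')
        show "j < t \<Longrightarrow> excess (insert y A) j < u" for j
          using Sl[of j] True by (auto simp: S')
      qed (use True u in \<open>auto simp: S' u_def\<close>)
      then have tt: "t' = t" using t' cancelling_unique by blast
      have r: "raising A0 B y"
      proof (rule raisingI[of _ _ _ "m + 2"])
        show "hgt A0 B a \<le> m + 2" for a using hm[of a] by (auto simp: h1 simp flip: h1_def)
        show "a < y \<Longrightarrow> hgt A0 B a < m + 2" for a using hl[of a] by (auto simp: h1 simp flip: h1_def)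
      qed (use ty m in \<open>auto simp: h1 m_def simp flip: h1_def\<close>)
      have "insert y A0 = insert y A - letter_pair t'" using yt by (auto simp: A0_def tt letter_pair_def)
      then show ?thesis using f_raise[OF smA0 r] by (simp add: A0_def)
    next
      \<comment> \<open>The move lifts some later excess to \<open>u + 1\<close>; after it, the
        deletion takes place at \<open>t'\<close> instead of \<open>t\<close>.\<close>
      case ex: True
      have t'u: "excess (insert y A) t' = u + 1"
      proof (rule antisym)
        show "excess (insert y A) t' \<le> u + 1" using Su[of t'] by (simp add: S')
        obtain j where "l \<le> j" "S j = u" using ex by auto
        then have "excess (insert y A) j = u + 1" by (simp add: S')
        then show "u + 1 \<le> excess (insert y A) t'" using t' by (metis cancelling_def)
      qed
      then have t'l: "l \<le> t'" and St': "S t' = u" using Su[of t'] by (auto simp: S' split: if_splits)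
      have Sll: "S j < u" if "l \<le> j" "j < t'" for j
        using t' t'u that unfolding cancelling_def by (auto simp: S')
      have tA': "2 * t' \<in> insert y A" "2 * t' + 1 \<in> insert y A" "t' > 0"
        "excess (insert y A) (t' - 1) = u"
        using cancelling_mem[OF A2(2) t'] t'u by auto
      have y1: "h1 y = m + 2" using ty by (simp add: h1 m_def)
      \<comment> \<open>After the deletion the levels \<open>m + 2\<close>, \<open>m + 1\<close> and
        \<open>m\<close> are first reached at \<open>y\<close>, \<open>z2\<close> and
        \<open>z1\<close>. Each move lowers the heights from its own point on by two, so these three
        letters move one after another.\<close>
      obtain z2 where z2: "h1 z2 = m + 1" "z2 \<le> y" "\<And>a. a < z2 \<Longrightarrow> h1 a < m + 1"
        using hgt_reach[of "m + 1" A0 B y] y1 m unfolding h1_def by auto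
      obtain z1 where z1: "h1 z1 = m" "z1 \<le> z2" "\<And>a. a < z1 \<Longrightarrow> h1 a < m"
        using hgt_reach[of m A0 B z2] z2 m unfolding h1_def by auto
      have z2y: "z2 < y" using z2(1,2) y1 by (cases "z2 = y") auto
      have z12: "z1 < z2" using z1(1,2) z2(1) by (cases "z1 = z2") auto
      have z1t: "2 * t \<le> z1"
        using hl[of z1] z1(1) z12 z2y by (auto simp: h1 split: if_splits)
      have h1y: "h1 a \<le> m + 2" for a using hm[of a] by (simp add: h1)
      have h1yl: "h1 a \<le> m + 1" if "a < y" for a using hl[OF that] by (simp add: h1)
      have r1: "raising A0 B y"
        using y1 m h1yl h1y by (intro raisingI[of _ _ _ "m + 2"]) (force simp flip: h1_def)+
      have sm1: "small N (insert y A0) (B - {y})" using small_raise[OF smA0 r1] .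
      have e1: "hgt (insert y A0) (B - {y}) a = h1 a - (if y \<le> a then 2 else 0)" for a
        using hgt_raise[OF r1] by (simp add: h1_def)
      have r2: "raising (insert y A0) (B - {y}) z2"
      proof (rule raisingI[of _ _ _ "m + 1"])
        show "hgt (insert y A0) (B - {y}) a \<le> m + 1" for a
          using h1y[of a] h1yl[of a] m by (auto simp: e1)
        show "a < z2 \<Longrightarrow> hgt (insert y A0) (B - {y}) a < m + 1" for a
          using z2(3)[of a] by (auto simp: e1)
      qed (use z2 z2y m in \<open>auto simp: e1\<close>)
      have sm2: "small N (insert z2 (insert y A0)) (B - {y} - {z2})" using small_raise[OF sm1 r2] .
      have e2: "hgt (insert z2 (insert y A0)) (B - {y} - {z2}) a
          = h1 a - (if y \<le> a then 2 else 0) - (if z2 \<le> a then 2 else 0)" for a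
        using hgt_raise[OF r2] by (simp add: e1)
      have r3: "raising (insert z2 (insert y A0)) (B - {y} - {z2}) z1"
      proof (rule raisingI[of _ _ _ m])
        show "hgt (insert z2 (insert y A0)) (B - {y} - {z2}) a \<le> m" for a
          using h1y[of a] h1yl[of a] z2(3)[of a] z2y m by (auto simp: e2)
        show "a < z1 \<Longrightarrow> hgt (insert z2 (insert y A0)) (B - {y} - {z2}) a < m" for a
          using z1(3)[of a] by (auto simp: e2)
      qed (use z1 z2y z12 m in \<open>auto simp: e2\<close>)
      define X0 where "X0 = insert z1 (insert z2 (insert y A0))"
      define Bx where "Bx = B - {y} - {z2} - {z1}"
      have sm3: "small N X0 Bx" using small_raise[OF sm2 r3] by (simp add: X0_def Bx_def)
      have f1: "f A0 B = f X0 Bx"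
        using f_raise[OF smA0 r1] f_raise[OF sm1 r2] f_raise[OF sm2 r3] by (simp add: X0_def Bx_def)
      have e3: "hgt X0 Bx a
          = h1 a - (if y \<le> a then 2 else 0) - (if z2 \<le> a then 2 else 0) - (if z1 \<le> a then 2 else 0)" for a
        using hgt_raise[OF r3] by (simp add: e2 X0_def Bx_def)
      have E3: "excess X0 j = S j - (if t \<le> j then 2 else 0) + (if l \<le> j then 1 else 0)
          + (if z2 div 2 \<le> j then 1 else 0) + (if z1 div 2 \<le> j then 1 else 0)" for j
        using excess_raise[OF r3, of j] excess_raise[OF r2, of j] excess_raise[OF r1, of j]
        by (simp add: S0 X0_def l_def)
      \<comment> \<open>The letter \<open>2 * t'\<close> already belongs to the first column,
        whereas \<open>z2\<close> still has to be moved there; so the two differ.\<close>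
      have "z2 \<notin> insert y A0" using raising_mem[OF r2] by auto
      then have z2t': "z2 < 2 * t'"
      proof -
        have "z2 \<noteq> 2 * t'" if "z2 < y"
          using tA'(1) \<open>z2 \<notin> insert y A0\<close> \<open>t < l\<close> t'l that by (auto simp: A0_def letter_pair_def)
        moreover have "y \<le> 2 * t' + 1" using t'l by (auto simp: l_def)
        ultimately show ?thesis using z2y by auto
      qed
      have lz: "t \<le> z1 div 2" "z1 div 2 \<le> z2 div 2" "z2 div 2 \<le> l" "z2 div 2 < t'"
        using z1t z12 z2y z2t' by (auto simp: l_def div_le_mono)
      \<comment> \<open>Three moves against one deletion leave a surplus of one, so the excess at
        \<open>t'\<close> is \<open>u + 1\<close> on this side too.\<close>
      have c1: "cancelling X0 t'"
      proof (rule cancellingI[of _ _ "u + 1"])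
        show "excess X0 j \<le> u + 1" for j using Su[of j] lz True by (auto simp: E3)
        show "j < t' \<Longrightarrow> excess X0 j < u + 1" for j using Sll[of j] Su[of j] lz True by (auto simp: E3)
        show "excess X0 t' = u + 1" using St' lz True t'l by (auto simp: E3)
      qed (use u in auto)
      define X where "X = X0 - letter_pair t'"
      have X2: "X0 \<subseteq> {2..}" using sm3 by (auto simp: small_def)
      have smX: "small N X Bx" using small_cancel[OF sm3] by (simp add: X_def)
      have f2: "f A0 B = f X Bx" using f1 f_cancel[OF sm3 c1] by (simp add: X_def)
      have eX: "hgt X Bx a = h1 a - (if y \<le> a then 2 else 0) - (if z2 \<le> a then 2 else 0)
          - (if z1 \<le> a then 2 else 0) + (if 2 * t' \<le> a then 1 else 0) + (if 2 * t' + 1 \<le> a then 1 else 0)" for a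
        using hgt_cancel[OF X2 c1] by (simp add: X_def e3)
      have EX: "excess X j = S j - (if t \<le> j then 2 else 0) + (if l \<le> j then 1 else 0)
          + (if z2 div 2 \<le> j then 1 else 0) + (if z1 div 2 \<le> j then 1 else 0)
          - (if t' \<le> j then 2 else 0)" for j
        using excess_cancel[OF X2 c1] by (simp add: X_def E3)
      \<comment> \<open>The other side: the move comes first, then the deletion at
        \<open>t'\<close>, then the one at \<open>t\<close>.\<close>
      define Y0 where "Y0 = insert y A - letter_pair t'"
      have EY0: "excess Y0 j = S j + (if l \<le> j then 1 else 0) - (if t' \<le> j then 2 else 0)" for j
        using excess_cancel[OF A2(2) t'] by (simp add: Y0_def S')
      have eY0: "hgt Y0 (B - {y}) a = h a - (if y \<le> a then 2 else 0)
          + (if 2 * t' \<le> a then 1 else 0) + (if 2 * t' + 1 \<le> a then 1 else 0)" for a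
        using hgt_cancel[OF A2(2) t'] hgt_raise[OF y] by (simp add: Y0_def h_def)
      have smY0: "small N Y0 (B - {y})" using smY by (simp add: Y0_def)
      have Y02: "Y0 \<subseteq> {2..}" using smY0 by (auto simp: small_def)
      have c2: "cancelling Y0 t"
      proof (rule cancellingI[of _ _ u])
        show "excess Y0 j \<le> u" for j using Su[of j] Sll[of j] by (auto simp: EY0)
        show "j < t \<Longrightarrow> excess Y0 j < u" for j using Sl[of j] True by (auto simp: EY0)
        show "excess Y0 t = u" using True t'l by (simp add: EY0 u_def)
      qed (use u in auto)
      define Y where "Y = Y0 - letter_pair t"
      have smYY: "small N Y (B - {y})" using small_cancel[OF smY0] by (simp add: Y_def)
      have f3: "f Y0 (B - {y}) = f Y (B - {y})" using f_cancel[OF smY0 c2] by (simp add: Y_def)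
      have eY: "hgt Y (B - {y}) a = h1 a - (if y \<le> a then 2 else 0)
          + (if 2 * t' \<le> a then 1 else 0) + (if 2 * t' + 1 \<le> a then 1 else 0)" for a
        using hgt_cancel[OF Y02 c2] by (simp add: Y_def eY0 h1)
      have EY: "excess Y j = S j + (if l \<le> j then 1 else 0) - (if t' \<le> j then 2 else 0)
          - (if t \<le> j then 2 else 0)" for j
        using excess_cancel[OF Y02 c2] by (simp add: Y_def EY0)
      have eYlow: "hgt Y (B - {y}) a = h1 a" if "a \<le> z2" for a
        using that z2y z2t' by (simp add: eY)
      have eYmax: "hgt Y (B - {y}) a \<le> m + 2" for a
        using h1y[of a] h1yl[of a] t'l by (auto simp: eY l_def)
      have XY: "X = insert z1 (insert z2 Y)"
        using z2t' z12 yt by (auto simp: X_def X0_def Y_def Y0_def A0_def letter_pair_def)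
      show ?thesis
      proof (cases "\<exists>a. hgt Y (B - {y}) a \<ge> m + 2")
        \<comment> \<open>Degree 5: on this side the letters \<open>z2\<close> and \<open>z1\<close>
          are the next to move, and the sides meet.\<close>
        case False
        have eYmax': "hgt Y (B - {y}) a \<le> m + 1" for a using False[simplified, rule_format, of a] by simp
        have r4: "raising Y (B - {y}) z2"
        proof (rule raisingI[of _ _ _ "m + 1"])
          show "a < z2 \<Longrightarrow> hgt Y (B - {y}) a < m + 1" for a using z2(3)[of a] by (simp add: eYlow)
        qed (use eYmax' m z2 in \<open>auto simp: eYlow\<close>)
        have sm4: "small N (insert z2 Y) (B - {y} - {z2})" using small_raise[OF smYY r4] .
        have e4: "hgt (insert z2 Y) (B - {y} - {z2}) a = hgt Y (B - {y}) a - (if z2 \<le> a then 2 else 0)" for a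
          using hgt_raise[OF r4] .
        have r5: "raising (insert z2 Y) (B - {y} - {z2}) z1"
        proof (rule raisingI[of _ _ _ m])
          show "hgt (insert z2 Y) (B - {y} - {z2}) a \<le> m" for a
            using eYmax'[of a] z2(3)[of a] eYlow[of a] by (auto simp: e4)
          show "a < z1 \<Longrightarrow> hgt (insert z2 Y) (B - {y} - {z2}) a < m" for a
            using z1(3)[of a] eYlow[of a] z12 by (auto simp: e4)
        qed (use z1 z12 m eYlow in \<open>auto simp: e4\<close>)
        have "f Y (B - {y}) = f X Bx"
          using f_raise[OF smYY r4] f_raise[OF sm4 r5] by (simp add: XY Bx_def)
        then show ?thesis using f2 f3 by (simp add: A0_def Y0_def)
      next
        \<comment> \<open>Degree 7: the deletion at \<open>t'\<close> has lifted some height at or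
          beyond its pair to \<open>m + 2\<close>, so a letter \<open>x\<close> moves before
          \<open>z2\<close> and \<open>z1\<close>. Both sides then get one more deletion, at
          \<open>r\<close>: this side after its three moves, the side of \<open>X\<close> before it
          moves \<open>x\<close>.\<close>
        case True
        then obtain x where x: "hgt Y (B - {y}) x = m + 2" "\<And>a. a < x \<Longrightarrow> hgt Y (B - {y}) a < m + 2"
          using hgt_reach[of "m + 2" Y "B - {y}"] m by force
        have xt': "2 * t' \<le> x"
        proof (rule ccontr)
          assume "\<not> ?thesis"
          then have "hgt Y (B - {y}) x \<le> m + 1"
            using h1y[of x] h1yl[of x] m by (auto simp: eY)
          then show False using x by simp
        qed
        then have xz2: "z2 < x" using z2t' by simp
        have r4: "raising Y (B - {y}) x"
          using x eYmax m by (intro raisingI[of _ _ _ "m + 2"]) auto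
        have sm4: "small N (insert x Y) (B - {y} - {x})" using small_raise[OF smYY r4] .
        have e4: "hgt (insert x Y) (B - {y} - {x}) a = hgt Y (B - {y}) a - (if x \<le> a then 2 else 0)" for a
          using hgt_raise[OF r4] .
        have r5: "raising (insert x Y) (B - {y} - {x}) z2"
        proof (rule raisingI[of _ _ _ "m + 1"])
          show "hgt (insert x Y) (B - {y} - {x}) a \<le> m + 1" for a
            using eYmax[of a] x(2)[of a] by (auto simp: e4)
          show "a < z2 \<Longrightarrow> hgt (insert x Y) (B - {y} - {x}) a < m + 1" for a
            using z2(3)[of a] eYlow[of a] xz2 by (auto simp: e4)
        qed (use z2 xz2 m eYlow in \<open>auto simp: e4\<close>)
        have sm5: "small N (insert z2 (insert x Y)) (B - {y} - {x} - {z2})" using small_raise[OF sm4 r5] .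
        have e5: "hgt (insert z2 (insert x Y)) (B - {y} - {x} - {z2}) a
            = hgt Y (B - {y}) a - (if x \<le> a then 2 else 0) - (if z2 \<le> a then 2 else 0)" for a
          using hgt_raise[OF r5] by (simp add: e4)
        have r6: "raising (insert z2 (insert x Y)) (B - {y} - {x} - {z2}) z1"
        proof (rule raisingI[of _ _ _ m])
          show "hgt (insert z2 (insert x Y)) (B - {y} - {x} - {z2}) a \<le> m" for a
            using eYmax[of a] x(2)[of a] z2(3)[of a] eYlow[of a] by (auto simp: e5)
          show "a < z1 \<Longrightarrow> hgt (insert z2 (insert x Y)) (B - {y} - {x} - {z2}) a < m" for a
            using z1(3)[of a] eYlow[of a] z12 xz2 by (auto simp: e5)
        qed (use z1 z12 xz2 m eYlow in \<open>auto simp: e5\<close>)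
        define Y3 where "Y3 = insert z1 (insert z2 (insert x Y))"
        define By where "By = B - {y} - {x} - {z2} - {z1}"
        have sm6: "small N Y3 By" using small_raise[OF sm5 r6] by (simp add: Y3_def By_def)
        have f4: "f Y (B - {y}) = f Y3 By"
          using f_raise[OF smYY r4] f_raise[OF sm4 r5] f_raise[OF sm5 r6] by (simp add: Y3_def By_def)
        have E6: "excess Y3 j = excess Y j + (if x div 2 \<le> j then 1 else 0)
            + (if z2 div 2 \<le> j then 1 else 0) + (if z1 div 2 \<le> j then 1 else 0)" for j
          using excess_raise[OF r6, of j] excess_raise[OF r5, of j] excess_raise[OF r4, of j]
          by (simp add: Y3_def)
        have E6X: "excess Y3 j = excess X j + (if x div 2 \<le> j then 1 else 0)" for j
          by (simp add: E6 EX EY)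
        \<comment> \<open>This guarantees that the excess of \<open>X\<close> reaches
          \<open>u\<close> below \<open>t'\<close>. The letter \<open>x\<close> lies beyond
          \<open>t'\<close>, where the excess of \<open>X\<close> is at most \<open>u - 1\<close>,
          so adding it does not displace the first maximum \<open>r\<close>.\<close>
        have "excess X (t' - 1) = u"
          using tA'(3,4) lz True \<open>t < l\<close> t'l unfolding S' EX
          by (auto split: if_splits)
        then obtain r where r: "r \<le> t' - 1" "excess X r = u" "\<And>j. j < r \<Longrightarrow> excess X j < u"
          using excess_reach[of X u "t' - 1"] smX u by (auto simp: small_def)
        have rt': "r < t'" using r(1) tA'(3) by simp
        have rz2: "z2 div 2 \<le> r"
        proof (rule ccontr)
          assume "\<not> ?thesis"
          then have "excess X r < u"
            using Su[of r] Sl[of r] lz \<open>t < l\<close> rt' by (auto simp: EX split: if_splits)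
          then show False using r by simp
        qed
        have EXmax: "excess X j \<le> u" for j
          using Su[of j] Sll[of j] lz \<open>t < l\<close> t'l by (auto simp: EX)
        have EXhigh: "excess X j \<le> u - 1" if "t' \<le> j" for j
          using Su[of j] lz \<open>t < l\<close> t'l that by (auto simp: EX)
        have xt2: "t' \<le> x div 2" using xt' by auto
        have c3: "cancelling X r" using r EXmax u by (intro cancellingI[of _ _ u]) auto
        have c4: "cancelling Y3 r"
        proof (rule cancellingI[of _ _ u])
          show "excess Y3 j \<le> u" for j using EXmax[of j] EXhigh[of j] xt2 by (auto simp: E6X)
          show "j < r \<Longrightarrow> excess Y3 j < u" for j using r(3)[of j] xt2 rt' by (auto simp: E6X)
        qed (use r u xt2 rt' in \<open>auto simp: E6X\<close>)
        have X2': "X \<subseteq> {2..}" using smX by (auto simp: small_def)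
        have smXr: "small N (X - letter_pair r) Bx" using small_cancel[OF smX] .
        have xr: "2 * r + 1 < x" using xt' rt' by simp
        have z2r: "z2 \<le> 2 * r + 1" using rz2 by simp
        have e7: "hgt (X - letter_pair r) Bx a = hgt Y (B - {y}) a - (if z2 \<le> a then 2 else 0)
            - (if z1 \<le> a then 2 else 0) + (if 2 * r \<le> a then 1 else 0) + (if 2 * r + 1 \<le> a then 1 else 0)" for a
          using hgt_cancel[OF X2' c3] by (simp add: eX eY)
        have r7: "raising (X - letter_pair r) Bx x"
        proof (rule raisingI[of _ _ _ m])
          show "hgt (X - letter_pair r) Bx a \<le> m" for a
            using eYmax[of a] z2(3)[of a] z1(3)[of a] eYlow[of a] z12 z2r by (auto simp: e7)
          show "a < x \<Longrightarrow> hgt (X - letter_pair r) Bx a < m" for a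
            using x(2)[of a] z2(3)[of a] z1(3)[of a] eYlow[of a] z12 z2r by (auto simp: e7)
        qed (use x xr xz2 z12 m in \<open>auto simp: e7\<close>)
        have "insert x (X - letter_pair r) = Y3 - letter_pair r"
          using xr by (auto simp: XY Y3_def letter_pair_def)
        moreover have "Bx - {x} = By" by (auto simp: Bx_def By_def)
        ultimately have "f X Bx = f (Y3 - letter_pair r) By"
          using f_cancel[OF smX c3] f_raise[OF smXr r7] by simp
        also have "\<dots> = f Y3 By" using f_cancel[OF sm6 c4] by simp
        finally show ?thesis using f2 f3 f4 by (simp add: A0_def Y0_def)
      qed
    qed
  next
    case False
    then have lt: "l < t" using tl by simp
    then have ty: "y < 2 * t" by (auto simp: l_def)
    \<comment> \<open>The move lifts the excess at \<open>t\<close> as well, and at least as much as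
      anywhere else.\<close>
    have "cancelling (insert y A) t"
    proof (rule cancellingI[of _ _ "u + 1"])
      show "excess (insert y A) j \<le> u + 1" for j using Su[of j] by (auto simp: S')
      show "j < t \<Longrightarrow> excess (insert y A) j < u + 1" for j using Sl[of j] by (auto simp: S')
    qed (use lt u in \<open>auto simp: S' u_def\<close>)
    then have tt: "t' = t" using t' cancelling_unique by blast
    define Y where "Y = insert y A - letter_pair t"
    have YA0: "Y = insert y A0" using yt by (auto simp: Y_def A0_def letter_pair_def)
    have smYY: "small N Y (B - {y})" using smY by (simp add: tt Y_def)
    have h1low: "h1 a = h a" if "a < 2 * t" for a using that by (simp add: h1)
    have h1y: "h1 y = m" using ty by (simp add: h1low m_def)
    have h1l: "h1 a < m" if "a < y" for a using hl[OF that] that ty by (simp add: h1low)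
    have h1m: "h1 a \<le> m + 2" for a using hm[of a] by (simp add: h1)
    have "f A0 B = f Y (B - {y})"
    proof (cases "\<exists>a. h1 a \<ge> m + 1")
      \<comment> \<open>Degree 2: the deletion creates no height above \<open>m\<close>, so
        \<open>y\<close> remains the letter to move.\<close>
      case False
      have "h1 a \<le> m" for a using False[simplified, rule_format, of a] by simp
      then have "raising A0 B y"
        using h1y h1l m by (intro raisingI[of _ _ _ m]) (auto simp flip: h1_def)
      from f_raise[OF smA0 this] show ?thesis by (simp add: YA0)
    next
      \<comment> \<open>Beyond the pair \<open>t\<close> the deletion has created heights above
        \<open>m\<close>; other letters now have to move before \<open>y\<close>.\<close>
      case True
      then obtain z2 where z2: "h1 z2 = m + 1" "\<And>a. a < z2 \<Longrightarrow> h1 a < m + 1"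
        using hgt_reach[of "m + 1" A0 B] m unfolding h1_def by force
      have z2t: "2 * t \<le> z2" using z2(1) hm[of z2] h1low[of z2] by (cases "z2 < 2 * t") auto
      have EY: "excess Y j = S j - (if t \<le> j then 2 else 0) + (if l \<le> j then 1 else 0)" for j
        using excess_insert[of y A0 j] yA by (simp add: YA0 S0 l_def) (simp add: A0_def)
      have eY: "hgt Y (B - {y}) a = h1 a - (if y \<le> a then 2 else 0)" for a
      proof -
        have "y \<notin> A0" using yA by (simp add: A0_def)
        then show ?thesis using yA by (simp add: YA0 h1_def hgt_def cnt_insert cnt_remove)
      qed
      \<comment> \<open>The move of \<open>y\<close> has lifted the excess just below
        \<open>t\<close> from \<open>u - 1\<close> to \<open>u\<close>, so on its side a second
        deletion is possible, at a point \<open>s\<close> between \<open>l\<close> and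
        \<open>t\<close>.\<close>
      have "excess Y (t - 1) = u" using tA lt by (auto simp: EY)
      then obtain s where s: "s \<le> t - 1" "excess Y s = u" "\<And>j. j < s \<Longrightarrow> excess Y j < u"
        using excess_reach[of Y u "t - 1"] smYY u by (auto simp: small_def)
      have st: "s < t" using s(1) tA(3) by simp
      have sl: "l \<le> s" using s(2) Sl[of s] st by (auto simp: EY split: if_splits)
      have EYm: "excess Y j \<le> u" for j using Su[of j] Sl[of j] by (auto simp: EY)
      have EYh: "excess Y j = S j - 1" if "t \<le> j" for j using that lt by (auto simp: EY)
      have c1: "cancelling Y s" using s EYm u by (intro cancellingI[of _ _ u]) auto
      have Y2: "Y \<subseteq> {2..}" using smYY by (auto simp: small_def)
      have smYs: "small N (Y - letter_pair s) (B - {y})" using small_cancel[OF smYY] .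
      define h3 where "h3 = hgt (Y - letter_pair s) (B - {y})"
      have h3: "h3 a = h1 a - (if y \<le> a then 2 else 0) + (if 2 * s \<le> a then 1 else 0)
          + (if 2 * s + 1 \<le> a then 1 else 0)" for a
        using hgt_cancel[OF Y2 c1] by (simp add: eY h3_def)
      have ys: "y \<le> 2 * s + 1" using sl by (simp add: l_def)
      have h3low: "h3 a \<le> m" if "a < 2 * t" for a
        using that hm[of a] hl[of a] h1low[of a] ys by (auto simp: h3)
      have h3high: "h3 a = h1 a" if "2 * t \<le> a" for a
        using that st ty by (simp add: h3)
      have h3z2: "h3 a \<le> m" if "a < z2" for a
        using that z2(2)[of a] h3low[of a] h3high[of a] by (cases "a < 2 * t") auto
      show ?thesis
      proof (cases "\<exists>a. h1 a \<ge> m + 2")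
        \<comment> \<open>Degree 4: one side deletes, moves \<open>z2\<close> and \<open>y\<close>,
          and deletes at \<open>s\<close>; the other moves \<open>y\<close>, deletes twice and moves
          \<open>z2\<close>.\<close>
        case False
        have h1m': "h1 a \<le> m + 1" for a using False[simplified, rule_format, of a] by simp
        have r1: "raising A0 B z2"
          using z2 m h1m' by (intro raisingI[of _ _ _ "m + 1"]) (auto simp flip: h1_def)
        have sm1: "small N (insert z2 A0) (B - {z2})" using small_raise[OF smA0 r1] .
        have e1: "hgt (insert z2 A0) (B - {z2}) a = h1 a - (if z2 \<le> a then 2 else 0)" for a
          using hgt_raise[OF r1] by (simp add: h1_def)
        have r2: "raising (insert z2 A0) (B - {z2}) y"
        proof (rule raisingI[of _ _ _ m])
          show "hgt (insert z2 A0) (B - {z2}) a \<le> m" for a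
            using h1m'[of a] z2(2)[of a] by (auto simp: e1)
          show "a < y \<Longrightarrow> hgt (insert z2 A0) (B - {z2}) a < m" for a
            using h1l[of a] by (auto simp: e1)
        qed (use h1y m ty z2t in \<open>auto simp: e1\<close>)
        have sm2: "small N (insert y (insert z2 A0)) (B - {z2} - {y})" using small_raise[OF sm1 r2] .
        define Z where "Z = insert y (insert z2 A0)"
        have E2: "excess Z j = excess Y j + (if z2 div 2 \<le> j then 1 else 0)" for j
          using excess_raise[OF r2, of j] excess_raise[OF r1, of j] by (simp add: Z_def EY S0 l_def)
        have z2t2: "t \<le> z2 div 2" using z2t by auto
        have c2: "cancelling Z s"
        proof (rule cancellingI[of _ _ u])
          show "excess Z j \<le> u" for j using EYm[of j] EYh[of j] Su[of j] z2t2 by (auto simp: E2)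
          show "j < s \<Longrightarrow> excess Z j < u" for j using s(3)[of j] z2t2 st by (auto simp: E2)
        qed (use s u z2t2 st in \<open>auto simp: E2\<close>)
        have f1: "f A0 B = f (Z - letter_pair s) (B - {z2} - {y})"
          using f_raise[OF smA0 r1] f_raise[OF sm1 r2] f_cancel[OF sm2, of s] c2 by (simp add: Z_def)
        have r3: "raising (Y - letter_pair s) (B - {y}) z2"
        proof (rule raisingI[of _ _ _ "m + 1"])
          show "hgt (Y - letter_pair s) (B - {y}) a \<le> m + 1" for a
            using h3low[of a] h3high[of a] h1m'[of a] by (cases "a < 2 * t") (auto simp flip: h3_def)
          show "a < z2 \<Longrightarrow> hgt (Y - letter_pair s) (B - {y}) a < m + 1" for a
            using h3z2[of a] by (auto simp flip: h3_def)
        qed (use z2 z2t h3high m in \<open>auto simp flip: h3_def\<close>)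
        have "insert z2 (Y - letter_pair s) = Z - letter_pair s"
          using z2t st by (auto simp: YA0 Z_def letter_pair_def)
        moreover have "B - {y} - {z2} = B - {z2} - {y}" by auto
        ultimately show ?thesis
          using f1 f_cancel[OF smYY c1] f_raise[OF smYs r3] by simp
      next
        \<comment> \<open>With a level \<open>m + 2\<close> there are three moves after the deletion
          at \<open>t\<close>, namely of \<open>z\<close>, \<open>z2\<close> and
          \<open>y\<close>.\<close>
        case True
        then obtain z where z: "h1 z = m + 2" "\<And>a. a < z \<Longrightarrow> h1 a < m + 2"
          using hgt_reach[of "m + 2" A0 B] m unfolding h1_def by force
        have z2z: "z2 < z" using z(1) z2(1) z2(2)[of z] by (cases z z2 rule: linorder_cases) auto
        have r1: "raising A0 B z"
          using z m h1m by (intro raisingI[of _ _ _ "m + 2"]) (auto simp flip: h1_def)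
        have sm1: "small N (insert z A0) (B - {z})" using small_raise[OF smA0 r1] .
        have e1: "hgt (insert z A0) (B - {z}) a = h1 a - (if z \<le> a then 2 else 0)" for a
          using hgt_raise[OF r1] by (simp add: h1_def)
        have r2: "raising (insert z A0) (B - {z}) z2"
        proof (rule raisingI[of _ _ _ "m + 1"])
          show "hgt (insert z A0) (B - {z}) a \<le> m + 1" for a
            using h1m[of a] z(2)[of a] by (auto simp: e1)
          show "a < z2 \<Longrightarrow> hgt (insert z A0) (B - {z}) a < m + 1" for a
            using z2(2)[of a] by (auto simp: e1)
        qed (use z2 m z2z in \<open>auto simp: e1\<close>)
        have sm2: "small N (insert z2 (insert z A0)) (B - {z} - {z2})" using small_raise[OF sm1 r2] .
        have e2: "hgt (insert z2 (insert z A0)) (B - {z} - {z2}) a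
            = h1 a - (if z \<le> a then 2 else 0) - (if z2 \<le> a then 2 else 0)" for a
          using hgt_raise[OF r2] by (simp add: e1)
        have r3: "raising (insert z2 (insert z A0)) (B - {z} - {z2}) y"
        proof (rule raisingI[of _ _ _ m])
          show "hgt (insert z2 (insert z A0)) (B - {z} - {z2}) a \<le> m" for a
            using h1m[of a] z(2)[of a] z2(2)[of a] by (auto simp: e2)
          show "a < y \<Longrightarrow> hgt (insert z2 (insert z A0)) (B - {z} - {z2}) a < m" for a
            using h1l[of a] by (auto simp: e2)
        qed (use h1y m ty z2t z2z in \<open>auto simp: e2\<close>)
        define Z where "Z = insert y (insert z2 (insert z A0))"
        define Bz where "Bz = B - {z} - {z2} - {y}"
        have sm3: "small N Z Bz" using small_raise[OF sm2 r3] by (simp add: Z_def Bz_def)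
        have f1: "f A0 B = f Z Bz"
          using f_raise[OF smA0 r1] f_raise[OF sm1 r2] f_raise[OF sm2 r3] by (simp add: Z_def Bz_def)
        have e3: "hgt Z Bz a = h1 a - (if z \<le> a then 2 else 0) - (if z2 \<le> a then 2 else 0)
            - (if y \<le> a then 2 else 0)" for a
          using hgt_raise[OF r3] by (simp add: e2 Z_def Bz_def)
        have E3: "excess Z j = excess Y j + (if z2 div 2 \<le> j then 1 else 0) + (if z div 2 \<le> j then 1 else 0)" for j
          using excess_raise[OF r3, of j] excess_raise[OF r2, of j] excess_raise[OF r1, of j]
          by (simp add: Z_def EY S0 l_def)
        have zt2: "t \<le> z2 div 2" "z2 div 2 \<le> z div 2" using z2t z2z by (auto simp: div_le_mono)
        have r4: "raising (Y - letter_pair s) (B - {y}) z"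
        proof (rule raisingI[of _ _ _ "m + 2"])
          show "hgt (Y - letter_pair s) (B - {y}) a \<le> m + 2" for a
            using h3low[of a] h3high[of a] h1m[of a] by (cases "a < 2 * t") (auto simp flip: h3_def)
          show "a < z \<Longrightarrow> hgt (Y - letter_pair s) (B - {y}) a < m + 2" for a
            using h3low[of a] h3high[of a] z(2)[of a] by (cases "a < 2 * t") (auto simp flip: h3_def)
        qed (use z z2z z2t h3high m in \<open>auto simp flip: h3_def\<close>)
        have sm4: "small N (insert z (Y - letter_pair s)) (B - {y} - {z})" using small_raise[OF smYs r4] .
        have e4: "hgt (insert z (Y - letter_pair s)) (B - {y} - {z}) a = h3 a - (if z \<le> a then 2 else 0)" for a
          using hgt_raise[OF r4] by (simp add: h3_def)
        have h3m: "h3 a \<le> m + 2" for a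
          using h3low[of a] h3high[of a] h1m[of a] by (cases "a < 2 * t") auto
        have h3z: "h3 a \<le> m + 1" if "a < z" for a
          using that h3low[of a] h3high[of a] z(2)[of a] by (cases "a < 2 * t") auto
        have r5: "raising (insert z (Y - letter_pair s)) (B - {y} - {z}) z2"
        proof (rule raisingI[of _ _ _ "m + 1"])
          show "hgt (insert z (Y - letter_pair s)) (B - {y} - {z}) a \<le> m + 1" for a
            using h3m[of a] h3z[of a] by (auto simp: e4)
          show "a < z2 \<Longrightarrow> hgt (insert z (Y - letter_pair s)) (B - {y} - {z}) a < m + 1" for a
            using h3z2[of a] by (auto simp: e4)
        qed (use z2 z2t z2z h3high m in \<open>auto simp: e4\<close>)
        define W where "W = insert z2 (insert z (Y - letter_pair s))"
        define Bw where "Bw = B - {y} - {z} - {z2}"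
        have sm5: "small N W Bw" using small_raise[OF sm4 r5] by (simp add: W_def Bw_def)
        have e5: "hgt W Bw a = h3 a - (if z \<le> a then 2 else 0) - (if z2 \<le> a then 2 else 0)" for a
          using hgt_raise[OF r5] by (simp add: e4 W_def Bw_def)
        have E5: "excess W j = excess Y j - (if s \<le> j then 2 else 0)
            + (if z2 div 2 \<le> j then 1 else 0) + (if z div 2 \<le> j then 1 else 0)" for j
          using excess_raise[OF r5, of j] excess_raise[OF r4, of j] excess_cancel[OF Y2 c1, of j]
          by (simp add: W_def)
        have f2: "f Y (B - {y}) = f W Bw"
          using f_cancel[OF smYY c1] f_raise[OF smYs r4] f_raise[OF sm4 r5] by (simp add: W_def Bw_def)
        have Bzw: "Bz = Bw" by (auto simp: Bz_def Bw_def)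
        have ZW: "Z - letter_pair s = W"
          using z2t z2z st by (auto simp: YA0 Z_def W_def letter_pair_def)
        have Z2: "Z \<subseteq> {2..}" "W \<subseteq> {2..}" using sm3 sm5 by (auto simp: small_def)
        have EZlow: "excess Z j = excess Y j" if "j < t" for j
          using that zt2 by (simp add: E3)
        show ?thesis
        proof (cases "\<exists>j\<ge>z div 2. S j = u")
          \<comment> \<open>Degree 5: the added letters \<open>z2\<close> and \<open>z\<close> lift
            no excess above \<open>u\<close>, so \<open>s\<close> remains the place of the next
            deletion.\<close>
          case False
          then have Slz: "S j < u" if "z div 2 \<le> j" for j using Su[of j] that by (meson order_less_le)
          have c2: "cancelling Z s"
          proof (rule cancellingI[of _ _ u])
            show "excess Z j \<le> u" for j
              using EYm[of j] EYh[of j] Su[of j] Slz[of j] zt2 by (auto simp: E3)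
            show "j < s \<Longrightarrow> excess Z j < u" for j using s(3)[of j] st EZlow[of j] by auto
          qed (use s u st EZlow in auto)
          show ?thesis using f1 f2 f_cancel[OF sm3 c2] by (simp add: ZW Bzw)
        next
          \<comment> \<open>Degree 7: at \<open>q\<close> the excess has become
            \<open>u + 1\<close>, so on one side a deletion at \<open>q\<close> precedes the one at
            \<open>s\<close>. The other side performs it last, once both have moved the same further
            letter \<open>x\<close>.\<close>
          case True
          define q where "q = (LEAST j. z div 2 \<le> j \<and> S j = u)"
          have q: "z div 2 \<le> q" "S q = u" using LeastI_ex[of "\<lambda>j. z div 2 \<le> j \<and> S j = u"] True
            by (auto simp: q_def)
          have qmin: "S j < u" if "z div 2 \<le> j" "j < q" for j
            using not_less_Least[of j "\<lambda>j. z div 2 \<le> j \<and> S j = u"] that Su[of j]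
            by (auto simp: q_def order_less_le)
          have c2: "cancelling Z q"
          proof (rule cancellingI[of _ _ "u + 1"])
            show "excess Z j \<le> u + 1" for j using EYm[of j] EYh[of j] Su[of j] zt2 by (auto simp: E3)
            show "j < q \<Longrightarrow> excess Z j < u + 1" for j
              using EYm[of j] EYh[of j] Su[of j] qmin[of j] zt2 by (auto simp: E3)
            show "excess Z q = u + 1" using q zt2 EYh[of q] by (auto simp: E3)
          qed (use u in auto)
          have smZq: "small N (Z - letter_pair q) Bz" using small_cancel[OF sm3] .
          have Eq: "excess (Z - letter_pair q) j = excess Z j - (if q \<le> j then 2 else 0)" for j
            using excess_cancel[OF Z2(1) c2] .
          have eq: "hgt (Z - letter_pair q) Bz a = hgt Z Bz a + (if 2 * q \<le> a then 1 else 0)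
              + (if 2 * q + 1 \<le> a then 1 else 0)" for a
            using hgt_cancel[OF Z2(1) c2] .
          have sq: "s < q" using st zt2 q by simp
          have c3: "cancelling (Z - letter_pair q) s"
          proof (rule cancellingI[of _ _ u])
            show "excess (Z - letter_pair q) j \<le> u" for j
              using EYm[of j] EYh[of j] Su[of j] qmin[of j] zt2 q by (auto simp: E3 Eq)
            show "j < s \<Longrightarrow> excess (Z - letter_pair q) j < u" for j
              using s(3)[of j] st EZlow[of j] sq by (auto simp: Eq)
          qed (use s u st EZlow sq in \<open>auto simp: Eq\<close>)
          have Zq2: "Z - letter_pair q \<subseteq> {2..}" using Z2 by auto
          have smZqs: "small N (Z - letter_pair q - letter_pair s) Bz" using small_cancel[OF smZq] .
          have eqs: "hgt (Z - letter_pair q - letter_pair s) Bz a = h3 a - (if z \<le> a then 2 else 0)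
              - (if z2 \<le> a then 2 else 0) + (if 2 * q \<le> a then 1 else 0) + (if 2 * q + 1 \<le> a then 1 else 0)" for a
            using hgt_cancel[OF Zq2 c3] by (simp add: eq e3 h3)
          have h3z2': "h3 z2 = m + 1" using z2 z2t h3high by simp
          \<comment> \<open>Having moved \<open>z\<close> and \<open>z2\<close>, the remaining
            maximum of the height is \<open>m\<close>; it is first reached between the pair
            \<open>s\<close> and \<open>z2\<close>.\<close>
          obtain x where x: "h3 x = m" "x \<le> z2" "\<And>a. a < x \<Longrightarrow> h3 a < m"
            using hgt_reach[of m "Y - letter_pair s" "B - {y}" z2] h3z2' m unfolding h3_def by auto
          have xz2: "x < z2" using x(1,2) h3z2' by (cases "x = z2") auto
          have zq: "z \<le> 2 * q + 1" using q by simp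
          have r6: "raising (Z - letter_pair q - letter_pair s) Bz x"
          proof (rule raisingI[of _ _ _ m])
            show "hgt (Z - letter_pair q - letter_pair s) Bz a \<le> m" for a
              using h3m[of a] h3z[of a] h3z2[of a] z2z zq by (auto simp: eqs)
            show "a < x \<Longrightarrow> hgt (Z - letter_pair q - letter_pair s) Bz a < m" for a
              using x(3)[of a] xz2 z2z zq by (auto simp: eqs)
          qed (use x xz2 z2z zq m in \<open>auto simp: eqs\<close>)
          have r7: "raising W Bw x"
          proof (rule raisingI[of _ _ _ m])
            show "hgt W Bw a \<le> m" for a using h3m[of a] h3z[of a] h3z2[of a] z2z by (auto simp: e5)
            show "a < x \<Longrightarrow> hgt W Bw a < m" for a using x(3)[of a] xz2 z2z by (auto simp: e5)
          qed (use x xz2 z2z m in \<open>auto simp: e5\<close>)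
          have sm7: "small N (insert x W) (Bw - {x})" using small_raise[OF sm5 r7] .
          have E7: "excess (insert x W) j = excess W j + (if x div 2 \<le> j then 1 else 0)" for j
            using excess_raise[OF r7] .
          have xz: "x div 2 \<le> z2 div 2" using xz2 by (simp add: div_le_mono)
          have "2 * s \<le> x"
          proof (rule ccontr)
            assume "\<not> ?thesis"
            then have "h3 x < m"
              using hl[of x] hm[of x] h1low[of x] st by (auto simp: h3)
            then show False using x by simp
          qed
          then have xs: "s \<le> x div 2" by simp
          have c4: "cancelling (insert x W) q"
          proof (rule cancellingI[of _ _ u])
            show "excess (insert x W) j \<le> u" for j
              using EYm[of j] EYh[of j] Su[of j] zt2 st xs by (auto simp: E7 E5)
            show "excess (insert x W) q = u" using EYh[of q] q zt2 st xz by (auto simp: E7 E5)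
            show "j < q \<Longrightarrow> excess (insert x W) j < u" for j
              using EYm[of j] s(3)[of j] EYh[of j] Su[of j] qmin[of j] zt2 st xs
              by (cases "j < s"; cases "j < t") (auto simp: E7 E5)
          qed (use u in auto)
          have "insert x (Z - letter_pair q - letter_pair s) = insert x W - letter_pair q"
            using xz2 z2z zq sq q by (auto simp: letter_pair_def simp flip: ZW)
          then show ?thesis
            using f1 f2 f_cancel[OF sm3 c2] f_cancel[OF smZq c3] f_raise[OF smZqs r6]
              f_raise[OF sm5 r7] f_cancel[OF sm7 c4] by (simp add: Bzw)
        qed
      qed
    qed
    then show ?thesis by (simp add: A0_def Y_def tt)
  qed
qed

section \<open>Uniqueness of the Schensted tableau\<close>

lemma row_insert_bump:
  "\<forall>p\<in>set P. p \<le> a \<Longrightarrow> a < b \<Longrightarrow> row_insert a (P @ b # N) = (P @ a # N, Some b)"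
  by (induction P) auto

lemma row_insert_end: "\<forall>p\<in>set P. p \<le> a \<Longrightarrow> row_insert a P = (P @ [a], None)"
  by (induction P) auto

lemma sorted_split:
  fixes a :: letter
  assumes "sorted R"
  obtains P N where "R = P @ N" "\<forall>p\<in>set P. p \<le> a" "\<forall>n\<in>set N. a < n"
proof
  show "R = takeWhile (\<lambda>b. b \<le> a) R @ dropWhile (\<lambda>b. b \<le> a) R" by simp
  show "\<forall>p\<in>set (takeWhile (\<lambda>b. b \<le> a) R). p \<le> a" using set_takeWhileD by fast
  show "\<forall>n\<in>set (dropWhile (\<lambda>b. b \<le> a) R). a < n"
  proof (cases "dropWhile (\<lambda>b. b \<le> a) R")
    case Nil
    show ?thesis unfolding Nil by simp
  next
    case (Cons b N)
    then have "a < b" using hd_dropWhile[of "\<lambda>b. b \<le> a" R] by simp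
    moreover have "sorted (b # N)"
      using assms Cons by (metis sorted_append takeWhile_dropWhile_id)
    ultimately show ?thesis using Cons by auto
  qed
qed

lemma row_insert_cases:
  assumes "sorted R"
  obtains (bump) P b N where "R = P @ b # N" "\<forall>p\<in>set P. p \<le> a" "a < b" "\<forall>n\<in>set N. a < n"
      "row_insert a R = (P @ a # N, Some b)"
  | (end_of_row) "\<forall>p\<in>set R. p \<le> a" "row_insert a R = (R @ [a], None)"
proof -
  obtain P N where PN: "R = P @ N" "\<forall>p\<in>set P. p \<le> a" "\<forall>n\<in>set N. a < n"
    using sorted_split[OF assms] .
  show thesis
  proof (cases N)
    case Nil
    then show ?thesis using PN end_of_row row_insert_end by simp
  next
    case (Cons b N')
    then show ?thesis using PN bump[of P b N'] row_insert_bump by simp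
  qed
qed

text \<open>Insertion is organized row by row instead of letter by letter: the letters bumped from
  one row, in order, form the word for the next. Invariance then becomes a statement about a single
  row.\<close>

fun pass :: "letter list \<Rightarrow> letter list \<Rightarrow> letter list \<times> letter list" where
  "pass R [] = (R, [])"
| "pass R (a # w) = (let (R', out) = row_insert a R; (R'', out') = pass R' w
     in (R'', (case out of None \<Rightarrow> [] | Some b \<Rightarrow> [b]) @ out'))"

lemma pass_append:
  "pass R (u @ v) = (let (R', out) = pass R u; (R'', out') = pass R' v in (R'', out @ out'))"
proof (induction u arbitrary: R)
  case (Cons a u)
  obtain R' out where R': "row_insert a R = (R', out)" by (cases "row_insert a R")
  show ?case using R' Cons.IH[of R'] by (simp split: prod.splits)
qed simp

lemma sorted_row_insert: "sorted R \<Longrightarrow> sorted (fst (row_insert a R))"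
  by (rule row_insert_cases[of R a])
    (auto simp: sorted_append less_imp_le)

lemma sorted_pass: "sorted R \<Longrightarrow> sorted (fst (pass R w))"
proof (induction w arbitrary: R)
  case (Cons a w)
  obtain R' out where R': "row_insert a R = (R', out)" by (cases "row_insert a R")
  then have "sorted (fst (pass R' w))"
    using Cons sorted_row_insert[of R a] by simp
  then show ?case using R' by (simp add: case_prod_unfold Let_def)
qed simp

lemma length_pass: "length (snd (pass R w)) \<le> length w"
proof (induction w arbitrary: R)
  case (Cons a w)
  obtain R' out where R': "row_insert a R = (R', out)" by (cases "row_insert a R")
  show ?case using R' Cons.IH[of R'] by (cases out) (simp_all add: case_prod_unfold Let_def)
qed simp

text \<open>In both orders \<open>x\<close> bumps the same letter \<open>e\<close>, at or to the
  left of the new \<open>y\<close>, while \<open>z\<close> acts further to the right. The bumped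
  words coincide or are related by the same kind of Knuth relation.\<close>

lemma pass_yxz:
  assumes "sorted R" "x < y" "y \<le> z"
  shows "fst (pass R [y, x, z]) = fst (pass R [y, z, x]) \<and>
    snd (pass R [y, x, z]) \<approx> snd (pass R [y, z, x])"
proof -
  obtain P N where PN: "R = P @ N" "\<forall>p\<in>set P. p \<le> y" "\<forall>n\<in>set N. y < n"
    using sorted_split[OF assms(1)] .
  have "sorted P" "sorted N" using assms(1) PN by (auto simp: sorted_append)
  obtain P1 P2 where P: "P = P1 @ P2" "\<forall>p\<in>set P1. p \<le> x" "\<forall>p\<in>set P2. x < p"
    using sorted_split[OF \<open>sorted P\<close>] .
  obtain e E where e: "P2 @ [y] = e # E" by (cases "P2 @ [y]") auto
  have eE: "x < e" "\<forall>p\<in>set (e # E). p \<le> y"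
  proof -
    have "\<forall>p\<in>set (e # E). x < p \<and> p \<le> y"
      unfolding e[symmetric] using P PN assms(2) by auto
    then show "x < e" "\<forall>p\<in>set (e # E). p \<le> y" by auto
  qed
  have eE': "P1 @ e # E = P @ [y]" using P e by simp
  define N' where "N' = tl N"
  have ins_y: "row_insert y R = (P1 @ e # E @ N', if N = [] then None else Some (hd N))"
  proof (cases N)
    case Nil
    then show ?thesis using row_insert_end[of P y] PN eE' by (simp add: N'_def)
  next
    case (Cons n N2)
    then show ?thesis using row_insert_bump[of P y n N2] PN eE' by (simp add: N'_def)
  qed
  have "sorted N'" using \<open>sorted N\<close> by (simp add: N'_def sorted_tl)
  obtain L H where LH: "N' = L @ H" "\<forall>p\<in>set L. p \<le> z" "\<forall>p\<in>set H. z < p"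
    using sorted_split[OF \<open>sorted N'\<close>] .
  have ins_x: "row_insert x (P1 @ e # X) = (P1 @ x # X, Some e)" for X
    using P eE by (intro row_insert_bump) auto
  have "p \<le> z" if "p \<in> set P1 \<union> set (e # E)" for p
  proof -
    have "p \<le> y" using that PN P eE(2) by auto
    then show ?thesis using assms(3) by simp
  qed
  then have lez: "\<forall>p\<in>set (P1 @ e # E @ L). p \<le> z" "\<forall>p\<in>set (P1 @ x # E @ L). p \<le> z"
    using LH assms by auto
  show ?thesis
  proof (cases H)
    case Nil
    have "row_insert z (P1 @ e # E @ L) = (P1 @ e # E @ L @ [z], None)"
      "row_insert z (P1 @ x # E @ L) = (P1 @ x # E @ L @ [z], None)"
      using row_insert_end[OF lez(1)] row_insert_end[OF lez(2)] by auto
    then show ?thesis using ins_y ins_x LH Nil by simp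
  next
    case (Cons c H')
    then have "row_insert z (P1 @ e # E @ L @ c # H') = (P1 @ e # E @ L @ z # H', Some c)"
      "row_insert z (P1 @ x # E @ L @ c # H') = (P1 @ x # E @ L @ z # H', Some c)"
      using row_insert_bump[of "P1 @ e # E @ L" z c H'] row_insert_bump[of "P1 @ x # E @ L" z c H'] lez LH
      by auto
    moreover obtain n N2 where N: "N = n # N2" using Cons LH by (cases N) (auto simp: N'_def)
    moreover have "[n, e, c] \<approx> [n, c, e]"
    proof -
      have "c \<in> set N2" using N Cons LH by (simp add: N'_def)
      then have "n \<le> c" using \<open>sorted N\<close> N by auto
      moreover have "e < n" using eE PN N by force
      ultimately show ?thesis using knuth_yxz[of e n c "[]" "[]"] by simp
    qed
    ultimately show ?thesis using ins_y ins_x LH Cons by simp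
  qed
qed

text \<open>If some entry exceeds \<open>x\<close> but not \<open>z\<close>, the bumped words
  coincide or are related by the same kind of relation. If there is none (\<open>L = []\<close>),
  then \<open>z\<close> is itself bumped, by \<open>y\<close> in one order and by \<open>x\<close>
  in the other, and the relation of the other kind may appear.\<close>

lemma pass_xzy:
  assumes "sorted R" "x \<le> y" "y < z"
  shows "fst (pass R [x, z, y]) = fst (pass R [z, x, y]) \<and>
    snd (pass R [x, z, y]) \<approx> snd (pass R [z, x, y])"
proof -
  obtain P N where PN: "R = P @ N" "\<forall>p\<in>set P. p \<le> x" "\<forall>n\<in>set N. x < n"
    using sorted_split[OF assms(1)] .
  have "sorted P" "sorted N" using assms(1) PN by (auto simp: sorted_append)
  obtain L H where LH: "N = L @ H" "\<forall>p\<in>set L. p \<le> z" "\<forall>p\<in>set H. z < p"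
    using sorted_split[OF \<open>sorted N\<close>] .
  have ins_x: "row_insert x (P @ n # X) = (P @ x # X, Some n)" if "x < n" for n X
    using PN that by (intro row_insert_bump) auto
  have ins_x0: "row_insert x P = (P @ [x], None)"
    using PN by (intro row_insert_end) auto
  have Pz: "\<forall>p\<in>set P. p \<le> z" "\<forall>p\<in>set P. p \<le> y" "x \<le> z"
    using PN assms by force+
  show ?thesis
  proof (cases L)
    case (Cons l L')
    have lx: "x < l" using PN LH Cons by auto
    have "sorted (L' @ [z])" using \<open>sorted N\<close> LH Cons by (auto simp: sorted_append)
    then obtain D1 D2 where D: "L' @ [z] = D1 @ D2" "\<forall>p\<in>set D1. p \<le> y" "\<forall>p\<in>set D2. y < p"
      by (rule sorted_split)
    obtain d D3 where D2: "D2 = d # D3"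
      using D assms by (cases D2) (auto dest: arg_cong[of _ _ set])
    have d: "d \<in> set (L' @ [z])" "y < d" using D D2 by auto
    have ins_y: "row_insert y (P @ x # L' @ z # X) = (P @ x # D1 @ y # D3 @ X, Some d)" for X
    proof -
      have "P @ x # L' @ z # X = P @ x # (L' @ [z]) @ X" by simp
      also have "\<dots> = (P @ x # D1) @ d # (D3 @ X)" unfolding D(1) D2 by simp
      finally have eq: "P @ x # L' @ z # X = (P @ x # D1) @ d # (D3 @ X)" .
      have "\<forall>p\<in>set (P @ x # D1). p \<le> y" using Pz D(2) assms by auto
      then show ?thesis
        unfolding eq using row_insert_bump[of "P @ x # D1" y d "D3 @ X"] d(2) by simp
    qed
    have lez: "\<forall>p\<in>set (P @ x # L'). p \<le> z" "\<forall>p\<in>set (P @ l # L'). p \<le> z"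
      using Pz LH Cons by auto
    show ?thesis
    proof (cases H)
      case Nil
      have "row_insert z (P @ x # L') = (P @ x # L' @ [z], None)"
        "row_insert z (P @ l # L') = (P @ l # L' @ [z], None)"
        using row_insert_end[OF lez(1)] row_insert_end[OF lez(2)] by auto
      then show ?thesis using ins_x[OF lx] ins_y[of "[]"] PN LH Cons Nil by simp
    next
      case H: (Cons c H')
      have "row_insert z (P @ x # L' @ c # H') = (P @ x # L' @ z # H', Some c)"
        "row_insert z (P @ l # L' @ c # H') = (P @ l # L' @ z # H', Some c)"
        using row_insert_bump[of "P @ x # L'" z c H'] row_insert_bump[of "P @ l # L'" z c H'] lez LH H
        by auto
      moreover have "[l, c, d] \<approx> [c, l, d]"
      proof -
        have "l \<le> d" using d \<open>sorted N\<close> LH Cons by auto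
        moreover have "d < c" using d LH H Cons by force
        ultimately show ?thesis using knuth_xzy[of l d c "[]" "[]"] by simp
      qed
      ultimately show ?thesis using ins_x[OF lx] ins_y PN LH Cons H by simp
    qed
  next
    case Nil
    have ins_z: "row_insert z (P @ n # X) = (P @ z # X, Some n)" if "z < n" for n X
      using Pz that by (intro row_insert_bump) auto
    have ins_z0: "row_insert z P = (P @ [z], None)"
      using Pz by (intro row_insert_end) auto
    have ins_xz: "row_insert z (P @ x # n # X) = (P @ x # z # X, Some n)" if "z < n" for n X
      using row_insert_bump[of "P @ [x]" z n X] Pz that by auto
    have ins_xz0: "row_insert z (P @ [x]) = (P @ [x, z], None)"
      using row_insert_end[of "P @ [x]" z] Pz by auto
    have ins_y: "row_insert y (P @ x # n # X) = (P @ x # y # X, Some n)" if "y < n" for n X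
      using row_insert_bump[of "P @ [x]" y n X] Pz that assms by auto
    have ins_y0: "row_insert y (P @ [x]) = (P @ [x, y], None)"
      using row_insert_end[of "P @ [x]" y] Pz assms by auto
    have xz: "x < z" using assms by simp
    show ?thesis
    proof (cases H)
      case H: Nil
      then show ?thesis
        using PN LH Nil ins_x0 ins_xz0 ins_y[OF assms(3)] ins_z0 ins_x[OF xz] ins_y0 by simp
    next
      case H: (Cons n H')
      then have zn: "z < n" "x < n" "y < n" using LH assms xz by auto
      show ?thesis
      proof (cases H')
        case H': Nil
        then show ?thesis
          using PN LH Nil H zn ins_x[OF zn(2)] ins_xz0 ins_y[OF assms(3)] ins_z[OF zn(1)] ins_x[OF xz] ins_y0
          by simp
      next
        case H': (Cons n2 H2)
        then have n2: "n \<le> n2" "z < n2" "y < n2" using \<open>sorted N\<close> LH H H' assms by (auto simp: sorted_append)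
        have "[n, z, n2] \<approx> [n, n2, z]"
          using knuth_yxz[of z n n2 "[]" "[]"] zn n2 by simp
        then show ?thesis
          using PN LH Nil H H' zn n2 ins_x[OF zn(2)] ins_xz[OF n2(2)] ins_y[OF assms(3)] ins_z[OF zn(1)]
            ins_x[OF xz] ins_y[OF n2(3)] by (auto intro: knuth_sym)
      qed
    qed
  qed
qed

lemma pass_context:
  assumes "\<And>R. sorted R \<Longrightarrow> fst (pass R w) = fst (pass R w') \<and> snd (pass R w) \<approx> snd (pass R w')"
    and "sorted R"
  shows "fst (pass R (u @ w @ v)) = fst (pass R (u @ w' @ v)) \<and>
    snd (pass R (u @ w @ v)) \<approx> snd (pass R (u @ w' @ v))"
  using assms(1)[OF sorted_pass[OF assms(2), of u]]
  by (auto simp: pass_append case_prod_unfold Let_def intro: knuth_context)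

lemma pass_knuth:
  assumes "w \<approx> w'" "sorted R"
  shows "fst (pass R w) = fst (pass R w') \<and> snd (pass R w) \<approx> snd (pass R w')"
  using assms
proof (induction rule: equivclp_induct)
  case base
  then show ?case by simp
next
  case (step y z)
  have *: "fst (pass R v) = fst (pass R v') \<and> snd (pass R v) \<approx> snd (pass R v')"
    if "knuth_step v v'" for v v'
    using that
  proof cases
    case (1 x y z u t)
    show ?thesis unfolding 1 using pass_yxz[OF _ 1(3,4)] step.prems by (intro pass_context) auto
  next
    case (2 x y z u t)
    show ?thesis unfolding 2 using pass_xzy[OF _ 2(3,4)] step.prems by (intro pass_context) auto
  qed
  from step.hyps(2) have "fst (pass R y) = fst (pass R z) \<and> snd (pass R y) \<approx> snd (pass R z)"
    using *[of y z] *[of z y] knuth_sym by auto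
  with step.IH[OF step.prems] show ?case using knuth_trans by auto
qed

function schensted :: "letter list \<Rightarrow> tableau" where
  "schensted w = (if w = [] then [] else fst (pass [] w) # schensted (snd (pass [] w)))"
  by auto
termination
proof (relation "measure length")
  fix w :: "letter list" assume "w \<noteq> []"
  \<comment> \<open>The first letter enters an empty row and bumps nothing, so the word for the next
    row is strictly shorter.\<close>
  then obtain a v where "w = a # v" by (cases w) auto
  then have "length (snd (pass [] w)) \<le> length v"
    using length_pass[of "[a]" v] by (simp add: case_prod_unfold Let_def)
  then show "(snd (pass [] w), w) \<in> measure length" using \<open>w = a # v\<close> by simp
qed simp

declare schensted.simps [simp del]

lemma schensted_knuth: "w \<approx> w' \<Longrightarrow> schensted w = schensted w'"
proof (induction w arbitrary: w' rule: schensted.induct)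
  case (1 w)
  show ?case
  proof (cases "w = []")
    case True
    then have "w' = []" using knuth_length[OF "1.prems"] by simp
    then show ?thesis using True by simp
  next
    case False
    then have "w' \<noteq> []" using knuth_length[OF "1.prems"] by auto
    have "fst (pass [] w) = fst (pass [] w')" "snd (pass [] w) \<approx> snd (pass [] w')"
      using pass_knuth[OF "1.prems", of "[]"] by auto
    then show ?thesis
      using "1.IH"[OF False] False \<open>w' \<noteq> []\<close> by (simp add: schensted.simps[of w] schensted.simps[of w'])
  qed
qed

text \<open>A row inserted into the row below it replaces that row letter by letter and expels it
  unchanged. This is how insertion rebuilds a tableau from its row word.\<close>

lemma pass_above:
  assumes "sorted (L @ A)" "sorted C" "above A C"
  shows "pass (L @ C) A = (L @ A, C)"
  using assms
proof (induction A arbitrary: L C)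
  case Nil
  then show ?case by simp
next
  case (Cons a A)
  have L: "\<forall>p\<in>set L. p \<le> a" using Cons.prems by (auto simp: sorted_append)
  show ?case
  proof (cases C)
    case Nil
    then show ?thesis using Cons.IH[of "L @ [a]" "[]"] Cons.prems row_insert_end[OF L] by simp
  next
    case C: (Cons c C')
    then show ?thesis using Cons.IH[of "L @ [a]" C'] Cons.prems row_insert_bump[OF L, of c C'] by simp
  qed
qed

lemma pass_row_word: "tab (R # Rs) \<Longrightarrow> pass [] (row_word (R # Rs)) = (R, row_word Rs)"
proof (induction Rs arbitrary: R)
  case Nil
  then show ?case using pass_above[of "[]" R "[]"] by simp
next
  case (Cons R' Rs)
  then have "pass [] (row_word (R' # Rs)) = (R', row_word Rs)" by simp
  then show ?case using pass_above[of "[]" R R'] pass_append[of "[]" "row_word Rs @ R'" R] Cons.prems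
    by simp
qed

lemma schensted_row_word: "tab T \<Longrightarrow> [] \<notin> set T \<Longrightarrow> schensted (row_word T) = T"
proof (induction T)
  case Nil
  then show ?case by (simp add: schensted.simps)
next
  case (Cons R T)
  then have "R \<noteq> []" by auto
  then show ?case using Cons pass_row_word[of R T] schensted.simps[of "row_word (R # T)"] by simp
qed

lemma tab_unique:
  assumes "tab T" "[] \<notin> set T" "tab T'" "[] \<notin> set T'" "row_word T \<approx> row_word T'"
  shows "T = T'"
  using schensted_knuth[OF assms(5)] schensted_row_word assms by simp

section \<open>Berele insertion and Knuth equivalence\<close>

definition first_row :: "tableau \<Rightarrow> letter list" where
  "first_row T = (case T of [] \<Rightarrow> [] | R # _ \<Rightarrow> R)"

lemma first_row_simps [simp]: "first_row [] = []" "first_row (R # Rs) = R"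
  by (simp_all add: first_row_def)

text \<open>The list consists of the rows \<open>i, i + 1, \<dots>\<close> of the tableau.\<close>

fun king :: "nat \<Rightarrow> tableau \<Rightarrow> bool" where
  "king i [] \<longleftrightarrow> True"
| "king i (R # Rs) \<longleftrightarrow> R \<noteq> [] \<and> sorted R \<and> (\<forall>a\<in>set R. Plain i \<le> a) \<and> above R (first_row Rs) \<and> king (Suc i) Rs"

lemma king_tab: "king i T \<Longrightarrow> tab T"
proof (induction T arbitrary: i)
  case (Cons R Rs)
  have "tab Rs" using Cons.IH[of "Suc i"] Cons.prems by simp
  then show ?case using Cons.prems by (cases Rs) simp_all
qed simp

lemma king_nonempty: "king i T \<Longrightarrow> [] \<notin> set T"
proof (induction T arbitrary: i)
  case (Cons R Rs)
  then have "[] \<notin> set Rs" by auto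
  then show ?case using Cons.prems by auto
qed simp

lemma plain_le_iff: "Plain i \<le> a \<longleftrightarrow> 2 * i \<le> letter_rank a"
  by (simp add: less_eq_letter_def)

lemma letter_less_iff: "a < b \<longleftrightarrow> letter_rank a < letter_rank b"
  by (simp add: less_letter_def)

lemma letter_le_iff: "a \<le> b \<longleftrightarrow> letter_rank a \<le> letter_rank b" for a b :: letter
  by (simp add: less_eq_letter_def)

lemma plain_mono: "i \<le> j \<Longrightarrow> Plain j \<le> a \<Longrightarrow> Plain i \<le> a"
  by (simp add: plain_le_iff)

section \<open>Jeu de taquin\<close>

lemma jdt_up:
  assumes "Suc r < length T" "c < length (T ! Suc r)"
    "Suc c < length (T ! r) \<Longrightarrow> T ! Suc r ! c \<le> T ! r ! Suc c"
  shows "jdt T r c = jdt (T[r := (T ! r)[c := T ! Suc r ! c]]) (Suc r) c"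
  using assms by (subst jdt.simps) (auto simp: Let_def)

lemma jdt_right:
  assumes "r < length T" "Suc c < length (T ! r)"
    "\<not> (Suc r < length T \<and> c < length (T ! Suc r) \<and> T ! Suc r ! c \<le> T ! r ! Suc c)"
  shows "jdt T r c = jdt (T[r := (T ! r)[c := T ! r ! Suc c]]) r (Suc c)"
  using assms by (subst jdt.simps) (auto simp: Let_def)

lemma jdt_stop:
  assumes "\<not> (Suc r < length T \<and> c < length (T ! Suc r))" "\<not> (r < length T \<and> Suc c < length (T ! r))"
  shows "jdt T r c = filter (\<lambda>R. R \<noteq> []) (T[r := butlast (T ! r)])"
  using assms by (subst jdt.simps) (auto simp: Let_def)

text \<open>The empty box never moves up. The row on top must be nonempty in order to survive the
  final removal of empty rows.\<close>

lemma jdt_Cons: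
  assumes "X \<noteq> []"
  shows "jdt (X # T) (Suc r) c = X # jdt T r c"
proof (induction T r c rule: jdt.induct)
  case (1 T r c)
  consider (up) "Suc r < length T" "c < length (T ! Suc r)"
      "Suc c < length (T ! r) \<longrightarrow> T ! Suc r ! c \<le> T ! r ! Suc c"
    | (rightwards) "r < length T" "Suc c < length (T ! r)"
      "\<not> (Suc r < length T \<and> c < length (T ! Suc r) \<and> T ! Suc r ! c \<le> T ! r ! Suc c)"
    | (stop) "\<not> (Suc r < length T \<and> c < length (T ! Suc r))" "\<not> (r < length T \<and> Suc c < length (T ! r))"
    by linarith
  then show ?case
  proof cases
    case up
    let ?T = "T[r := (T ! r)[c := T ! Suc r ! c]]"
    have "jdt (X # T) (Suc r) c = jdt (X # ?T) (Suc (Suc r)) c"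
      using up by (subst jdt_up) auto
    also have "\<dots> = X # jdt ?T (Suc r) c" using "1.IH"(1) up by simp
    also have "jdt ?T (Suc r) c = jdt T r c" using up by (subst jdt_up[of r T c]) auto
    finally show ?thesis .
  next
    case rightwards
    let ?T = "T[r := (T ! r)[c := T ! r ! Suc c]]"
    have "jdt (X # T) (Suc r) c = jdt (X # ?T) (Suc r) (Suc c)"
      using rightwards by (subst jdt_right) auto
    also have "\<dots> = X # jdt ?T r (Suc c)" using "1.IH"(2) rightwards by auto
    also have "jdt ?T r (Suc c) = jdt T r c" using rightwards by (subst jdt_right[of r T c]) auto
    finally show ?thesis .
  next
    case stop
    then show ?thesis using assms by (subst (1 2) jdt_stop) auto
  qed
qed

lemma above_nth: "above P Q \<Longrightarrow> m < length Q \<Longrightarrow> P ! m < Q ! m"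
  by (simp add: above_def)

lemma above_length: "above P Q \<Longrightarrow> length Q \<le> length P"
  by (simp add: above_def)

lemma aboveI: "length Q \<le> length P \<Longrightarrow> (\<And>m. m < length Q \<Longrightarrow> P ! m < Q ! m) \<Longrightarrow> above P Q"
  by (simp add: above_def)

text \<open>Insert the upper row into the lower one: \<open>A\<close> bumps \<open>C\<close>, then
  \<open>B\<close> bumps \<open>D\<close>, and \<open>b\<close> stays between the two halves of the
  new upper row.\<close>

lemma knuth_slide_up:
  assumes "sorted (C @ b # D)" "sorted (A @ b # B)" "list_all2 (<) A C" "above B D"
  shows "(C @ b # D) @ (A @ B) \<approx> (C @ D) @ (A @ b # B)"
proof -
  obtain B1 B2 where B: "B = B1 @ B2" "list_all2 (<) B1 D"
    using assms(4) by (rule above_split)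
  have bD: "\<forall>d\<in>set D. b \<le> d" "\<forall>c\<in>set A. c \<le> b" using assms by (auto simp: sorted_append)
  then have "\<forall>x\<in>set A. \<forall>d\<in>set D. x \<le> d" by (meson order.trans)
  then have "sorted (A @ b # D)" using assms bD by (auto simp: sorted_append)
  then have "[] @ C @ (b # D) @ A \<approx> C @ [] @ A @ b # D"
    using assms by (intro knuth_bump_block) (auto simp: list_all2_lengthD)
  then have "(C @ b # D) @ A \<approx> C @ A @ b # D" by simp
  from knuth_append_right[OF this, of B]
  have "(C @ b # D) @ (A @ B) \<approx> C @ (A @ b # D) @ B" by simp
  also have "(A @ [b]) @ D @ [] @ B1 \<approx> D @ (A @ [b]) @ B1 @ []"
    using assms B \<open>sorted (A @ b # D)\<close>
    by (intro knuth_bump_block) (auto simp: sorted_append list_all2_lengthD)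
  from knuth_context[OF this, of C B2]
  have "C @ (A @ b # D) @ B \<approx> (C @ D) @ (A @ b # B)" using B by simp
  finally show ?thesis .
qed

text \<open>The placeholder in the empty box counts as an entry here; the last conclusion records that the
  entry which finally fills the first box below a moved entry is strictly larger.\<close>

lemma jdt_king:
  assumes "king i (R # Rs)" "c < length R"
  shows "king i (jdt (R # Rs) 0 c) \<and>
    row_word (jdt (R # Rs) 0 c) \<approx> row_word Rs @ take c R @ drop (Suc c) R \<and>
    length (first_row (jdt (R # Rs) 0 c)) \<le> length R \<and>
    (\<forall>m < length (first_row (jdt (R # Rs) 0 c)). R ! m \<le> first_row (jdt (R # Rs) 0 c) ! m) \<and>
    (c < length (first_row (jdt (R # Rs) 0 c)) \<longrightarrow> R ! c < first_row (jdt (R # Rs) 0 c) ! c \<or>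
      (Suc c < length R \<and> R ! Suc c \<le> first_row (jdt (R # Rs) 0 c) ! c))"
  using assms
proof (induction "length Rs + (length R - c)" arbitrary: i R Rs c rule: less_induct)
  case less
  define below where "below \<longleftrightarrow> Rs \<noteq> [] \<and> c < length (first_row Rs)"
  define right where "right \<longleftrightarrow> Suc c < length R"
  have R: "R \<noteq> []" "sorted R" "\<forall>a\<in>set R. Plain i \<le> a" "above R (first_row Rs)" "king (Suc i) Rs"
    using less.prems by auto
  consider (up) "below" "right \<longrightarrow> first_row Rs ! c \<le> R ! Suc c"
    | (rightwards) "\<not> (below \<and> (right \<longrightarrow> first_row Rs ! c \<le> R ! Suc c))" "right"
    | (stop) "\<not> below" "\<not> right" by blast
  then show ?case
  proof cases
    case up
    then obtain R2 Rs2 where Rs: "Rs = R2 # Rs2" by (cases Rs) (auto simp: below_def)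
    define b where "b = R2 ! c"
    have cR2: "c < length R2" using up Rs by (simp add: below_def)
    have R2: "sorted R2" "length R2 \<le> length R" using R Rs by (auto dest: above_length)
    define R' where "R' = R[c := b]"
    define T where "T = jdt (R2 # Rs2) 0 c"
    have eq: "jdt (R # Rs) 0 c = R' # T"
      using up Rs jdt_Cons[of R' "R2 # Rs2" 0 c] less.prems cR2
        jdt_up[of 0 "R # Rs" c] by (simp add: R'_def T_def b_def right_def)
    have IH: "king (Suc i) T" "row_word T \<approx> row_word Rs2 @ take c R2 @ drop (Suc c) R2"
      "length (first_row T) \<le> length R2" "\<And>m. m < length (first_row T) \<Longrightarrow> R2 ! m \<le> first_row T ! m"
      "c < length (first_row T) \<Longrightarrow> R2 ! c < first_row T ! c \<or>
        (Suc c < length R2 \<and> R2 ! Suc c \<le> first_row T ! c)"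
      using less.hyps[of Rs2 R2 c "Suc i"] R Rs cR2 R2 less.prems(2) unfolding T_def by fastforce+
    have Rb: "R ! c < b" using R(4) cR2 Rs by (simp add: above_def b_def)
    have bright: "b \<le> R ! Suc c" if "Suc c < length R" using up that Rs by (simp add: right_def b_def)
    define A where "A = take c R"
    define B where "B = drop (Suc c) R"
    define C where "C = take c R2"
    define D where "D = drop (Suc c) R2"
    have "R = A @ R ! c # B" and decR: "R' = A @ b # B" "length A = c"
      using less.prems(2)
      by (auto simp: A_def B_def R'_def upd_conv_take_nth_drop intro: id_take_nth_drop)
    then have sAB: "sorted (A @ R ! c # B)" using R(2) by metis
    have decR2: "R2 = C @ b # D" "length C = c"
      unfolding C_def D_def b_def using cR2 by (auto intro: id_take_nth_drop)
    then have sCD: "sorted (C @ b # D)" using R2(1) by metis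
    have "\<forall>x\<in>set B. b \<le> x"
    proof (cases "Suc c < length R")
      case True
      then have "B = R ! Suc c # drop (Suc (Suc c)) R" by (simp add: B_def Cons_nth_drop_Suc)
      moreover have "sorted B" using R(2) by (simp add: B_def)
      ultimately show ?thesis using bright[OF True] by auto
    qed (simp add: B_def)
    moreover have "\<forall>x\<in>set A. x \<le> b"
      using sAB Rb by (auto simp: sorted_append)
    moreover have "sorted A" "sorted B" using R(2) by (auto simp: A_def B_def)
    ultimately have sR'': "sorted (A @ b # B)"
      by (auto simp: sorted_append) (meson order.trans)
    then have sR': "sorted R'" using decR by simp
    have AC: "list_all2 (<) A C" unfolding list_all2_conv_all_nth
      using R(4) Rs cR2 less.prems(2) by (auto simp: A_def C_def above_def)
    have BD: "above B D"
      using R(4) Rs cR2 less.prems(2) by (auto simp: B_def D_def above_def)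
    have "row_word (R' # T) \<approx> row_word Rs2 @ (C @ D) @ R'"
      using knuth_append_right[OF IH(2), of R'] by (simp add: C_def D_def)
    also have "\<dots> \<approx> row_word Rs2 @ (C @ b # D) @ (A @ B)"
      unfolding decR(1) using sR'' sCD AC BD
      by (intro knuth_append_left knuth_sym[OF knuth_slide_up])
    also have "\<dots> = row_word Rs @ take c R @ drop (Suc c) R"
      unfolding Rs decR2(1) by (simp add: A_def B_def)
    finally have word: "row_word (R' # T) \<approx> row_word Rs @ take c R @ drop (Suc c) R" .
    have ab: "above R' (first_row T)"
    proof (rule aboveI)
      show "length (first_row T) \<le> length R'" using IH(3) R2 by (simp add: R'_def)
      fix m assume m: "m < length (first_row T)"
      show "R' ! m < first_row T ! m"
      proof (cases "m = c")
        case False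
        then have "R' ! m = R ! m" by (simp add: R'_def)
        also have "\<dots> < R2 ! m" using R(4) Rs m IH(3) by (simp add: above_def)
        finally show ?thesis using IH(4)[OF m] by simp
      next
        case True
        then have "R' ! m = b" using less.prems(2) by (simp add: R'_def)
        from IH(5) m True consider "R2 ! c < first_row T ! c"
          | "Suc c < length R2" "R2 ! Suc c \<le> first_row T ! c" by blast
        then show ?thesis
        proof cases
          case 1
          then show ?thesis using \<open>R' ! m = b\<close> True by (simp add: b_def)
        next
          \<comment> \<open>The entry now below \<open>b\<close> came from the right. The slide went
            up, so \<open>b\<close> is at most its right neighbour, which is smaller than the entry
            below that neighbour.\<close>
          case 2
          have "b \<le> R ! Suc c" using bright 2 R2 by simp
          also have "\<dots> < R2 ! Suc c" using R(4) Rs 2 by (simp add: above_def)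
          finally show ?thesis using \<open>R' ! m = b\<close> True 2 by simp
        qed
      qed
    qed
    have bi: "Plain i \<le> b"
    proof -
      have "b \<in> set R2" using cR2 by (simp add: b_def)
      then have "Plain (Suc i) \<le> b" using R(5) Rs by simp
      then show ?thesis using plain_mono[of i "Suc i" b] by simp
    qed
    have "\<forall>a\<in>set R'. Plain i \<le> a"
      using set_update_subset_insert[of R c b] R(3) bi unfolding R'_def by blast
    moreover have "R' \<noteq> []" using R(1) by (simp add: R'_def)
    ultimately have "king i (R' # T)"
      using sR' ab IH(1) by simp
    moreover have "R ! m \<le> R' ! m" if "m < length R" for m
      using that Rb by (cases "m = c") (auto simp: R'_def)
    moreover have "R ! c < R' ! c" using Rb less.prems(2) by (simp add: R'_def)
    ultimately show ?thesis using eq word Rb by (simp add: R'_def)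
  next
    case rightwards
    define r where "r = R ! Suc c"
    define R' where "R' = R[c := r]"
    define T where "T = jdt (R' # Rs) 0 (Suc c)"
    have cR: "Suc c < length R" using rightwards by (simp add: right_def)
    have eq: "jdt (R # Rs) 0 c = T"
      using rightwards jdt_right[of 0 "R # Rs" c]
      by (cases Rs) (auto simp: R'_def T_def r_def right_def below_def)
    have Rr: "R ! c \<le> r" using R(2) cR by (simp add: r_def sorted_iff_nth_mono)
    have sR': "sorted R'" unfolding sorted_iff_nth_mono_less
    proof (intro allI impI)
      fix m n assume mn: "m < n" "n < length R'"
      then have "R ! m \<le> R ! n" "m < c \<Longrightarrow> R ! m \<le> r" "c < n \<Longrightarrow> r \<le> R ! n"
        using R(2) cR by (auto simp: sorted_iff_nth_mono R'_def r_def)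
      then show "R' ! m \<le> R' ! n" using mn cR by (auto simp: R'_def nth_list_update)
    qed
    have ab: "above R' (first_row Rs)"
    proof (rule aboveI)
      show "length (first_row Rs) \<le> length R'" using R(4) by (simp add: R'_def above_def)
      fix m assume m: "m < length (first_row Rs)"
      show "R' ! m < first_row Rs ! m"
      proof (cases "m = c")
        case True
        then have "below" using m by (cases Rs) (auto simp: below_def)
        then show ?thesis using rightwards True cR by (simp add: R'_def r_def)
      qed (use R(4) m in \<open>simp add: R'_def above_def\<close>)
    qed
    have "r \<in> set R" using cR by (simp add: r_def)
    then have "\<forall>a\<in>set R'. Plain i \<le> a"
      using set_update_subset_insert[of R c r] R(3) unfolding R'_def by blast
    moreover have "R' \<noteq> []" using R(1) by (simp add: R'_def)
    ultimately have "king i (R' # Rs)"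
      using sR' ab R(5) by simp
    then have IH: "king i T" "row_word T \<approx> row_word Rs @ take (Suc c) R' @ drop (Suc (Suc c)) R'"
      "length (first_row T) \<le> length R'" "\<And>m. m < length (first_row T) \<Longrightarrow> R' ! m \<le> first_row T ! m"
      using less.hyps[of Rs R' "Suc c" i] cR unfolding T_def by (auto simp: R'_def)
    have "take (Suc c) R' @ drop (Suc (Suc c)) R' = take c R @ drop (Suc c) R"
      using cR by (simp add: R'_def r_def take_Suc_conv_app_nth Cons_nth_drop_Suc)
    moreover have "R ! m \<le> R' ! m" for m
      using Rr cR by (cases "m = c") (auto simp: R'_def)
    then have "R ! m \<le> first_row T ! m" if "m < length (first_row T)" for m
      using IH(4)[OF that] by (meson order.trans)
    moreover have "R ! Suc c \<le> first_row T ! c" if "c < length (first_row T)"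
      using IH(4)[OF that] cR by (simp add: R'_def r_def)
    ultimately show ?thesis unfolding eq using IH cR by (simp add: R'_def)
  next
    case stop
    have c: "length R = Suc c" using less.prems(2) stop by (simp add: right_def)
    have ne: "filter (\<lambda>R. R \<noteq> []) Rs = Rs"
      using king_nonempty[OF R(5)] by (auto simp: filter_id_conv)
    have eq: "jdt (R # Rs) 0 c = filter (\<lambda>R. R \<noteq> []) (butlast R # Rs)"
      using stop jdt_stop[of 0 "R # Rs" c] by (cases Rs) (auto simp: right_def below_def)
    have word: "take c R @ drop (Suc c) R = butlast R" using c by (simp add: butlast_conv_take)
    show ?thesis
    proof (cases "butlast R = []")
      case True
      then have "c = 0" using c by (cases R rule: rev_cases) auto
      then have "first_row Rs = []" using stop by (cases Rs) (auto simp: below_def)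
      then have "Rs = []" using R(5) by (cases Rs) auto
      then show ?thesis using eq True \<open>c = 0\<close> c by simp
    next
      case False
      have "above (butlast R) (first_row Rs)"
        using R(4) stop c by (cases Rs) (auto simp: above_def below_def nth_butlast)
      moreover have "sorted (butlast R)" using R(2) by (simp add: butlast_conv_take)
      ultimately show ?thesis
        using R False c eq ne word by (auto simp: nth_butlast dest: in_set_butlastD)
    qed
  qed
qed


section \<open>Bumping across neighbouring rows\<close>

lemma above_bump:
  assumes "above (P @ b # N) Q" "a < b"
  shows "above (P @ a # N) Q"
proof (rule aboveI)
  show "length Q \<le> length (P @ a # N)" using assms(1) by (simp add: above_def)
  fix m assume "m < length Q"
  then have "(P @ b # N) ! m < Q ! m" by (rule above_nth[OF assms(1)])
  then show "(P @ a # N) ! m < Q ! m"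
    using assms(2) by (auto simp: nth_append nth_Cons split: if_splits nat.splits)
qed

lemma above_append: "above P Q \<Longrightarrow> above (P @ [a]) Q"
  by (auto simp: above_def nth_append)

text \<open>The bumping route goes weakly to the left: below the old place of \<open>b\<close> every
  entry of \<open>Q\<close> exceeds \<open>b\<close>, so \<open>b\<close> lands in a column where
  the new upper row has a smaller entry.\<close>

lemma above_insert:
  assumes "sorted R" "sorted Q" "above R Q" "row_insert x R = (R', Some b)"
  shows "above R' (fst (row_insert b Q))"
proof -
  obtain P N where R: "R = P @ b # N" "\<forall>p\<in>set P. p \<le> x" "x < b" "R' = P @ x # N"
    using row_insert_cases[OF assms(1), of x] assms(4) by (metis option.sel prod.inject option.distinct(1))
  have R'Q: "above R' Q" using above_bump assms(3) R by metis
  obtain P2 N2 where Q: "Q = P2 @ N2" "\<forall>p\<in>set P2. p \<le> b" "\<forall>n\<in>set N2. b < n"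
    using sorted_split[OF assms(2)] .
  have le: "length P2 \<le> length P"
  proof (rule ccontr)
    assume "\<not> ?thesis"
    then have "R ! length P < Q ! length P" "Q ! length P \<in> set P2"
      using above_nth[OF assms(3), of "length P"] Q(1) by (auto simp: nth_append)
    then show False using R(1) Q(2) by force
  qed
  have "(P @ x # N) ! m < b" if "m \<le> length P" for m
    using that R by (cases "m = length P") (auto simp: nth_append intro: order.strict_trans1)
  then have mb: "R' ! length P2 < b" using le R by simp
  have ins: "fst (row_insert b Q) = P2 @ b # tl N2"
    using row_insert_end[OF Q(2)] row_insert_bump[OF Q(2)] Q(1,3) by (cases N2) auto
  show ?thesis unfolding ins
  proof (rule aboveI)
    show "length (P2 @ b # tl N2) \<le> length R'"
      using le R'Q Q(1) R(4) by (cases N2) (auto simp: above_def)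
    fix m assume m: "m < length (P2 @ b # tl N2)"
    show "R' ! m < (P2 @ b # tl N2) ! m"
    proof (cases "m = length P2")
      case True
      then show ?thesis using mb by simp
    next
      case False
      then have "m < length Q" "(P2 @ b # tl N2) ! m = Q ! m"
        using m Q(1) by (cases N2; auto simp: nth_append nth_Cons split: nat.splits)+
      then show ?thesis using R'Q by (simp add: above_def)
    qed
  qed
qed

lemma tab_map_tl: "tab V \<Longrightarrow> tab (map tl V)"
proof (induction V)
  case (Cons R V)
  then show ?case by (cases V) (auto simp: sorted_tl above_tl)
qed simp

lemma tab_append_Nil: "tab V \<Longrightarrow> tab (V @ [[]])"
proof (induction V)
  case (Cons R V)
  then show ?case by (cases V) auto
qed simp

lemma tab_Cons: "tab (R # Rs) \<longleftrightarrow> sorted R \<and> above R (first_row Rs) \<and> tab Rs"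
  by (cases Rs) auto

lemma knuth_first_column:
  "tab Rs \<Longrightarrow> [] \<notin> set Rs \<Longrightarrow> row_word Rs \<approx> rev (map hd Rs) @ row_word (map tl Rs)"
proof (induction Rs)
  case Nil
  then show ?case by simp
next
  case (Cons R Rs)
  then obtain h u where R: "R = h # u" by (cases R) auto
  have "row_word (R # Rs) \<approx> rev (map hd Rs) @ row_word (map tl Rs) @ h # u"
    using knuth_append_right[OF Cons.IH, of R] Cons.prems R by (simp add: tab_Cons)
  also have "\<dots> \<approx> rev (map hd Rs) @ h # row_word (u # map tl Rs)"
    using tab_map_tl[OF Cons.prems(1)] Cons.prems(1) R
    by (intro knuth_append_left knuth_sym[OF knuth_move_down]) (auto simp: tab_Cons)
  finally show ?case using R by simp
qed

text \<open>Such a letter bumps the head of the row, which is in turn smaller than the whole next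
  row. So the first column moves down by one box and nothing else changes.\<close>

lemma knuth_insert_small:
  "tab Rs \<Longrightarrow> [] \<notin> set Rs \<Longrightarrow> \<forall>a\<in>set (first_row Rs). b < a \<Longrightarrow>
    row_word Rs @ [b] \<approx> rev (b # map hd Rs) @ row_word (map tl Rs)"
proof (induction Rs arbitrary: b)
  case Nil
  then show ?case by simp
next
  case (Cons R Rs)
  then obtain h u where R: "R = h # u" by (cases R) auto
  have small: "\<forall>a\<in>set (first_row Rs). h < a"
  proof (cases "first_row Rs")
    case (Cons r r')
    then have "h < r" "sorted (first_row Rs)"
      using Cons.prems(1) R by (cases Rs; simp add: tab_Cons)+
    then show ?thesis using Cons by auto
  qed simp
  have "row_word (R # Rs) @ [b] \<approx> row_word Rs @ h # b # u"
    using knuth_bump[of "[]" h u b] Cons.prems R by (auto simp: tab_Cons intro: knuth_append_left)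
  also have "\<dots> \<approx> (rev (h # map hd Rs) @ row_word (map tl Rs)) @ b # u"
    using knuth_append_right[OF Cons.IH[OF _ _ small], of "b # u"] Cons.prems by (simp add: tab_Cons)
  also have "\<dots> \<approx> rev (h # map hd Rs) @ b # row_word (u # map tl Rs)"
  proof -
    have "b # row_word (u # map tl Rs) \<approx> row_word (map tl Rs) @ b # u"
      using tab_map_tl[OF Cons.prems(1)] Cons.prems(3) R
      by (intro knuth_move_down) auto
    from knuth_append_left[OF knuth_sym[OF this], of "rev (h # map hd Rs)"] show ?thesis by simp
  qed
  finally show ?case using R by simp
qed

definition count_upto :: "letter list \<Rightarrow> nat \<Rightarrow> nat" where
  "count_upto c l = length (filter (\<lambda>b. b \<le> Barred l) c)"

text \<open>\<open>rev c @ row_word V\<close> is the column \<open>c\<close> glued to the left of \<open>V\<close>: the result of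
  the Schensted insertion, in which \<open>c\<close> has its first violation at \<open>j\<close>. Its first row is recorded
  since the induction over the rows has to put a further row on top.\<close>

definition cancellation :: "nat \<Rightarrow> tableau \<Rightarrow> letter \<Rightarrow> tableau \<Rightarrow> bool" where
  "cancellation i Rs a T \<longleftrightarrow> (\<exists>c V j. i \<le> j \<and> V \<noteq> [] \<and> c \<noteq> [] \<and> tab V \<and> Rs \<noteq> [] \<and>
     hd c # hd V = fst (row_insert a (hd Rs)) \<and> sorted_wrt (<) c \<and> (\<forall>b\<in>set c. Plain i \<le> b) \<and>
     Plain j \<in> set c \<and>
     (\<forall>l\<ge>i. count_upto c l \<le> l - i + 2) \<and> (\<forall>l. i \<le> l \<and> l < j \<longrightarrow> count_upto c l \<le> l - i + 1) \<and> count_upto c j = j - i + 2 \<and>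
     row_word Rs @ [a] \<approx> rev c @ row_word V \<and>
     row_word T \<approx> rev (filter (\<lambda>b. b \<noteq> Plain j \<and> b \<noteq> Barred j) c) @ row_word V)"

text \<open>By the King condition, entries up to \<open>Barred l\<close> occur only in the rows
  \<open>i\<close> to \<open>l\<close>. The case \<open>l = i - 1\<close> says that there are
  none.\<close>

lemma first_column_bound:
  assumes "king i Rs"
  shows "(\<forall>l. Suc l \<ge> i \<longrightarrow> count_upto (map hd Rs) l \<le> Suc l - i) \<and> sorted_wrt (<) (map hd Rs) \<and>
    (\<forall>b\<in>set (map hd Rs). Plain i \<le> b)"
  using assms
proof (induction Rs arbitrary: i)
  case Nil
  then show ?case by (simp add: count_upto_def)
next
  case (Cons R Rs)
  have R: "R \<noteq> []" "sorted R" "\<forall>a\<in>set R. Plain i \<le> a" "above R (first_row Rs)" "king (Suc i) Rs"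
    using Cons.prems by auto
  note IH = Cons.IH[OF R(5)]
  have hR: "Plain i \<le> hd R" using R by simp
  have hd_less: "hd R < hd R2" if "Rs = R2 # Rs2" for R2 Rs2
    using R that by (cases R; cases R2) auto
  then have "\<forall>b\<in>set (map hd Rs). hd R < b"
    using IH by (cases Rs) (auto intro: order.strict_trans)
  moreover have "count_upto (map hd (R # Rs)) l \<le> Suc l - i" if "Suc l \<ge> i" for l
  proof (cases "Suc l = i")
    case True
    have "\<not> b \<le> Barred l" if "b \<in> set (map hd (R # Rs))" for b
    proof -
      have "Plain i \<le> b" using that hR IH plain_mono[of i "Suc i"] by auto
      then show ?thesis using True by (simp add: letter_le_iff)
    qed
    then have "filter (\<lambda>b. b \<le> Barred l) (map hd (R # Rs)) = []" by (simp only: filter_empty_conv) blast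
    then show ?thesis by (simp only: count_upto_def) simp
  next
    case False
    then have "count_upto (map hd Rs) l \<le> Suc l - Suc i" using IH that by simp
    moreover have "Suc l - i = Suc (l - i)" using False that by simp
    ultimately show ?thesis by (simp add: count_upto_def)
  qed
  moreover have "\<forall>b\<in>set (map hd (R # Rs)). Plain i \<le> b"
    using IH hR plain_mono[of i "Suc i"] by auto
  ultimately show ?case using IH by simp
qed

lemma row_insert_bump_letter:
  assumes "sorted R" "row_insert x R = (R', Some b)"
  shows "b \<in> set R" "x < b" "length R' = length R" "R' \<noteq> []" "set R' \<subseteq> insert x (set R)"
  using row_insert_cases[OF assms(1), of x] assms(2)
  by (metis (no_types, lifting) Pair_inject in_set_conv_decomp option.distinct(1) option.inject)
    (rule row_insert_cases[OF assms(1), of x]; use assms(2) in force)+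

lemma append_Cons_const: "\<forall>p\<in>set P. p = x \<Longrightarrow> P @ x # N = x # P @ N"
  by (induction P) auto

text \<open>The recursion sees only the lower rows, so the relation to the row above is carried
  along as the middle conclusion, for every row that could have bumped \<open>a\<close>. The last
  conclusion compares with Schensted insertion.\<close>

lemma berele_from_spec:
  assumes "king i Rs" "Plain i \<le> a"
  shows "king i (berele_from i Rs a) \<and>
    (\<forall>R x R'. sorted R \<longrightarrow> above R (first_row Rs) \<longrightarrow> row_insert x R = (R', Some a) \<longrightarrow>
      above R' (first_row (berele_from i Rs a))) \<and>
    (row_word Rs @ [a] \<approx> row_word (berele_from i Rs a) \<or> cancellation i Rs a (berele_from i Rs a))"
  using assms
proof (induction i Rs a rule: berele_from.induct)
  case (1 i a)
  then show ?case using above_insert[where Q = "[]"] by auto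
next
  case (2 i R Rs a)
  have R: "R \<noteq> []" "sorted R" "\<forall>a\<in>set R. Plain i \<le> a" "above R (first_row Rs)" "king (Suc i) Rs"
    using "2.prems" by auto
  have sRs: "sorted (first_row Rs)" using R(5) by (cases Rs) auto
  show ?case
  proof (cases "a = Plain i \<and> Barred i \<in> set R")
    case True
    then obtain P N where PN: "R = P @ Barred i # N" "Barred i \<notin> set P"
      using split_list_first by metis
    \<comment> \<open>A King row has no letter below \<open>Plain i\<close>. Hence only copies of
      \<open>Plain i\<close> precede the first \<open>Barred i\<close>, and the empty box starts in
      the first column.\<close>
    have P: "\<forall>p\<in>set P. p = Plain i"
    proof
      fix p assume p: "p \<in> set P"
      then have "p \<le> Barred i" "p \<noteq> Barred i" "Plain i \<le> p"
        using R PN by (auto simp: sorted_append)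
      then have "letter_rank p = letter_rank (Plain i)"
        by (auto simp: letter_le_iff simp flip: letter_rank_inject)
      then show "p = Plain i" by (simp only: letter_rank_inject)
    qed
    define R' where "R' = Plain i # P @ N"
    have R'eq: "R' = P @ Plain i # N" using append_Cons_const[OF P] by (simp add: R'_def)
    \<comment> \<open>Replacing the first \<open>Barred i\<close> is still the ordinary bump; the
      exception consists in what happens afterwards.\<close>
    have bump: "row_insert a R = (R', Some (Barred i))"
      unfolding PN(1) R'eq using row_insert_bump[of P a "Barred i" N] P True
      by (simp add: letter_less_iff)
    have fp: "first_pos (Barred i) R = length P"
      using PN by (simp add: first_pos_def takeWhile_append)
    have "R[first_pos (Barred i) R := Plain i] = R'" unfolding fp R'eq by (simp add: PN(1))
    moreover have "first_pos (Plain i) R' = 0" by (simp add: first_pos_def R'_def)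
    ultimately have T: "berele_from i (R # Rs) a = jdt (R' # Rs) 0 0" using True by (simp add: Let_def)
    have above': "above R' (first_row Rs)"
      unfolding R'eq using above_bump[of P "Barred i" N] R(4) PN(1) by (simp add: letter_less_iff)
    have "sorted R'" using sorted_row_insert[OF R(2), of a] bump by simp
    then have "king i (R' # Rs)" using R above' PN P by (auto simp: R'_def)
    note J = jdt_king[OF this, of 0, folded T]
    have kT: "king i (berele_from i (R # Rs) a)"
      and wT: "row_word (berele_from i (R # Rs) a) \<approx> row_word Rs @ P @ N"
      and lT: "length (first_row (berele_from i (R # Rs) a)) \<le> length R'"
      and nT: "\<And>m. m < length (first_row (berele_from i (R # Rs) a)) \<Longrightarrow>
        R' ! m \<le> first_row (berele_from i (R # Rs) a) ! m"
      using J by (auto simp: R'_def)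
    have ab: "above S' (first_row (berele_from i (R # Rs) a))"
      if "sorted S" "above S R" "row_insert x S = (S', Some a)" for S x S'
    proof (rule aboveI)
      have "above S' R'" using above_insert[OF that(1) R(2) that(2,3)] bump by simp
      then show "length (first_row (berele_from i (R # Rs) a)) \<le> length S'"
        using lT by (simp add: above_def)
      fix m assume m: "m < length (first_row (berele_from i (R # Rs) a))"
      then show "S' ! m < first_row (berele_from i (R # Rs) a) ! m"
        using nT[OF m] \<open>above S' R'\<close> lT by (auto simp: above_def intro: order.strict_trans2)
    qed
    \<comment> \<open>Ordinary insertion would send \<open>Barred i\<close> into row
      \<open>Suc i\<close>, where it is smaller than everything and pushes the first column
      \<open>d\<close> down. The resulting column \<open>c\<close> violates the King condition
      there, and deleting its pair restores \<open>d\<close>.\<close>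
    define d where "d = map hd Rs"
    define c where "c = Plain i # Barred i # d"
    define V where "V = (P @ N) # map tl Rs"
    have d: "\<And>l. l \<ge> i \<Longrightarrow> count_upto d l \<le> l - i" "sorted_wrt (<) d" "\<forall>b\<in>set d. Plain (Suc i) \<le> b"
      using first_column_bound[OF R(5)] by (auto simp: d_def)
    have d_large: "\<forall>b\<in>set d. Barred i < b"
      using d(3) by (auto simp: plain_le_iff letter_less_iff)
    have first_small: "\<forall>a\<in>set (first_row Rs). Barred i < a"
      using R(5) by (cases Rs) (auto simp: plain_le_iff letter_less_iff)
    have "tab V"
    proof -
      have "above (P @ N) (tl (fst (row_insert (Barred i) (first_row Rs))))"
        using above_tl[OF above_insert[OF R(2) sRs R(4) bump]] by (simp add: R'_def)
      moreover have "tl (fst (row_insert (Barred i) (first_row Rs))) = tl (first_row Rs)"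
        using first_small by (cases "first_row Rs") auto
      moreover have "tl (first_row Rs) = first_row (map tl Rs)" by (cases Rs) auto
      moreover have "sorted (P @ N)" using \<open>sorted R'\<close> by (simp add: R'_def)
      ultimately show ?thesis
        unfolding V_def tab_Cons using tab_map_tl[OF king_tab[OF R(5)]] by simp
    qed
    have "row_word (R # Rs) @ [a] \<approx> row_word Rs @ Barred i # R'"
      using knuth_append_left[OF knuth_bump[of P "Barred i" N a], of "row_word Rs"] R(2) P True
      by (simp add: PN(1) R'eq letter_less_iff)
    also have "\<dots> \<approx> (rev (Barred i # d) @ row_word (map tl Rs)) @ R'"
      using knuth_append_right[OF knuth_insert_small[OF king_tab[OF R(5)] king_nonempty[OF R(5)] first_small], of R']
      by (simp add: d_def)
    also have "\<dots> \<approx> rev (Barred i # d) @ Plain i # row_word V"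
    proof -
      have "Plain i # row_word V \<approx> row_word (map tl Rs) @ Plain i # P @ N"
        unfolding V_def using \<open>tab V\<close> R(3) P PN(1) by (intro knuth_move_down) (auto simp: V_def)
      from knuth_append_left[OF knuth_sym[OF this], of "rev (Barred i # d)"] show ?thesis
        by (simp add: R'_def)
    qed
    finally have w1: "row_word (R # Rs) @ [a] \<approx> rev c @ row_word V" by (simp add: c_def)
    have "filter (\<lambda>b. b \<noteq> Plain i \<and> b \<noteq> Barred i) d = d"
      using d_large by (auto simp: filter_id_conv letter_less_iff)
    then have fc: "filter (\<lambda>b. b \<noteq> Plain i \<and> b \<noteq> Barred i) c = d" by (simp add: c_def)
    have "row_word (berele_from i (R # Rs) a) \<approx> row_word Rs @ P @ N" by (rule wT)
    also have "\<dots> \<approx> rev d @ row_word V"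
      using knuth_append_right[OF knuth_first_column[OF king_tab[OF R(5)] king_nonempty[OF R(5)]], of "P @ N"]
      by (simp add: d_def V_def)
    finally have w2: "row_word (berele_from i (R # Rs) a)
        \<approx> rev (filter (\<lambda>b. b \<noteq> Plain i \<and> b \<noteq> Barred i) c) @ row_word V"
      unfolding fc .
    have low_c: "count_upto c l = 2 + count_upto d l" if "i \<le> l" for l
      using that by (simp add: count_upto_def c_def letter_le_iff)
    have "cancellation i (R # Rs) a (berele_from i (R # Rs) a)"
      unfolding cancellation_def
    proof (intro exI[of _ c] exI[of _ V] exI[of _ i] conjI)
      show "hd c # hd V = fst (row_insert a (hd (R # Rs)))" using bump by (simp add: c_def V_def R'_def)
      show "sorted_wrt (<) c"
        using d(2) d_large by (auto simp: c_def letter_less_iff)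
      show "\<forall>b\<in>set c. Plain i \<le> b" using d_large by (auto simp: c_def letter_le_iff letter_less_iff)
      show "\<forall>l\<ge>i. count_upto c l \<le> l - i + 2" using low_c d(1) by simp
      show "count_upto c i = i - i + 2" using low_c[of i] d(1)[of i] by simp
    qed (use w1 w2 \<open>tab V\<close> in \<open>auto simp: V_def c_def\<close>)
    then show ?thesis using kT ab by auto
  next
    case False
    show ?thesis
    proof (cases "row_insert a R")
      case RI: (Pair R' out)
      have sR': "sorted R'" using sorted_row_insert[OF R(2), of a] RI by simp
      show ?thesis
      proof (cases out)
        case None
        have R': "R' = R @ [a]"
          using row_insert_cases[OF R(2), of a] RI None by (metis option.distinct(1) prod.inject)
        have T: "berele_from i (R # Rs) a = R' # Rs" using False RI None by auto
        have "king i (R' # Rs)"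
          using R sR' above_append[OF R(4)] "2.prems"(2) by (auto simp: R')
        moreover have "above S' R'"
          if "sorted S" "above S R" "row_insert x S = (S', Some a)" for S x S'
          using above_insert[OF that(1) R(2) that(2,3)] RI by simp
        ultimately show ?thesis unfolding T by (auto simp: R')
      next
        case (Some b)
        define T where "T = berele_from (Suc i) Rs b"
        have T: "berele_from i (R # Rs) a = R' # T" using False RI Some by (auto simp: T_def)
        note RI' = RI[unfolded Some]
        have bump: "b \<in> set R" "a < b" "length R' = length R" "R' \<noteq> []" "set R' \<subseteq> insert a (set R)"
          using row_insert_bump_letter[OF R(2) RI'] by auto
        have b: "Plain (Suc i) \<le> b"
        proof -
          have "b \<noteq> Barred i" if "a = Plain i" using that False bump(1) by auto
          moreover have "b = Barred i \<Longrightarrow> a = Plain i"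
            using bump(2) "2.prems"(2)
            by (auto simp: letter_less_iff letter_le_iff simp flip: letter_rank_inject)
          ultimately have "letter_rank b \<noteq> letter_rank (Barred i)" unfolding letter_rank_inject by blast
          then show ?thesis using bump(2) "2.prems"(2) by (simp add: letter_less_iff letter_le_iff)
        qed
        have IH: "king (Suc i) T"
          "\<And>S x S'. sorted S \<Longrightarrow> above S (first_row Rs) \<Longrightarrow> row_insert x S = (S', Some b) \<Longrightarrow> above S' (first_row T)"
          "row_word Rs @ [b] \<approx> row_word T \<or> cancellation (Suc i) Rs b T"
          using "2.IH"[OF False RI[symmetric] Some] R(5) b RI by (auto simp: T_def)
        have ab: "above R' (first_row T)" using IH(2)[OF R(2,4) RI'] .
        have entries: "\<forall>x\<in>set R'. Plain i \<le> x" using bump(5) R(3) "2.prems"(2) by auto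
        have kT: "king i (R' # T)" using IH(1) ab sR' bump(4) entries by simp
        have ab': "above S' R'"
          if "sorted S" "above S R" "row_insert x S = (S', Some a)" for S x S'
          using above_insert[OF that(1) R(2) that(2,3)] RI by simp
        have "R @ [a] \<approx> b # R'"
        proof (rule row_insert_cases[OF R(2), of a])
          fix P b' N
          assume "R = P @ b' # N" "\<forall>p\<in>set P. p \<le> a" "a < b'" "row_insert a R = (P @ a # N, Some b')"
          then show ?thesis using knuth_bump[of P b' N a] R(2) RI' by simp
        next
          assume "row_insert a R = (R @ [a], None)"
          then show ?thesis using RI' by simp
        qed
        then have word: "row_word (R # Rs) @ [a] \<approx> (row_word Rs @ [b]) @ R'"
          using knuth_append_left[of "R @ [a]" "b # R'" "row_word Rs"] by simp
        have "row_word (R # Rs) @ [a] \<approx> row_word (R' # T) \<or> cancellation i (R # Rs) a (R' # T)"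
          using IH(3)
        proof
          assume "row_word Rs @ [b] \<approx> row_word T"
          from knuth_trans[OF word knuth_append_right[OF this, of R']] show ?thesis by simp
        next
          assume "cancellation (Suc i) Rs b T"
          then obtain c V j where c: "Suc i \<le> j" "V \<noteq> []" "c \<noteq> []" "tab V" "Rs \<noteq> []"
            "hd c # hd V = fst (row_insert b (hd Rs))" "sorted_wrt (<) c" "\<forall>b\<in>set c. Plain (Suc i) \<le> b"
            "Plain j \<in> set c" "\<forall>l\<ge>Suc i. count_upto c l \<le> l - Suc i + 2"
            "\<forall>l. Suc i \<le> l \<and> l < j \<longrightarrow> count_upto c l \<le> l - Suc i + 1" "count_upto c j = j - Suc i + 2"
            "row_word Rs @ [b] \<approx> rev c @ row_word V"
            "row_word T \<approx> rev (filter (\<lambda>b. b \<noteq> Plain j \<and> b \<noteq> Barred j) c) @ row_word V"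
            unfolding cancellation_def by blast
          \<comment> \<open>The new row is put on top of the glued picture: its head extends the
            column \<open>c\<close>, its tail the tableau \<open>V\<close>. Counts of small letters
            and their bounds both grow by one, since the rows now start at \<open>i\<close>.\<close>
          obtain a' R'' where R': "R' = a' # R''" using bump(4) by (cases R') auto
          have hd_Rs: "hd Rs = first_row Rs" using c(5) by (cases Rs) auto
          have "above R' (hd c # hd V)"
            using above_insert[OF R(2) sRs R(4) RI'] c(6) hd_Rs by simp
          then have aV: "a' < hd c" "above R'' (hd V)" using R' by auto
          have hd_le: "\<forall>x\<in>set c. hd c \<le> x" using c(3,7) by (cases c) auto
          then have a'c: "\<forall>x\<in>set c. a' < x" using aV(1) by (auto intro: order.strict_trans2)
          have "hd V = first_row V" using c(2) by (cases V) auto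
          then have tV: "tab (R'' # V)" unfolding tab_Cons using c(4) aV(2) sR' R' by simp
          have move: "a' # row_word (R'' # V) \<approx> row_word V @ R'"
            unfolding R' using sR' R' by (intro knuth_move_down[OF tV]) auto
          define f where "f = filter (\<lambda>b. b \<noteq> Plain j \<and> b \<noteq> Barred j)"
          have "a' < Plain j" using a'c c(9) by blast
          then have f: "f (a' # c) = a' # f c" by (auto simp: f_def letter_less_iff)
          have "row_word (R # Rs) @ [a] \<approx> (row_word Rs @ [b]) @ R'" by (rule word)
          also have "\<dots> \<approx> rev c @ row_word V @ R'" using knuth_append_right[OF c(13), of R'] by simp
          also have "\<dots> \<approx> rev c @ a' # row_word (R'' # V)"
            using knuth_append_left[OF knuth_sym[OF move]] .
          finally have w1: "row_word (R # Rs) @ [a] \<approx> rev (a' # c) @ row_word (R'' # V)" by simp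
          have "row_word (R' # T) \<approx> rev (f c) @ row_word V @ R'"
            using knuth_append_right[OF c(14), of R'] by (simp add: f_def)
          also have "\<dots> \<approx> rev (f c) @ a' # row_word (R'' # V)"
            using knuth_append_left[OF knuth_sym[OF move]] .
          finally have w2: "row_word (R' # T) \<approx> rev (f (a' # c)) @ row_word (R'' # V)" by (simp add: f)
          have low_le: "count_upto (a' # c) l \<le> Suc (count_upto c l)" for l by (simp add: count_upto_def)
          have low_i: "count_upto (a' # c) i \<le> 1"
          proof -
            have "filter (\<lambda>b. b \<le> Barred i) c = []"
              using c(8) by (auto simp: filter_empty_conv letter_le_iff plain_le_iff)
            then show ?thesis by (simp add: count_upto_def)
          qed
          have "a' \<le> Barred j" using \<open>a' < Plain j\<close> by (simp add: letter_less_iff letter_le_iff)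
          then have low_j: "count_upto (a' # c) j = Suc (count_upto c j)" by (simp add: count_upto_def)
          have "cancellation i (R # Rs) a (R' # T)"
            unfolding cancellation_def
          proof (intro exI[of _ "a' # c"] exI[of _ "R'' # V"] exI[of _ j] conjI)
            show "hd (a' # c) # hd (R'' # V) = fst (row_insert a (hd (R # Rs)))" using RI R' by simp
            show "sorted_wrt (<) (a' # c)" using c(7) a'c by simp
            show "\<forall>b\<in>set (a' # c). Plain i \<le> b"
              using c(8) entries R' plain_mono[of i "Suc i"] by auto
            show "\<forall>l\<ge>i. count_upto (a' # c) l \<le> l - i + 2"
            proof (intro allI impI)
              fix l assume "i \<le> l"
              then show "count_upto (a' # c) l \<le> l - i + 2"
                using low_i low_le[of l] c(10)[rule_format, of l] by (cases "l = i") auto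
            qed
            show "\<forall>l. i \<le> l \<and> l < j \<longrightarrow> count_upto (a' # c) l \<le> l - i + 1"
            proof (intro allI impI)
              fix l assume "i \<le> l \<and> l < j"
              then show "count_upto (a' # c) l \<le> l - i + 1"
                using low_i low_le[of l] c(11)[rule_format, of l] by (cases "l = i") auto
            qed
            show "count_upto (a' # c) j = j - i + 2" using low_j c(1,12) by simp
          qed (use w1 w2 tV c in \<open>auto simp: f_def\<close>)
          then show ?thesis ..
        qed
        then show ?thesis unfolding T using kT ab' by auto
      qed
    qed
  qed
qed

section \<open>The reduction relation\<close>

text \<open>\<open>A\<close> may be any column that splits off at the front of some word in the
  Knuth class; comparing different choices is the task of
  \<open>reduction_canonical\<close>.\<close>

definition reduces :: "letter list \<Rightarrow> letter list \<Rightarrow> bool" where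
  "reduces w w' \<longleftrightarrow> (\<exists>A v t. finite A \<and> A \<subseteq> {2..} \<and> cancelling A t \<and>
     w \<approx> column_word A @ v \<and> w' \<approx> column_word (A - letter_pair t) @ v)"

text \<open>The alphabet without its upper bound: Knuth steps and deletions introduce no letters, so
  \<open>k\<close> matters only in the return to \<open>words k\<close>.\<close>

definition admissible :: "letter list \<Rightarrow> bool" where
  "admissible w \<longleftrightarrow> (\<forall>a\<in>set w. Plain 1 \<le> a)"

lemma admissible_append [simp]: "admissible (u @ v) \<longleftrightarrow> admissible u \<and> admissible v"
  by (auto simp: admissible_def)

lemma admissible_knuth: "w \<approx> w' \<Longrightarrow> admissible w \<longleftrightarrow> admissible w'"
  by (auto simp: admissible_def dest: knuth_set)

lemma admissible_column: "finite A \<Longrightarrow> admissible (column_word A) \<longleftrightarrow> A \<subseteq> {2..}"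
  by (auto simp: admissible_def set_column_word letter_le_iff)

lemma reduces_append: "reduces w w' \<Longrightarrow> reduces (w @ u) (w' @ u)"
  unfolding reduces_def using knuth_append_right by (metis append.assoc)

lemma reduces_knuth_left: "w' \<approx> w \<Longrightarrow> reduces w w1 \<Longrightarrow> reduces w' w1"
  unfolding reduces_def using knuth_trans by meson

lemma reduces_set: "reduces w w' \<Longrightarrow> set w' \<subseteq> set w"
proof -
  assume "reduces w w'"
  then obtain A v t where r: "finite A" "w \<approx> column_word A @ v" "w' \<approx> column_word (A - letter_pair t) @ v"
    unfolding reduces_def by blast
  show ?thesis using knuth_set[OF r(2)] knuth_set[OF r(3)] r(1) by (auto simp: set_column_word)
qed

lemma reduces_length: "reduces w w' \<Longrightarrow> length w' < length w"
proof -
  assume "reduces w w'"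
  then obtain A v t where r: "finite A" "A \<subseteq> {2..}" "cancelling A t" "w \<approx> column_word A @ v"
      "w' \<approx> column_word (A - letter_pair t) @ v"
    unfolding reduces_def by blast
  have "2 * t \<in> A" using cancelling_mem[OF r(2,3)] by simp
  then have "A - letter_pair t \<subset> A" by (auto simp: letter_pair_def)
  then have "card (A - letter_pair t) < card A" using r(1) by (rule psubset_card_mono[rotated])
  then show ?thesis using knuth_length[OF r(4)] knuth_length[OF r(5)] by simp
qed

section \<open>Berele insertion as a sequence of Knuth steps and deletions\<close>

lemma column_word_of_list:
  assumes "sorted_wrt (<) c"
  shows "column_word (letter_rank ` set c) = rev c"
proof -
  have "sorted (map letter_rank c)" "distinct (map letter_rank c)"
    using assms
    by (induction c) (auto simp: letter_less_iff letter_le_iff)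
  then have "sorted_list_of_set (set (map letter_rank c)) = map letter_rank c"
    using sorted_list_of_set.idem_if_sorted_distinct by blast
  then show ?thesis by (simp add: column_word_def rev_map map_idI)
qed

lemma cnt_eq_count_upto:
  assumes "sorted_wrt (<) c"
  shows "cnt (letter_rank ` set c) (2 * l + 1) = int (count_upto c l)"
proof -
  have "letter_rank ` set c \<inter> {..2 * l + 1} = letter_rank ` set (filter (\<lambda>b. b \<le> Barred l) c)"
    by (auto simp: letter_le_iff)
  moreover have "inj_on letter_rank S" for S
    by (auto simp: inj_on_def letter_rank_inject)
  moreover have "distinct c" using assms by (induction c) auto
  ultimately show ?thesis
    by (simp add: cnt_def count_upto_def card_image distinct_card[symmetric])
qed

text \<open>For \<open>i = 1\<close> the bounds on \<open>count_upto\<close> say that the excess is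
  at most 1 and reaches 1 first at \<open>j\<close>.\<close>

lemma cancellation_reduces:
  assumes "cancellation 1 Rs a T"
  shows "reduces (row_word Rs @ [a]) (row_word T)"
proof -
  obtain c V j where c: "1 \<le> j" "sorted_wrt (<) c" "\<forall>b\<in>set c. Plain 1 \<le> b"
    "\<forall>l\<ge>1. count_upto c l \<le> l - 1 + 2" "\<forall>l. 1 \<le> l \<and> l < j \<longrightarrow> count_upto c l \<le> l - 1 + 1" "count_upto c j = j - 1 + 2"
    "row_word Rs @ [a] \<approx> rev c @ row_word V"
    "row_word T \<approx> rev (filter (\<lambda>b. b \<noteq> Plain j \<and> b \<noteq> Barred j) c) @ row_word V"
    using assms unfolding cancellation_def by blast
  define A where "A = letter_rank ` set c"
  have A: "finite A" "A \<subseteq> {2..}" using c(3) by (auto simp: A_def letter_le_iff)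
  have ex: "excess A l = int (count_upto c l) - int l" for l
    using cnt_eq_count_upto[OF c(2), of l] by (simp add: excess_def A_def)
  have "count_upto c 0 = 0" using c(3) by (auto simp: count_upto_def filter_empty_conv letter_le_iff)
  have "cancelling A j"
  proof (rule cancellingI[of _ _ 1])
    show "excess A j = 1" using c(1,6) by (simp add: ex)
    show "excess A l \<le> 1" for l
      using c(4)[rule_format, of l] \<open>count_upto c 0 = 0\<close> by (cases "l = 0") (auto simp: ex)
    show "l < j \<Longrightarrow> excess A l < 1" for l
      using c(5)[rule_format, of l] \<open>count_upto c 0 = 0\<close> by (cases "l = 0") (auto simp: ex)
  qed simp
  moreover have "column_word A = rev c" unfolding A_def using c(2) by (rule column_word_of_list)
  moreover have "column_word (A - letter_pair j) = rev (filter (\<lambda>b. b \<noteq> Plain j \<and> b \<noteq> Barred j) c)"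
  proof -
    have "letter_rank b \<in> letter_pair j \<longleftrightarrow> b = Plain j \<or> b = Barred j" for b
      by (auto simp: letter_pair_def simp flip: letter_rank_inject)
    then have "A - letter_pair j = letter_rank ` set (filter (\<lambda>b. b \<noteq> Plain j \<and> b \<noteq> Barred j) c)"
      by (auto simp: A_def)
    then show ?thesis using column_word_of_list[OF sorted_wrt_filter[OF c(2)]] by metis
  qed
  ultimately show ?thesis unfolding reduces_def using A c(7,8) by metis
qed

abbreviation reach :: "letter list \<Rightarrow> letter list \<Rightarrow> bool" where
  "reach \<equiv> (\<lambda>w w'. w \<approx> w' \<or> reduces w w')\<^sup>*\<^sup>*"

lemma reach_append: "reach w w' \<Longrightarrow> reach (w @ u) (w' @ u)"
proof (induction rule: rtranclp_induct)
  case (step w1 w2)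
  then have "w1 @ u \<approx> w2 @ u \<or> reduces (w1 @ u) (w2 @ u)"
    using knuth_append_right reduces_append by blast
  with step.IH show ?case by (rule rtranclp.rtrancl_into_rtrancl)
qed simp

lemma king_entries: "king i T \<Longrightarrow> b \<in> set (row_word T) \<Longrightarrow> Plain i \<le> b"
proof (induction T arbitrary: i)
  case (Cons R Rs)
  then show ?case using plain_mono[of i "Suc i" b] by auto
qed simp

lemma reach_P_C:
  assumes "admissible w"
  shows "king 1 (P_C w) \<and> reach w (row_word (P_C w))"
  using assms
proof (induction w rule: rev_induct)
  case Nil
  then show ?case by (simp add: P_C_def)
next
  case (snoc x w)
  then have IH: "king 1 (P_C w)" "reach w (row_word (P_C w))" and x: "Plain 1 \<le> x"
    by (auto simp: admissible_def)
  have P: "P_C (w @ [x]) = berele_from 1 (P_C w) x" by (simp add: P_C_def berele_insert_def)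
  have "row_word (P_C w) @ [x] \<approx> row_word (P_C (w @ [x]))
      \<or> reduces (row_word (P_C w) @ [x]) (row_word (P_C (w @ [x])))"
    using berele_from_spec[OF IH(1) x] cancellation_reduces unfolding P by blast
  with reach_append[OF IH(2), of "[x]"] have "reach (w @ [x]) (row_word (P_C (w @ [x])))"
    by (rule rtranclp.rtrancl_into_rtrancl)
  then show ?case using berele_from_spec[OF IH(1) x] P by simp
qed

text \<open>Knuth steps in front of the first deletion are absorbed, since \<open>reduces\<close> is
  closed under Knuth equivalence on its left.\<close>

lemma reach_cases:
  assumes "reach w w'"
  shows "w \<approx> w' \<or> (\<exists>w1. reduces w w1 \<and> reach w1 w')"
  using assms
proof (induction rule: converse_rtranclp_induct)
  case base
  then show ?case by simp
next
  case (step w u)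
  from step.hyps(1) show ?case
  proof
    assume "w \<approx> u"
    with step.IH show ?case using knuth_trans reduces_knuth_left by blast
  next
    assume "reduces w u"
    with step.hyps(2) show ?case by blast
  qed
qed

section \<open>Tuples of columns\<close>

definition columns_word :: "nat set list \<Rightarrow> letter list" where
  "columns_word Cs = concat (map column_word Cs)"

lemma columns_word_simps [simp]:
  "columns_word [] = []" "columns_word (C # Cs) = column_word C @ columns_word Cs"
  by (simp_all add: columns_word_def)

inductive raise_step :: "nat set list \<Rightarrow> nat set list \<Rightarrow> bool" where
  here: "raising A B y \<Longrightarrow> raise_step (A # B # Cs) (insert y A # (B - {y}) # Cs)"
| there: "raise_step Cs Cs' \<Longrightarrow> raise_step (A # Cs) (A # Cs')"

text \<open>A letter in column number \<open>p\<close> counts \<open>p\<close> times, so moving it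
  one column to the left lowers the weight by one.\<close>

fun weight :: "nat set list \<Rightarrow> nat" where
  "weight [] = 0"
| "weight (C # Cs) = sum_list (map card Cs) + weight Cs"

definition valid_columns :: "nat set list \<Rightarrow> bool" where
  "valid_columns Cs \<longleftrightarrow> (\<forall>C\<in>set Cs. finite C \<and> C \<subseteq> {2..})"

lemma valid_columns_simps [simp]: "valid_columns []" "valid_columns (C # Cs) \<longleftrightarrow> finite C \<and> C \<subseteq> {2..} \<and> valid_columns Cs"
  by (auto simp: valid_columns_def)

lemma admissible_columns: "valid_columns Cs \<Longrightarrow> admissible (columns_word Cs)"
proof (induction Cs)
  case Nil
  then show ?case by (simp add: admissible_def)
next
  case (Cons C Cs)
  then show ?case by (simp add: admissible_column)
qed

lemma raise_step_spec:
  assumes "raise_step Cs Cs'" "valid_columns Cs"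
  shows "valid_columns Cs' \<and> columns_word Cs \<approx> columns_word Cs' \<and> weight Cs' < weight Cs \<and>
    sum_list (map card Cs') = sum_list (map card Cs)"
  using assms
proof induction
  case (here A B y Cs)
  note y = raising_mem[OF here(1)]
  have fin: "finite A" "finite B" "A \<subseteq> {2..}" "B \<subseteq> {2..}" "valid_columns Cs" using here.prems by auto
  have "columns_word (A # B # Cs) \<approx> columns_word (insert y A # (B - {y}) # Cs)"
    using knuth_append_right[OF knuth_raising[OF fin(1,2) here(1)], of "columns_word Cs"] by simp
  moreover have "valid_columns (insert y A # (B - {y}) # Cs)" using fin y by auto
  moreover have "card B = Suc (card (B - {y}))" using card_Suc_Diff1[OF fin(2) y(1)] by simp
  moreover have "card (insert y A) = Suc (card A)" using y(2) fin(1) by simp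
  ultimately show ?case by simp
next
  case (there Cs Cs' A)
  then have "columns_word Cs \<approx> columns_word Cs'" by simp
  then have "columns_word (A # Cs) \<approx> columns_word (A # Cs')"
    using knuth_append_left[of "columns_word Cs" "columns_word Cs'" "column_word A"] by simp
  moreover have "valid_columns Cs'" "weight Cs' < weight Cs" "sum_list (map card Cs') = sum_list (map card Cs)"
    using there by auto
  ultimately show ?case using there.prems by simp
qed

section \<open>Tuples without moves are the columns of tableaux\<close>

fun dominant :: "nat set list \<Rightarrow> bool" where
  "dominant (A # B # Cs) \<longleftrightarrow> (\<forall>a. cnt B a \<le> cnt A a) \<and> dominant (B # Cs)"
| "dominant _ \<longleftrightarrow> True"

lemma dominant_or_raise_step: "valid_columns Cs \<Longrightarrow> dominant Cs \<or> (\<exists>Cs'. raise_step Cs Cs')"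
proof (induction Cs rule: dominant.induct)
  case (1 A B Cs)
  show ?case
  proof (cases "\<exists>a. hgt A B a \<ge> 1")
    case True
    moreover have "finite B" using "1.prems" by simp
    ultimately obtain y where "raising A B y" using raising_exists by blast
    then show ?thesis using raise_step.here by blast
  next
    case False
    have le: "cnt B a \<le> cnt A a" for a
      using False[simplified, rule_format, of a] by (simp add: hgt_def)
    have "dominant (B # Cs) \<or> (\<exists>Cs'. raise_step (B # Cs) Cs')" using "1.IH" "1.prems" by simp
    then show ?thesis using le raise_step.there[of "B # Cs" _ A] by auto
  qed
qed auto

text \<open>Up to the entry of index \<open>m\<close> in \<open>B\<close>, counted from 0, there are
  \<open>m + 1\<close> letters of \<open>B\<close>, hence at least as many of \<open>A\<close>. This
  turns domination of counts into a comparison entry by entry.\<close>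

lemma dominated_lists:
  assumes "finite A" "finite B" "\<And>a. cnt B a \<le> cnt A a" "m < card B"
  shows "m < card A \<and> sorted_list_of_set A ! m \<le> sorted_list_of_set B ! m"
proof -
  define sA where "sA = sorted_list_of_set A"
  define sB where "sB = sorted_list_of_set B"
  have sA: "sorted sA" "distinct sA" "set sA = A" "length sA = card A" using assms by (auto simp: sA_def)
  have sB: "sorted sB" "distinct sB" "set sB = B" "length sB = card B" using assms by (auto simp: sB_def)
  define b where "b = sB ! m"
  have "set (take (Suc m) sB) \<subseteq> B \<inter> {..b}"
  proof
    fix x assume "x \<in> set (take (Suc m) sB)"
    then obtain n where n: "n < Suc m" "x = sB ! n" using assms(4) sB(4) by (auto simp: in_set_conv_nth)
    then show "x \<in> B \<inter> {..b}"
      using sB assms(4) by (auto simp: b_def sorted_iff_nth_mono intro!: nth_mem[of n sB, unfolded sB(3)])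
  qed
  then have "card (set (take (Suc m) sB)) \<le> card (B \<inter> {..b})" by (intro card_mono) auto
  moreover have "card (set (take (Suc m) sB)) = Suc m"
    using sB assms(4) by (simp add: distinct_card)
  ultimately have "int (Suc m) \<le> cnt A b" using assms(3)[of b] by (simp add: cnt_def)
  then have big: "Suc m \<le> card (A \<inter> {..b})" by (simp add: cnt_def)
  have "m < card A \<and> sA ! m \<le> b"
  proof (rule ccontr)
    assume contra: "\<not> ?thesis"
    have "A \<inter> {..b} \<subseteq> set (take m sA)"
    proof
      fix x assume x: "x \<in> A \<inter> {..b}"
      then obtain n where n: "n < length sA" "x = sA ! n" using sA(3) by (metis IntD1 in_set_conv_nth)
      have "n < m"
      proof (rule ccontr)
        assume "\<not> n < m"
        then have "sA ! m \<le> sA ! n" using sA(1) n(1) by (simp add: sorted_iff_nth_mono)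
        then show False using contra n x sA(4) \<open>\<not> n < m\<close> by auto
      qed
      then show "x \<in> set (take m sA)" using n by (auto simp: in_set_conv_nth)
    qed
    then have "card (A \<inter> {..b}) \<le> card (set (take m sA))" by (intro card_mono) auto
    also have "\<dots> \<le> m" by (rule order.trans[OF card_length]) simp
    finally show False using big by simp
  qed
  then show ?thesis by (simp add: sA_def sB_def b_def)
qed

lemma tab_attach:
  assumes "tab V" "length c = length V" "sorted_wrt (<) c" "\<forall>m < length V. \<forall>r\<in>set (V ! m). c ! m \<le> r"
  shows "tab (map2 (#) c V)"
  using assms
proof (induction V arbitrary: c)
  case (Cons R V)
  then obtain a c' where c: "c = a # c'" by (cases c) auto
  have "tab (map2 (#) c' V)" using Cons.prems c by (intro Cons.IH) fastforce+
  moreover have "above (a # R) (first_row (map2 (#) c' V))"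
    using Cons.prems c by (cases V; cases c') auto
  moreover have "sorted (a # R)" using Cons.prems c by fastforce
  ultimately show ?case unfolding c by (simp add: tab_Cons del: tab.simps)
qed simp

lemma tab_append_empty: "tab V \<Longrightarrow> tab (V @ replicate n [])"
proof (induction n)
  case (Suc n)
  then show ?case using tab_append_Nil[of "V @ replicate n []"]
    by (simp add: replicate_append_same[symmetric])
qed simp

definition first_column :: "tableau \<Rightarrow> nat set" where
  "first_column Q = letter_rank ` set (map hd Q)"

lemma row_word_empty_rows: "row_word (V @ replicate n []) = row_word V"
  by (simp add: row_word_append) (simp add: row_word_def)

lemma attach_exists:
  assumes "finite A" "tab V" "[] \<notin> set V"
    and B: "finite B" "map hd V = map letter_of (sorted_list_of_set B)" "\<And>a. cnt B a \<le> cnt A a"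
  shows "\<exists>Q. tab Q \<and> [] \<notin> set Q \<and> map hd Q = map letter_of (sorted_list_of_set A) \<and>
    row_word (map tl Q) = row_word V \<and> row_word Q \<approx> column_word A @ row_word V"
proof -
  define c where "c = map letter_of (sorted_list_of_set A)"
  define n where "n = card A - length V"
  \<comment> \<open>Padding with empty rows gives each entry of the longer column \<open>c\<close> a
    row to be attached to.\<close>
  define V' where "V' = V @ replicate n []"
  define Q where "Q = map2 (#) c V'"
  have lV: "length V = card B" using arg_cong[OF B(2), of length] by simp
  have dom: "m < card A \<and> sorted_list_of_set A ! m \<le> sorted_list_of_set B ! m" if "m < card B" for m
    using dominated_lists[OF assms(1) B(1) B(3) that] .
  have "card B \<le> card A" using dom[of "card B - 1"] by (cases "card B") auto
  then have len: "length c = length V'" by (simp add: c_def V'_def n_def lV)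
  have le: "c ! m \<le> r" if m: "m < length V'" and r: "r \<in> set (V' ! m)" for m r
  proof -
    have mV: "m < length V" "V' ! m = V ! m"
      using r m by (auto simp: V'_def nth_append split: if_splits)
    have sorted: "sorted (V ! m)" using assms(2) mV(1)
    proof (induction V arbitrary: m)
      case (Cons R V)
      then show ?case by (cases m) (auto simp: tab_Cons simp del: tab.simps)
    qed simp
    have "c ! m \<le> map letter_of (sorted_list_of_set B) ! m"
      using dom[of m] mV lV by (simp add: c_def)
    also have "\<dots> = hd (V ! m)" using mV B(2) by (metis nth_map)
    also have "\<dots> \<le> r" using sorted r mV by (cases "V ! m") auto
    finally show ?thesis .
  qed
  have c: "sorted_wrt (<) c"
    by (auto simp: c_def sorted_wrt_map strict_sorted_list_of_set)
  have tV': "tab V'" using tab_append_empty[OF assms(2)] by (simp add: V'_def)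
  have "map tl Q = V'" "map hd Q = c" using len by (auto simp: Q_def intro!: nth_equalityI)
  moreover have "[] \<notin> set Q" by (auto simp: Q_def)
  moreover have "tab Q" unfolding Q_def using tV' len c le by (intro tab_attach) auto
  moreover have "row_word Q \<approx> rev c @ row_word V'"
    unfolding Q_def using tV' len le by (intro knuth_attach_column) auto
  moreover have "rev c = column_word A" by (simp add: c_def column_word_def rev_map)
  moreover have "row_word V' = row_word V" by (simp add: V'_def row_word_empty_rows)
  ultimately show ?thesis by (intro exI[of _ Q]) (simp add: c_def)
qed

text \<open>The last two conclusions identify the first column and the word of what remains without
  it, so that a deletion from the tuple can be read as one from the tableau.\<close>

lemma dominant_tableau:
  assumes "dominant Cs" "valid_columns Cs"
  shows "\<exists>V. tab V \<and> [] \<notin> set V \<and> row_word V \<approx> columns_word Cs \<and>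
    map hd V = (case Cs of [] \<Rightarrow> [] | A # _ \<Rightarrow> map letter_of (sorted_list_of_set A)) \<and>
    (Cs \<noteq> [] \<longrightarrow> row_word (map tl V) \<approx> columns_word (tl Cs))"
  using assms
proof (induction Cs)
  case Nil
  then show ?case by (intro exI[of _ "[]"]) simp
next
  case (Cons A Cs)
  define B where "B = (case Cs of [] \<Rightarrow> {} | B # _ \<Rightarrow> B)"
  have "dominant Cs" using Cons.prems by (cases Cs) auto
  then obtain V where V: "tab V" "[] \<notin> set V" "row_word V \<approx> columns_word Cs"
    "map hd V = (case Cs of [] \<Rightarrow> [] | A # _ \<Rightarrow> map letter_of (sorted_list_of_set A))"
    using Cons by auto
  have "finite B" using Cons.prems by (cases Cs) (auto simp: B_def)
  moreover have "map hd V = map letter_of (sorted_list_of_set B)"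
    using V(4) by (cases Cs) (auto simp: B_def)
  moreover have "cnt B a \<le> cnt A a" for a
    using Cons.prems by (cases Cs) (auto simp: B_def cnt_def)
  ultimately obtain Q where "tab Q" "[] \<notin> set Q" "map hd Q = map letter_of (sorted_list_of_set A)"
    "row_word (map tl Q) = row_word V" "row_word Q \<approx> column_word A @ row_word V"
    using attach_exists[of A V B] V(1,2) Cons.prems by auto
  then show ?case
    using V(3) knuth_append_left[OF V(3), of "column_word A"]
    by (intro exI[of _ Q]) (auto intro: knuth_trans)
qed

section \<open>Invariance of Berele insertion\<close>

text \<open>Whichever column is split off, \<open>g\<close> takes the same value after its deletion
  as after the deletion from the first column of the Schensted tableau \<open>Q\<close>. The tuple
  is straightened one move at a time, and \<open>g\<close> is compared only on words that have
  already lost a pair.\<close>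

lemma reduction_canonical:
  assumes inv: "\<And>w w'. admissible w \<Longrightarrow> length w < n \<Longrightarrow> w \<approx> w' \<or> reduces w w' \<Longrightarrow> g w = g w'"
    and "valid_columns (A # Cs)" "length (columns_word (A # Cs)) = n" "cancelling A t"
  shows "\<exists>Q t'. tab Q \<and> [] \<notin> set Q \<and> columns_word (A # Cs) \<approx> row_word Q \<and>
    cancelling (first_column Q) t' \<and>
    g (column_word (A - letter_pair t) @ columns_word Cs) =
    g (column_word (first_column Q - letter_pair t') @ row_word (map tl Q))"
  using assms(2-)
proof (induction "weight (A # Cs)" arbitrary: A Cs t rule: less_induct)
  case less
  have fin: "finite A" "A \<subseteq> {2..}" "valid_columns Cs" using less.prems by auto
  note mem = cancelling_mem[OF fin(2) less.prems(3)]
  have "A - letter_pair t \<subset> A" using mem by (auto simp: letter_pair_def)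
  then have smaller: "card (A - letter_pair t) < card A" using fin by (intro psubset_card_mono)
  have adm: "admissible (column_word (A - letter_pair t))"
    using fin by (subst admissible_column) auto
  consider (dominant) "dominant (A # Cs)" | (step) Cs' where "raise_step (A # Cs) Cs'"
    using dominant_or_raise_step less.prems by blast
  then show ?case
  proof cases
    case dominant
    obtain Q where Q: "tab Q" "[] \<notin> set Q" "row_word Q \<approx> columns_word (A # Cs)"
      "map hd Q = map letter_of (sorted_list_of_set A)" "row_word (map tl Q) \<approx> columns_word Cs"
      using dominant_tableau[OF dominant less.prems(1)] by auto
    have "first_column Q = letter_rank ` letter_of ` A"
      unfolding first_column_def Q(4) using fin by simp
    then have fc: "first_column Q = A" by (simp add: image_image)
    have "g (column_word (A - letter_pair t) @ columns_word Cs)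
        = g (column_word (A - letter_pair t) @ row_word (map tl Q))"
      using adm admissible_columns[OF fin(3)] less.prems(2) smaller
      by (intro inv disjI1 knuth_append_left knuth_sym[OF Q(5)]) auto
    then show ?thesis using Q fc less.prems(3) by (intro exI[of _ Q] exI[of _ t]) (auto intro: knuth_sym)
  next
    case step
    note spec = raise_step_spec[OF step less.prems(1)]
    have lenCs: "length (columns_word Ds) = sum_list (map card Ds)" for Ds
      by (induction Ds) auto
    from step show ?thesis
    proof cases
      \<comment> \<open>A move between later columns leaves \<open>A\<close>, and with it the
        deletion, untouched.\<close>
      case (there Ds)
      note spec' = raise_step_spec[OF there(2) fin(3)]
      have "g (column_word (A - letter_pair t) @ columns_word Cs)
          = g (column_word (A - letter_pair t) @ columns_word Ds)"
        using adm admissible_columns[OF fin(3)] less.prems(2) smaller spec'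
        by (intro inv disjI1 knuth_append_left) auto
      moreover have "\<exists>Q t'. tab Q \<and> [] \<notin> set Q \<and> columns_word (A # Ds) \<approx> row_word Q \<and>
        cancelling (first_column Q) t' \<and> g (column_word (A - letter_pair t) @ columns_word Ds) =
        g (column_word (first_column Q - letter_pair t') @ row_word (map tl Q))"
        using spec there less.prems lenCs by (intro less.hyps) auto
      ultimately show ?thesis using spec there(1) knuth_trans by metis
    next
      case (here B y Ds)
      define v where "v = columns_word Ds"
      have B: "finite B" "B \<subseteq> {2..}" "valid_columns Ds" using fin here by auto
      have y: "y \<notin> A" using raising_mem[OF here(3)] by simp
      have A': "finite (insert y A)" "insert y A \<subseteq> {2..}" using spec here(2) by auto
      \<comment> \<open>A letter moved into the first column only lifts its excess, so a deletion
        stays possible.\<close>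
      have "excess (insert y A) t \<ge> 1"
        using less.prems(3) y by (simp add: cancelling_def excess_insert)
      then obtain t' where t': "cancelling (insert y A) t'"
        using cancelling_exists[OF A'] by blast
      have n: "card A + card B + length v = n" using less.prems(2) here(1) by (simp add: v_def)
      \<comment> \<open>The confluence of two columns is applied to \<open>g\<close> with the later
        columns as a fixed right context \<open>v\<close>.\<close>
      have "(\<lambda>A B. g (column_word A @ column_word B @ v)) (A - letter_pair t) B
          = (\<lambda>A B. g (column_word A @ column_word B @ v)) (insert y A - letter_pair t') (B - {y})"
      proof (rule two_column_confluence[where N = "card A + card B"])
        fix A1 B1 y1 assume sm: "small (card A + card B) A1 B1" and r: "raising A1 B1 y1"
        have f1: "finite A1" "finite B1" "A1 \<subseteq> {2..}" "B1 \<subseteq> {2..}" "card A1 + card B1 < card A + card B"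
          using sm by (auto simp: small_def)
        have "(column_word A1 @ column_word B1) @ v
            \<approx> (column_word (insert y1 A1) @ column_word (B1 - {y1})) @ v"
          using knuth_raising[OF f1(1,2) r] by (rule knuth_append_right)
        then show "g (column_word A1 @ column_word B1 @ v)
            = g (column_word (insert y1 A1) @ column_word (B1 - {y1}) @ v)"
          using f1 n admissible_columns[OF B(3)]
          by (intro inv disjI1) (auto simp: admissible_column v_def)
      next
        fix A1 B1 t1 assume sm: "small (card A + card B) A1 B1" and r: "cancelling A1 t1"
        have f1: "finite A1" "finite B1" "A1 \<subseteq> {2..}" "B1 \<subseteq> {2..}" "card A1 + card B1 < card A + card B"
          using sm by (auto simp: small_def)
        have "reduces (column_word A1 @ column_word B1 @ v) (column_word (A1 - letter_pair t1) @ column_word B1 @ v)"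
          unfolding reduces_def using f1 r by blast
        then show "g (column_word A1 @ column_word B1 @ v)
            = g (column_word (A1 - letter_pair t1) @ column_word B1 @ v)"
          using f1 n admissible_columns[OF B(3)]
          by (intro inv disjI2) (auto simp: admissible_column v_def)
      qed (use fin B here(3) less.prems(3) t' in auto)
      moreover have "\<exists>Q s. tab Q \<and> [] \<notin> set Q \<and> columns_word (insert y A # (B - {y}) # Ds) \<approx> row_word Q \<and>
        cancelling (first_column Q) s \<and>
        g (column_word (insert y A - letter_pair t') @ columns_word ((B - {y}) # Ds)) =
        g (column_word (first_column Q - letter_pair s) @ row_word (map tl Q))"
        using spec here less.prems lenCs t' by (intro less.hyps) (simp_all del: weight.simps columns_word_simps)
      ultimately show ?thesis using spec here(1,2) knuth_trans unfolding v_def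
        by (metis columns_word_simps(2))
    qed
  qed
qed

lemma reduces_canonical:
  assumes inv: "\<And>w w'. admissible w \<Longrightarrow> length w < length u \<Longrightarrow> w \<approx> w' \<or> reduces w w' \<Longrightarrow> g w = g w'"
    and u: "admissible u" "reduces u u1"
  shows "\<exists>Q t'. tab Q \<and> [] \<notin> set Q \<and> u \<approx> row_word Q \<and> cancelling (first_column Q) t' \<and>
    g u1 = g (column_word (first_column Q - letter_pair t') @ row_word (map tl Q))"
proof -
  obtain A v t where A: "finite A" "A \<subseteq> {2..}" "cancelling A t" "u \<approx> column_word A @ v"
      "u1 \<approx> column_word (A - letter_pair t) @ v"
    using u(2) unfolding reduces_def by blast
  \<comment> \<open>The letters of \<open>v\<close> serve as columns of one letter each; their order
    is the order of the word.\<close>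
  define Cs where "Cs = map (\<lambda>a. {letter_rank a}) v"
  have Cs: "columns_word Cs = v" unfolding Cs_def
    by (induction v) (auto simp: column_word_def)
  have "admissible v" using u(1) admissible_knuth[OF A(4)] by simp
  then have "valid_columns (A # Cs)" using A by (auto simp: valid_columns_def Cs_def admissible_def letter_le_iff)
  moreover have "length (columns_word (A # Cs)) = length u" using knuth_length[OF A(4)] Cs by simp
  ultimately obtain Q t' where Q: "tab Q" "[] \<notin> set Q" "columns_word (A # Cs) \<approx> row_word Q"
    "cancelling (first_column Q) t'"
    "g (column_word (A - letter_pair t) @ columns_word Cs) =
      g (column_word (first_column Q - letter_pair t') @ row_word (map tl Q))"
    using reduction_canonical[of "length u" g A Cs t] inv A(3) by blast
  have "g u1 = g (column_word (A - letter_pair t) @ columns_word Cs)"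
    using reduces_length[OF u(2)] reduces_set[OF u(2)] u(1) A(5) Cs
    by (intro inv) (auto simp: admissible_def)
  then show ?thesis using Q A(4) Cs knuth_trans by (metis columns_word_simps(2))
qed

section \<open>King tableaux as unique normal forms\<close>

text \<open>With a constant \<open>g\<close>, \<open>reduces_canonical\<close> still shows that the
  first column of the Schensted tableau of \<open>u\<close> admits a deletion. By uniqueness this
  tableau is \<open>T\<close>, whose first column has no positive excess.\<close>

lemma king_irreducible:
  assumes "king 1 T" "u \<approx> row_word T" "reduces u u1"
  shows False
proof -
  have "admissible u"
    using king_entries[OF assms(1)] knuth_set[OF assms(2)] by (auto simp: admissible_def)
  then obtain Q t where Q: "tab Q" "[] \<notin> set Q" "u \<approx> row_word Q" "cancelling (first_column Q) t"
    using reduces_canonical[of u "\<lambda>_. ()" u1] assms(3) by auto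
  have "row_word Q \<approx> row_word T" using Q(3) assms(2) knuth_sym knuth_trans by blast
  then have "Q = T" using tab_unique Q(1,2) king_tab[OF assms(1)] king_nonempty[OF assms(1)] by blast
  have "count_upto (map hd T) t \<le> t" "sorted_wrt (<) (map hd T)"
    using first_column_bound[OF assms(1)] by auto
  then have "excess (first_column T) t \<le> 0"
    using cnt_eq_count_upto[of "map hd T" t] by (simp add: excess_def first_column_def)
  then show False using Q(4) \<open>Q = T\<close> by (simp add: cancelling_def)
qed

lemma reach_invariant:
  assumes "reach w w'" "admissible w" "length w < n"
    and inv: "\<And>w w'. admissible w \<Longrightarrow> length w < n \<Longrightarrow> w \<approx> w' \<or> reduces w w' \<Longrightarrow> g w = g w'"
  shows "g w = g w'"
proof -
  have "g w = g w' \<and> admissible w' \<and> length w' < n"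
    using assms(1)
  proof (induction rule: rtranclp_induct)
    case base
    then show ?case using assms by simp
  next
    case (step u v)
    then have "g u = g v" using inv by blast
    moreover have "admissible v"
      using step admissible_knuth reduces_set[of u v] by (auto simp: admissible_def)
    moreover have "length v \<le> length u"
      using step.hyps(2) knuth_length reduces_length by fastforce
    ultimately show ?case using step.IH by simp
  qed
  then show ?thesis ..
qed

text \<open>By irreducibility, inserting the row word involves no deletion, so the result lies in
  the Knuth class of \<open>T\<close> and equals \<open>T\<close>.\<close>

lemma P_C_row_word:
  assumes "king 1 T"
  shows "P_C (row_word T) = T"
proof -
  have adm: "admissible (row_word T)" using king_entries[OF assms] by (auto simp: admissible_def)
  have P: "king 1 (P_C (row_word T))" "reach (row_word T) (row_word (P_C (row_word T)))"
    using reach_P_C[OF adm] by auto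
  have "row_word T \<approx> row_word (P_C (row_word T))"
    using reach_cases[OF P(2)] king_irreducible[OF assms knuth_refl] by blast
  then show ?thesis
    using tab_unique king_tab king_nonempty assms P(1) by metis
qed

text \<open>Induction on the length makes \<open>P_C\<close> an admissible \<open>g\<close> for
  shorter words. Then \<open>same\<close> is confluence at \<open>w\<close>, and
  \<open>reduced\<close> compares a given deletion with the one that insertion itself
  performs.\<close>

lemma P_C_step: "admissible w \<Longrightarrow> w \<approx> w' \<or> reduces w w' \<Longrightarrow> P_C w = P_C w'"
proof (induction "length w" arbitrary: w w' rule: less_induct)
  case less
  have inv: "P_C v = P_C v'" if "admissible v" "length v < length w" "v \<approx> v' \<or> reduces v v'" for v v'
    using less.hyps that by blast
  have canonical: "\<exists>Q t'. tab Q \<and> [] \<notin> set Q \<and> w \<approx> row_word Q \<and> cancelling (first_column Q) t' \<and>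
      P_C u = P_C (column_word (first_column Q - letter_pair t') @ row_word (map tl Q))"
    if "reduces w u" for u
    by (rule reduces_canonical[OF _ less.prems(1) that]) (rule inv)
  have same: "P_C u1 = P_C u2" if u1: "reduces w u1" and u2: "reduces w u2" for u1 u2
  proof -
    obtain Q1 t1 where Q1: "tab Q1" "[] \<notin> set Q1" "w \<approx> row_word Q1" "cancelling (first_column Q1) t1"
      "P_C u1 = P_C (column_word (first_column Q1 - letter_pair t1) @ row_word (map tl Q1))"
      using canonical[OF u1] by blast
    obtain Q2 t2 where Q2: "tab Q2" "[] \<notin> set Q2" "w \<approx> row_word Q2" "cancelling (first_column Q2) t2"
      "P_C u2 = P_C (column_word (first_column Q2 - letter_pair t2) @ row_word (map tl Q2))"
      using canonical[OF u2] by blast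
    have "row_word Q1 \<approx> row_word Q2" using Q1(3) Q2(3) knuth_sym knuth_trans by blast
    then have "Q1 = Q2" using tab_unique Q1(1,2) Q2(1,2) by blast
    then have "t1 = t2" using Q1(4) Q2(4) cancelling_unique by metis
    then show ?thesis using Q1(5) Q2(5) \<open>Q1 = Q2\<close> by simp
  qed
  have reduced: "P_C u = P_C u1" if red: "reduces u u1" and uw: "u \<approx> w" for u u1
  proof -
    have "admissible u" using admissible_knuth[OF uw] less.prems(1) by simp
    then have "king 1 (P_C u) \<and> reach u (row_word (P_C u))" by (rule reach_P_C)
    then have P: "king 1 (P_C u)" "reach u (row_word (P_C u))" by (rule conjunct1, rule conjunct2)
    \<comment> \<open>A word that admits a deletion is not in the Knuth class of a King tableau. So
      insertion performs a deletion too, and \<open>u2\<close> is the word after the first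
      one.\<close>
    have "\<not> u \<approx> row_word (P_C u)" using king_irreducible[OF P(1) _ red] by blast
    then obtain u2 where u2: "reduces u u2" "reach u2 (row_word (P_C u))"
      using reach_cases[OF P(2)] by blast
    have "admissible u2" using reduces_set[OF u2(1)] \<open>admissible u\<close> by (auto simp: admissible_def)
    moreover have "length u2 < length w"
      using reduces_length[OF u2(1)] knuth_length[OF uw] by simp
    ultimately have "P_C u2 = P_C (row_word (P_C u))"
      by (intro reach_invariant[OF u2(2), of "length w" P_C] inv)
    also have "\<dots> = P_C u" using P_C_row_word[OF P(1)] .
    finally have "P_C u = P_C u2" ..
    moreover have "P_C u2 = P_C u1"
      by (rule same) (rule reduces_knuth_left[OF knuth_sym[OF uw]], fact)+
    ultimately show ?thesis by simp
  qed
  from less.prems(2) show ?case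
  proof
    assume "reduces w w'"
    then show ?thesis by (rule reduced) simp
  next
    assume ww': "w \<approx> w'"
    show ?thesis
    proof (cases "\<exists>w1. reduces w w1")
      case True
      then obtain w1 where w1: "reduces w w1" by blast
      then have "reduces w' w1" by (rule reduces_knuth_left[OF knuth_sym[OF ww']])
      then have "P_C w' = P_C w1" by (rule reduced) (rule knuth_sym[OF ww'])
      then show ?thesis using reduced[OF w1] by simp
    next
      \<comment> \<open>Without deletions both insertions stay in the common Knuth class, which
        contains one tableau only.\<close>
      case False
      then have irred: "\<not> reduces w u" "\<not> reduces w' u" for u
        using reduces_knuth_left[OF ww'] by blast+
      have adm': "admissible w'" using admissible_knuth[OF ww'] less.prems(1) by simp
      have P: "king 1 (P_C w)" "king 1 (P_C w')"
        using reach_P_C[OF less.prems(1)] reach_P_C[OF adm'] by (blast intro: conjunct1)+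
      have "w \<approx> row_word (P_C w)" "w' \<approx> row_word (P_C w')"
        using reach_cases[of w "row_word (P_C w)"] reach_cases[of w' "row_word (P_C w')"]
          reach_P_C[OF less.prems(1)] reach_P_C[OF adm'] irred by meson+
      then have "row_word (P_C w) \<approx> row_word (P_C w')"
        using ww' knuth_sym knuth_trans by meson
      then show ?thesis
        by (intro tab_unique king_tab[OF P(1)] king_tab[OF P(2)] king_nonempty[OF P(1)] king_nonempty[OF P(2)])
    qed
  qed
qed

section \<open>King tableaux\<close>

lemma mem_alphabet_iff: "a \<in> alphabet k \<longleftrightarrow> Plain 1 \<le> a \<and> a \<le> Barred k"
  by (cases a) (auto simp: alphabet_def letter_le_iff)

lemma words_iff: "w \<in> words k \<longleftrightarrow> set w \<subseteq> alphabet k"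
  by (auto simp: words_def)

lemma words_admissible: "w \<in> words k \<Longrightarrow> admissible w"
  by (auto simp: words_iff admissible_def mem_alphabet_iff)

lemma set_row_word: "set (row_word T) = (\<Union>R\<in>set T. set R)"
  by (simp add: row_word_def)

lemma king_lengths: "king i T \<Longrightarrow> is_partition (map length T)"
proof (induction T arbitrary: i)
  case Nil
  then show ?case by (simp add: is_partition_def)
next
  case (Cons R Rs)
  have IH: "is_partition (map length Rs)" using Cons.IH[of "Suc i"] Cons.prems by simp
  have "length (first_row Rs) \<le> length R" using Cons.prems above_length by simp
  then have "\<forall>R'\<in>set Rs. length R' \<le> length R"
    using IH by (cases Rs) (auto simp: is_partition_def)
  then show ?case using IH Cons.prems by (auto simp: is_partition_def)
qed

lemma king_columns:
  "king i T \<Longrightarrow> Suc m < length T \<Longrightarrow> j < length (T ! Suc m) \<Longrightarrow> T ! m ! j < T ! Suc m ! j"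
proof (induction T arbitrary: i m)
  case (Cons R Rs)
  show ?case
  proof (cases m)
    case 0
    then show ?thesis using Cons.prems by (cases Rs) (auto simp: above_def)
  next
    case (Suc m')
    then show ?thesis using Cons.IH[of "Suc i" m'] Cons.prems by simp
  qed
qed simp

lemma king_rows: "king i T \<Longrightarrow> m < length T \<Longrightarrow> a \<in> set (T ! m) \<Longrightarrow> Plain (m + i) \<le> a"
proof (induction T arbitrary: i m)
  case (Cons R Rs)
  show ?case
  proof (cases m)
    case 0
    then show ?thesis using Cons.prems by simp
  next
    case (Suc m')
    then show ?thesis using Cons.IH[of "Suc i" m'] Cons.prems by simp
  qed
qed simp

lemma kingI:
  assumes "is_partition (map length T)" "\<forall>R\<in>set T. sorted R"
    "\<And>m j. Suc m < length T \<Longrightarrow> j < length (T ! Suc m) \<Longrightarrow> T ! m ! j < T ! Suc m ! j"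
    "\<And>m a. m < length T \<Longrightarrow> a \<in> set (T ! m) \<Longrightarrow> Plain (m + i) \<le> a"
  shows "king i T"
  using assms
proof (induction T arbitrary: i)
  case (Cons R Rs)
  have "king (Suc i) Rs"
  proof (rule Cons.IH)
    show "is_partition (map length Rs)" using Cons.prems(1) by (simp add: is_partition_def)
    show "\<forall>R\<in>set Rs. sorted R" using Cons.prems(2) by simp
    show "Rs ! m ! j < Rs ! Suc m ! j" if "Suc m < length Rs" "j < length (Rs ! Suc m)" for m j
      using Cons.prems(3)[of "Suc m" j] that by simp
    show "Plain (m + Suc i) \<le> a" if "m < length Rs" "a \<in> set (Rs ! m)" for m a
      using Cons.prems(4)[of "Suc m" a] that by simp
  qed
  moreover have "above R (first_row Rs)"
    using Cons.prems(1) Cons.prems(3)[of 0] by (cases Rs) (auto simp: is_partition_def above_def)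
  moreover have "\<forall>a\<in>set R. Plain i \<le> a" using Cons.prems(4)[of 0] by simp
  ultimately show ?case using Cons.prems(1,2) by (auto simp: is_partition_def)
qed simp

lemma king_tableaux_iff: "T \<in> king_tableaux k \<longleftrightarrow> king 1 T \<and> row_word T \<in> words k"
proof
  assume "T \<in> king_tableaux k"
  then have T: "is_partition (map length T)" "\<forall>R\<in>set T. set R \<subseteq> alphabet k" "\<forall>R\<in>set T. sorted R"
    "\<forall>i j. Suc i < length T \<longrightarrow> j < length (T ! Suc i) \<longrightarrow> T ! i ! j < T ! Suc i ! j"
    "\<forall>i < length T. \<forall>a \<in> set (T ! i). Plain (i + 1) \<le> a"
    by (auto simp: king_tableaux_def king_tableaux_of_shape_def)
  show "king 1 T \<and> row_word T \<in> words k"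
    using kingI[OF T(1,3), of 1] T by (auto simp: words_iff set_row_word)
next
  assume T: "king 1 T \<and> row_word T \<in> words k"
  have "\<forall>R\<in>set T. sorted R"
  proof -
    have "tab T" using T king_tab by blast
    then show ?thesis by (induction T) (auto simp: tab_Cons simp del: tab.simps)
  qed
  then show "T \<in> king_tableaux k"
    using T king_lengths[of 1 T] king_columns[of 1 T] king_rows[of 1 T]
    by (auto simp: king_tableaux_def king_tableaux_of_shape_def words_iff set_row_word)
qed

section \<open>Type C Knuth equivalence\<close>

lemma equiv_A_iff: "equiv_A k w w' \<longleftrightarrow> w \<in> words k \<and> w \<approx> w'"
  unfolding equiv_A_def words_iff using knuth_set by blast

lemma step_C_P_C:
  assumes "step_C k w w'"
  shows "P_C w = P_C w'"
proof -
  have w: "w \<in> words k" "w' \<in> words k" "w \<approx> w' \<or> equiv_5 k w w'"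
    using assms by (auto simp: step_C_def intro: knuth_sym)
  then have adm: "admissible w" "admissible w'" using words_admissible by auto
  from w(3) show ?thesis
  proof
    assume "w \<approx> w'"
    then show ?thesis using P_C_step adm by blast
  next
    assume "equiv_5 k w w'"
    then obtain v c c' where c: "w \<approx> c @ v" "w' \<approx> c' @ v" "P_C c = P_C c'"
      unfolding equiv_5_def equiv_A_iff by blast
    have "P_C w = P_C (c @ v)" using P_C_step[OF adm(1)] c(1) by blast
    \<comment> \<open>\<open>P_C\<close> is a left fold, so a prefix acts only through its own
      tableau.\<close>
    also have "\<dots> = P_C (c' @ v)" using c(3) by (simp add: P_C_def)
    also have "\<dots> = P_C w'" using P_C_step[OF adm(2)] c(2) by metis
    finally show ?thesis .
  qed
qed

lemma equiv_C_P_C: "equiv_C k w w' \<Longrightarrow> P_C w = P_C w'"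
proof -
  assume "equiv_C k w w'"
  then have "(step_C k)\<^sup>*\<^sup>* w w'" by (simp add: equiv_C_def)
  then show ?thesis by (induction rule: rtranclp_induct) (auto dest: step_C_P_C)
qed

lemma knuth_step_C:
  assumes "w \<in> words k" "w \<approx> w'"
  shows "(step_C k)\<^sup>*\<^sup>* w w'"
  using assms(2)
proof (induction rule: equivclp_induct)
  case (step y z)
  have "y \<in> words k" using knuth_set[OF step.hyps(1)] assms(1) by (simp add: words_iff)
  moreover have "y \<approx> z" using step.hyps(2) by auto
  then have "z \<in> words k" using knuth_set calculation by (simp add: words_iff)
  ultimately have "step_C k y z" using step.hyps(2) by (auto simp: step_C_def)
  with step.IH show ?case by (rule rtranclp.rtrancl_into_rtrancl)
qed simp

text \<open>A deletion is an instance of \<open>equiv_5\<close>: invariance under deletion, applied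
  to the column words alone, gives them the same \<open>P_C\<close>.\<close>

lemma reduces_step_C:
  assumes "w \<in> words k" "reduces w w'"
  shows "step_C k w w'"
proof -
  obtain A v t where A: "finite A" "A \<subseteq> {2..}" "cancelling A t" "w \<approx> column_word A @ v"
      "w' \<approx> column_word (A - letter_pair t) @ v"
    using assms(2) unfolding reduces_def by blast
  have w': "w' \<in> words k" using assms reduces_set by (auto simp: words_iff)
  have words: "column_word A \<in> words k" "v \<in> words k"
    using knuth_set[OF A(4)] assms(1) by (auto simp: words_iff)
  then have "column_word (A - letter_pair t) \<in> words k"
    using A(1) by (auto simp: words_iff set_column_word)
  moreover have "sorted_wrt (>) (column_word B)" for B
  proof -
    have "sorted_wrt (<) (sorted_list_of_set B)" by (rule strict_sorted_list_of_set)
    then show ?thesis by (simp add: column_word_def sorted_wrt_map sorted_wrt_rev)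
  qed
  moreover have "reduces (column_word A @ []) (column_word (A - letter_pair t) @ [])"
    unfolding reduces_def using A by blast
  then have "P_C (column_word A) = P_C (column_word (A - letter_pair t))"
    using P_C_step[of "column_word A"] A(1,2) by (simp add: admissible_column)
  ultimately have "equiv_5 k w w'"
    unfolding equiv_5_def equiv_A_iff column_words_def using words assms(1) w' A(4,5) by blast
  then show ?thesis using assms(1) w' by (simp add: step_C_def)
qed

lemma reach_step_C:
  assumes "w \<in> words k" "reach w w'"
  shows "w' \<in> words k \<and> (step_C k)\<^sup>*\<^sup>* w w'"
  using assms(2)
proof (induction rule: rtranclp_induct)
  case (step u v)
  have "v \<in> words k"
    using step knuth_set[of u v] reduces_set[of u v] by (auto simp: words_iff)
  moreover have "(step_C k)\<^sup>*\<^sup>* u v"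
    using step knuth_step_C reduces_step_C by blast
  ultimately show ?case using step.IH by (meson rtranclp_trans)
qed (use assms in simp)

theorem theorem3p17:
  fixes k :: nat and w :: "letter list"
  assumes "k \<ge> 1" and "w \<in> words k"
  shows "(\<exists>!T. T \<in> king_tableaux k \<and> equiv_C k w (row_word T))
       \<and> (\<forall>T. T \<in> king_tableaux k \<and> equiv_C k w (row_word T) \<longrightarrow> T = P_C w)"
proof -
  have P: "king 1 (P_C w)" "reach w (row_word (P_C w))"
    using reach_P_C[OF words_admissible[OF assms(2)]] by auto
  then have "P_C w \<in> king_tableaux k" "equiv_C k w (row_word (P_C w))"
    using reach_step_C[OF assms(2) P(2)] assms(2) by (auto simp: king_tableaux_iff equiv_C_def)
  moreover have unique: "T = P_C w" if "T \<in> king_tableaux k" "equiv_C k w (row_word T)" for T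
    using equiv_C_P_C[OF that(2)] P_C_row_word[of T] that(1) by (simp add: king_tableaux_iff)
  ultimately show ?thesis by blast
qed

end
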